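(* Let $n\ge 0$, let $C_0,\ldots,C_n\in\mathcal{P}(\mathbb{R}^d)$ be polyhedral cones, let $T_0,\ldots,T_n\in O(d)$, and let $0\le k\le d$. Furthermore, let $F(X_0,\ldots,X_n)$ be a Boolean read-once formula. Then for $Q_0,\ldots,Q_n\in O(d)$ independent and uniformly at random, $$\mathbb{E}\Big[ v_k\Big( F\big(T_0Q_0 C_0,\ldots,T_nQ_n C_n\big) \Big)\Big] = \sum_{\dim^F_d(k_0,\ldots,k_n)=k} v_{k_0}(C_0) \cdots v_{k_n}(C_n),$$ where the sum is over all $(k_0,\ldots,k_n)\in\{0,\ldots,d\}^{n+1}$ with $\dim^F_d(k_0,\ldots,k_n)=k$.
   Context: A polyhedral cone in $\mathbb{R}^d$ is a set of the form $\{x\in\mathbb{R}^d : Ax\le 0\}$ for some real matrix $A$ with $d$ columns; $\mathcal{P}(\mathbb{R}^d)$ is the set of polyhedral cones in $\mathbb{R}^d$. A face of $C\in\mathcal{P}(\mathbb{R}^d)$ is a subset of the form $F=\{x\in C: \langle x,z\rangle=0\}$, where $z\in\mathbb{R}^d$ satisfies $\langle x,z\rangle\le 0$ for all $x\in C$ (in particular $C$ itself is a face). $\mathcal{L}_k(C)$ is the (finite) set of linear spans of faces of $C$ whose span has dimension $k$. The polar cone is $C^\circ=\{z: \langle x,z\rangle\le 0 \text{ for all } x\in C\}$. For a linear subspace $L$, $\gamma_L$ denotes the standard Gaussian measure on $L$ (the Dirac measure at the origin if $\dim L=0$). The $k$th conic intrinsic volume is $$v_k(C)=\sum_{L\in\mathcal{L}_k(C)}\gamma_L(C\cap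 L)\,\gamma_{L^\perp}(C^\circ\cap L^\perp),\qquad 0\le k\le d.$$ "Uniformly at random" in $O(d)$ means distributed according to the normalized Haar measure. A Boolean formula in variables $X_0,\ldots,X_n$ is built from the variables with $\wedge,\vee,\neg$; it is read-once if every variable appears at most once. For cones $C_0,\ldots,C_n$, the evaluation $F(C_0,\ldots,C_n)\in\mathcal{P}(\mathbb{R}^d)$ is obtained by replacing $X_i$ by $C_i$, $\wedge$ by intersection $\cap$, $\vee$ by Minkowski sum $+$, and $\neg(\cdots)$ by the polar $(\cdots)^\circ$. For a read-once formula $F$, the function $\dim^F_d:\{0,\ldots,d\}^{n+1}\to\{0,\ldots,d\}$ is defined by $\dim_d^F(k_0,\ldots,k_n)=\dim F(L_0,\ldots,L_n)$, where $L_0,\ldots,L_n\subseteq\mathbb{R}^d$ are linear subspaces in general position with $\dim L_i=k_i$; i.e. it is the dimension of $F(L_0,\ldots,L_n)$ for almost all such tuples of subspaces (with respect to the rotation-invariant measures). Equivalently, it is computed recursively: a variable $X_i$ has dimension $k_i$; $\neg$ sends dimension $a$ to $d-a$; $\wedge$ sends $(a,b)$ to $\max\{0,a+b-d\}$; and $\vee$ sends $(a,b)$ to $\min\{d,a+b\}$. *)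

theory Defs
  imports "HOL-Probability.Probability"
begin

text \<open>The vectors \<open>a 0, \<dots>, a (m - 1)\<close> are the rows of the matrix \<open>A\<close> in \<open>{x. A x \<le> 0}\<close>.\<close>

definition polyhedral_cone :: "(real^'d) set \<Rightarrow> bool" where
  "polyhedral_cone C \<longleftrightarrow> (\<exists>(m::nat) (a :: nat \<Rightarrow> real^'d). C = {x. \<forall>i<m. a i \<bullet> x \<le> 0})"

definition cone_face :: "(real^'d) set \<Rightarrow> (real^'d) set \<Rightarrow> bool" where
  "cone_face F C \<longleftrightarrow> (\<exists>z. (\<forall>x\<in>C. x \<bullet> z \<le> 0) \<and> F = {x \<in> C. x \<bullet> z = 0})"

definition face_spans :: "nat \<Rightarrow> (real^'d) set \<Rightarrow> (real^'d) set set" where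
  "face_spans k C = {span F | F. cone_face F C \<and> dim (span F) = k}"

definition polar_cone :: "(real^'d) set \<Rightarrow> (real^'d) set" where
  "polar_cone C = {z. \<forall>x\<in>C. x \<bullet> z \<le> 0}"

definition onb_of :: "(real^'d) set \<Rightarrow> (real^'d) set" where
  "onb_of L = (SOME B. pairwise orthogonal B \<and> (\<forall>b\<in>B. norm b = 1) \<and> span B = L)"

text \<open>
  The law of a vector of \<open>L\<close> whose coordinates in an orthonormal basis are independent standard
  normal variables; it does not depend on the chosen basis. For \<open>L = {0}\<close> the basis is empty, and
  the result is the Dirac measure at the origin. The measure lives on the Borel sets of the ambient
  space and is supported on \<open>L\<close>. The parameter \<open>L\<close> is meant to be a linear subspace.
\<close>

definition gaussian_on :: "(real^'d) set \<Rightarrow> (real^'d) measure" where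
  "gaussian_on L =
     distr (PiM (onb_of L) (\<lambda>_. density lborel std_normal_density)) borel
           (\<lambda>g. \<Sum>b\<in>onb_of L. g b *\<^sub>R b)"

definition intrinsic_volume :: "nat \<Rightarrow> (real^'d) set \<Rightarrow> real" where
  "intrinsic_volume k C =
     (\<Sum>L\<in>face_spans k C.
        measure (gaussian_on L) (C \<inter> L) *
        measure (gaussian_on (orthogonal_comp L)) (polar_cone C \<inter> orthogonal_comp L))"

definition orthogonal_group :: "(real^'d^'d) measure" where
  "orthogonal_group = restrict_space borel {Q. orthogonal_matrix Q}"

definition normalized_haar :: "(real^'d^'d) measure \<Rightarrow> bool" where
  "normalized_haar H \<longleftrightarrow>
     prob_space H \<and> sets H = sets orthogonal_group \<and>
     (\<forall>U. orthogonal_matrix U \<longrightarrow> distr H H (\<lambda>Q. U ** Q) = H)"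

datatype formula = Var nat | Neg formula | And formula formula | Or formula formula

fun var_list :: "formula \<Rightarrow> nat list" where
  "var_list (Var i) = [i]"
| "var_list (Neg F) = var_list F"
| "var_list (And F G) = var_list F @ var_list G"
| "var_list (Or F G) = var_list F @ var_list G"

definition read_once :: "formula \<Rightarrow> bool" where
  "read_once F \<longleftrightarrow> distinct (var_list F)"

text \<open>The \<open>+\<close> below is the Minkowski sum of sets.\<close>

fun eval_formula :: "formula \<Rightarrow> (nat \<Rightarrow> (real^'d) set) \<Rightarrow> (real^'d) set" where
  "eval_formula (Var i) C = C i"
| "eval_formula (Neg F) C = polar_cone (eval_formula F C)"
| "eval_formula (And F G) C = eval_formula F C \<inter> eval_formula G C"
| "eval_formula (Or F G) C = eval_formula F C + eval_formula G C"

text \<open>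
  The generic dimension \<open>dim\<^sup>F\<^sub>d(k\<^sub>0, \<dots>, k\<^sub>n)\<close>, for \<open>d = CARD('d)\<close> and
  \<open>k\<^sub>i \<le> d\<close>: the number \<open>m\<close> such that \<open>F(L\<^sub>0, \<dots>, L\<^sub>n)\<close> has dimension \<open>m\<close> for
  almost all tuples of linear subspaces of dimensions \<open>k\<^sub>0, \<dots>, k\<^sub>n\<close>. The
  rotation-invariant measure on \<open>k\<close>-dimensional subspaces is the law of \<open>Q L\<close>, where \<open>L\<close> is any
  fixed such subspace and \<open>Q\<close> is distributed according to the Haar measure. The first argument
  only carries the dimension of the ambient space.
\<close>

definition generic_dim :: "'d::finite itself \<Rightarrow> formula \<Rightarrow> nat \<Rightarrow> (nat \<Rightarrow> nat) \<Rightarrow> nat" where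
  "generic_dim _ F n k = (THE m.
     \<forall>(H :: (real^'d^'d) measure) (L :: nat \<Rightarrow> (real^'d) set).
       normalized_haar H \<longrightarrow> (\<forall>i\<le>n. subspace (L i) \<and> dim (L i) = k i) \<longrightarrow>
       (AE Q in PiM {..n} (\<lambda>_. H). dim (eval_formula F (\<lambda>i. (*v) (Q i) ` L i)) = m))"

end

theory Submission
  imports Defs
begin

text \<open>
The intrinsic volumes of a polyhedral cone \<open>C\<close> describe its metric projection. Let \<open>g\<close> be a standard
  Gaussian vector. Almost surely there is exactly one face span \<open>L\<close> for which the orthogonal
  projections of \<open>g\<close> to \<open>L\<close> and to its orthogonal complement lie in \<open>C\<close> and in the polar of \<open>C\<close>
  (lemma \<open>AE_unique_tile\<close>), and then the projection of \<open>g\<close> to \<open>C\<close> is its projection to \<open>L\<close>. Thus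
  \<open>v\<^sub>k(C)\<close> is the probability that \<open>dim L = k\<close>. The length of a Gaussian vector is independent of its
  direction, and \<open>C\<close> is a cone, so the projection \<open>x\<close> of \<open>g\<close> to \<open>C\<close> satisfies
  \<open>E exp(- s |x|\<^sup>2) = \<Sum>k. v\<^sub>k(C) u ^ k\<close>, where \<open>1 / u\<^sup>2 = 1 + 2 s\<close> (lemma \<open>steiner\<close>). The intrinsic
  volumes are therefore the coefficients of a polynomial that depends on \<open>C\<close> only through the metric
  projection. Their sum, their invariance under rotations, the duality between \<open>C\<close> and its
  polar, and their measurability for random cones are all read off from this polynomial.

  For the kinematic formula take independent \<open>Q\<close>, uniform in the orthogonal group, and \<open>g\<close>, standard
  Gaussian. If the projection \<open>x\<close> of \<open>g\<close> to \<open>C \<inter> Q D\<close> is not zero, then \<open>g = x + a + b\<close>, where \<open>x\<close> lies in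
  \<open>L \<inter> Q M\<close> for face spans \<open>L\<close> of \<open>C\<close> and \<open>M\<close> of \<open>D\<close>, the vector \<open>a\<close> is orthogonal to \<open>L\<close> and in the polar of
  \<open>C\<close>, and \<open>b\<close> is orthogonal to \<open>Q M\<close> and in the polar of \<open>Q D\<close>. General position (lemma
  \<open>haar_general_position\<close>) gives \<open>dim L + dim M > d\<close> and makes this decomposition of \<open>g\<close> unique.
  An orthogonal map that preserves \<open>L\<close> moves \<open>x\<close> and \<open>a\<close>, but it leaves the pullbacks of \<open>x\<close> and \<open>b\<close>
  under \<open>Q\<close> in place. Since the joint law of \<open>Q\<close> and \<open>g\<close> is invariant, and since invariant measures are
  unique (lemma \<open>invariant_measure_unique\<close>), the directions of \<open>x\<close> and \<open>a\<close> are distributed as those of the two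
  parts of a Gaussian vector, independently of the pullbacks and of the length of \<open>x\<close>. The
  same holds for the pullbacks with respect to \<open>M\<close>. So the probability that the pair \<open>L\<close>, \<open>M\<close> occurs is the product of the
  probabilities that belong to \<open>L\<close> and to \<open>M\<close>, and the length of \<open>x\<close> contributes the factor
  \<open>u ^ (dim L + dim M - d)\<close> (lemma \<open>tile_pair_weight\<close>). The mass that is left belongs to \<open>x = 0\<close>. Hence
  the expected polynomial of \<open>C \<inter> Q D\<close> is \<open>\<Sum>i j. v\<^sub>i(C) v\<^sub>j(D) u ^ max 0 (i + j - d)\<close>.

  A read-once formula is treated by induction. The two parts of a conjunction have disjoint
  variables, so their values are independent random cones. An additional uniform rotation of all
  variables of the second part does not change its law and rotates its value, so that the kinematic
  formula applies (lemma \<open>kinematic_independent\<close>). Negation is the duality \<open>v\<^sub>k \<mapsto> v\<^sub>d\<^sub>-\<^sub>k\<close>, and disjunction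
  follows by De Morgan's laws. For linear subspaces \<open>v\<^sub>k\<close> is the indicator of dimension \<open>k\<close>; the same
  formula, applied to subspaces, therefore identifies the generic dimension with its recursion
  (lemma \<open>generic_dim_eq\<close>).
\<close>

section \<open>Closed convex cones and metric projections\<close>

definition closed_cone :: "(real^'d) set \<Rightarrow> bool" where
  "closed_cone C \<longleftrightarrow> convex_cone C \<and> closed C"

lemma closed_coneD:
  assumes "closed_cone C"
  shows "convex C" "closed C" "C \<noteq> {}" "0 \<in> C"
    "\<And>x y. x \<in> C \<Longrightarrow> y \<in> C \<Longrightarrow> x + y \<in> C" "\<And>x c. x \<in> C \<Longrightarrow> 0 \<le> c \<Longrightarrow> c *\<^sub>R x \<in> C"
  using assms unfolding closed_cone_def
  by (auto simp: convex_cone_add convex_cone_scaleR convex_cone_contains_0 convex_cone_nonempty)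
     (auto simp: convex_cone_def)

lemma closed_cone_subspace: "subspace L \<Longrightarrow> closed_cone (L :: (real^'d) set)"
  by (simp add: closed_cone_def closed_subspace subspace_imp_convex_cone)

lemma closed_cone_polar: "closed_cone (polar_cone C)"
proof -
  have "polar_cone C = (\<Inter>x\<in>C. {z. x \<bullet> z \<le> 0})"
    by (auto simp: polar_cone_def)
  then show ?thesis
    by (auto simp: closed_cone_def intro!: convex_cone_Inter closed_INT closed_halfspace_le convex_cone_halfspace_le)
qed

text \<open>
  Moreau's decomposition. The variational inequality that characterises the projection to a convex
  set is tested at \<open>0\<close> and at twice the projection, which gives the orthogonality.
\<close>

lemma closest_point_cone:
  assumes "closed_cone C"
  shows "closest_point C g \<in> C"
    and "g - closest_point C g \<in> polar_cone C"
    and "closest_point C g \<bullet> (g - closest_point C g) = 0"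
proof -
  note C = closed_coneD[OF assms]
  let ?x = "closest_point C g"
  show x: "?x \<in> C"
    by (rule closest_point_in_set) fact+
  have *: "(g - ?x) \<bullet> (y - ?x) \<le> 0" if "y \<in> C" for y
    by (rule closest_point_dot) (use C that in auto)
  from *[of 0] C(4) have 1: "(g - ?x) \<bullet> ?x \<ge> 0"
    by simp
  from *[of "2 *\<^sub>R ?x"] C(6)[OF x, of 2] have 2: "(g - ?x) \<bullet> ?x \<le> 0"
    by (simp add: scaleR_2)
  show 3: "?x \<bullet> (g - ?x) = 0"
    using 1 2 by (simp add: inner_commute)
  show "g - ?x \<in> polar_cone C"
    unfolding polar_cone_def using * 3 by (auto simp: inner_diff_right inner_commute)
qed

text \<open>
  These conditions make the cross term in \<open>|g - z|\<^sup>2 = |g - x|\<^sup>2 + |x - z|\<^sup>2 + 2 \<langle>g - x, x - z\<rangle>\<close>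
  nonnegative for every \<open>z\<close> in the cone. All projections below are computed in this way.
\<close>

lemma closest_point_cone_unique:
  assumes "closed_cone C" "x \<in> C" "g - x \<in> polar_cone C" "x \<bullet> (g - x) = 0"
  shows "closest_point C g = x"
proof (rule closest_point_unique[symmetric])
  show "convex C" "closed C" using closed_coneD[OF assms(1)] by auto
  show "\<forall>z\<in>C. dist g x \<le> dist g z"
  proof
    fix z assume z: "z \<in> C"
    have "(norm (g - z))\<^sup>2 = (norm (g - x))\<^sup>2 + (norm (x - z))\<^sup>2 + 2 * ((g - x) \<bullet> (x - z))"
      by (simp add: power2_norm_eq_inner algebra_simps inner_commute)
    moreover have "(g - x) \<bullet> (x - z) \<ge> 0"
    proof -
      have "z \<bullet> (g - x) \<le> 0" using assms(3) z by (auto simp: polar_cone_def)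
      with assms(4) show ?thesis by (simp add: inner_diff_right inner_diff_left inner_commute)
    qed
    ultimately have "(norm (g - x))\<^sup>2 \<le> (norm (g - z))\<^sup>2"
      by (smt (verit) zero_le_power2)
    then show "dist g x \<le> dist g z"
      by (simp add: dist_norm)
  qed
qed fact

text \<open>
  If \<open>z\<close> is in the bipolar and \<open>x\<close> is its projection to \<open>C\<close>, then \<open>z - x\<close> is in the polar cone, so that
  \<open>|z - x|\<^sup>2 = \<langle>z, z - x\<rangle> \<le> 0\<close>.
\<close>

lemma polar_polar:
  assumes "closed_cone C"
  shows "polar_cone (polar_cone C) = C"
proof
  show "C \<subseteq> polar_cone (polar_cone C)"
    by (auto simp: polar_cone_def inner_commute)
  show "polar_cone (polar_cone C) \<subseteq> C"
  proof
    fix z assume z: "z \<in> polar_cone (polar_cone C)"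
    let ?x = "closest_point C z"
    note x = closest_point_cone[OF assms, of z]
    have "(z - ?x) \<bullet> z \<le> 0"
      using z x(2) by (auto simp: polar_cone_def)
    then have "(z - ?x) \<bullet> (z - ?x) \<le> 0"
      using x(3) by (simp add: inner_diff_right inner_diff_left inner_commute)
    then have "z = ?x"
      by (metis inner_eq_zero_iff inner_ge_zero order_antisym right_minus_eq)
    with x(1) show "z \<in> C" by simp
  qed
qed

lemma closest_point_polar:
  assumes "closed_cone C"
  shows "closest_point (polar_cone C) g = g - closest_point C g"
  using closest_point_cone[OF assms, of g] assms
  by (intro closest_point_cone_unique closed_cone_polar) (simp_all add: polar_polar inner_commute)

lemma polar_subspace:
  fixes L :: "(real^'d) set"
  assumes "subspace L"
  shows "polar_cone L = orthogonal_comp L"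
proof -
  have "x \<bullet> z = 0" if "\<forall>x\<in>L. x \<bullet> z \<le> 0" "x \<in> L" for x z
    using that assms that(1)[rule_format, of "- x"] by (fastforce simp: subspace_neg)
  then show ?thesis
    by (auto simp: polar_cone_def orthogonal_comp_def orthogonal_def)
qed

lemma closest_point_subspace:
  fixes L :: "(real^'d) set"
  assumes "subspace L"
  shows "closest_point L g \<in> L" "g - closest_point L g \<in> orthogonal_comp L"
  using closest_point_cone[OF closed_cone_subspace[OF assms], of g] polar_subspace[OF assms] by auto

lemma closest_point_subspace_unique:
  fixes L :: "(real^'d) set"
  assumes "subspace L" "x \<in> L" "g - x \<in> orthogonal_comp L"
  shows "closest_point L g = x"
  using assms by (intro closest_point_cone_unique closed_cone_subspace)
    (auto simp: polar_subspace orthogonal_comp_def orthogonal_def)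

lemma closest_point_orthogonal_comp:
  fixes L :: "(real^'d) set"
  assumes "subspace L"
  shows "closest_point (orthogonal_comp L) g = g - closest_point L g"
  using closest_point_polar[OF closed_cone_subspace[OF assms]] polar_subspace[OF assms] by metis

lemma linear_closest_point:
  fixes L :: "(real^'d) set"
  assumes L: "subspace L"
  shows "linear (closest_point L)"
proof (rule linearI)
  note p = closest_point_subspace[OF L]
  show "closest_point L (x + y) = closest_point L x + closest_point L y" for x y
    using subspace_add[OF L p(1) p(1), of x y] subspace_add[OF subspace_orthogonal_comp p(2) p(2), of x y]
    by (intro closest_point_subspace_unique[OF L]) (simp_all add: algebra_simps)
  show "closest_point L (c *\<^sub>R x) = c *\<^sub>R closest_point L x" for c x
    using subspace_scale[OF L p(1), of c x] subspace_scale[OF subspace_orthogonal_comp p(2), of c x]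
    by (intro closest_point_subspace_unique[OF L]) (simp_all add: algebra_simps)
qed

lemma dim_orthogonal_comp:
  fixes L :: "(real^'d) set"
  assumes "subspace L"
  shows "dim (orthogonal_comp L) = CARD('d) - dim L" "dim L \<le> CARD('d)"
proof -
  have "orthogonal_comp L = {x \<in> UNIV. \<forall>y\<in>L. orthogonal y x}"
    by (auto simp: orthogonal_comp_def orthogonal_def inner_commute)
  moreover have "dim {y \<in> UNIV. \<forall>x\<in>L. orthogonal x y} + dim L = dim (UNIV :: (real^'d) set)"
    using assms by (intro dim_subspace_orthogonal_to_vectors) auto
  ultimately show "dim (orthogonal_comp L) = CARD('d) - dim L" "dim L \<le> CARD('d)"
    by (auto simp: dim_UNIV)
qed

section \<open>Orthogonal images and sums of cones\<close>

lemma polar_orthogonal_image: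
  fixes f :: "real^'d \<Rightarrow> real^'d"
  assumes f: "orthogonal_transformation f"
  shows "polar_cone (f ` C) = f ` polar_cone C"
proof
  show "f ` polar_cone C \<subseteq> polar_cone (f ` C)"
    using f by (auto simp: polar_cone_def orthogonal_transformation_def)
  show "polar_cone (f ` C) \<subseteq> f ` polar_cone C"
  proof
    fix z assume z: "z \<in> polar_cone (f ` C)"
    obtain y where y: "z = f y"
      using orthogonal_transformation_surj[OF f] by (metis surjD)
    with z have "y \<in> polar_cone C"
      using f by (auto simp: polar_cone_def orthogonal_transformation_def)
    with y show "z \<in> f ` polar_cone C" by auto
  qed
qed

lemma orthogonal_comp_orthogonal_image:
  fixes f :: "real^'d \<Rightarrow> real^'d"
  assumes f: "orthogonal_transformation f" and L: "subspace L"
  shows "orthogonal_comp (f ` L) = f ` orthogonal_comp L"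
  using polar_orthogonal_image[OF f, of L] polar_subspace[OF L]
    polar_subspace[OF linear_subspace_image[OF orthogonal_transformation_linear[OF f] L]] by simp

lemma closed_cone_orthogonal_image:
  fixes f :: "real^'d \<Rightarrow> real^'d"
  assumes f: "orthogonal_transformation f" and C: "closed_cone C"
  shows "closed_cone (f ` C)"
  by (metis C closed_cone_polar f polar_orthogonal_image polar_polar)

lemma closest_point_orthogonal_image:
  fixes f :: "real^'d \<Rightarrow> real^'d"
  assumes f: "orthogonal_transformation f" and C: "closed_cone C"
  shows "closest_point (f ` C) (f g) = f (closest_point C g)"
proof (rule closest_point_cone_unique[OF closed_cone_orthogonal_image[OF f C]])
  note x = closest_point_cone[OF C, of g]
  have l: "f g - f (closest_point C g) = f (g - closest_point C g)"
    using orthogonal_transformation_linear[OF f] by (simp add: linear_diff)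
  show "f (closest_point C g) \<in> f ` C" using x by auto
  show "f g - f (closest_point C g) \<in> polar_cone (f ` C)"
    using x unfolding l polar_orthogonal_image[OF f] by auto
  show "f (closest_point C g) \<bullet> (f g - f (closest_point C g)) = 0"
    using f x(3) unfolding l orthogonal_transformation_def by auto
qed

lemma polar_sum:
  assumes "0 \<in> C" "0 \<in> D"
  shows "polar_cone (C + D) = polar_cone C \<inter> polar_cone D"
proof
  show "polar_cone (C + D) \<subseteq> polar_cone C \<inter> polar_cone D"
  proof
    fix z assume z: "z \<in> polar_cone (C + D)"
    have "x + 0 \<in> C + D" if "x \<in> C" for x using that assms by (intro set_plus_intro)
    moreover have "0 + x \<in> C + D" if "x \<in> D" for x using that assms by (intro set_plus_intro)
    ultimately show "z \<in> polar_cone C \<inter> polar_cone D"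
      using z unfolding polar_cone_def by auto
  qed
  show "polar_cone C \<inter> polar_cone D \<subseteq> polar_cone (C + D)"
  proof
    fix z assume z: "z \<in> polar_cone C \<inter> polar_cone D"
    have "x \<bullet> z + y \<bullet> z \<le> 0" if "x \<in> C" "y \<in> D" for x y
      using z that by (intro add_nonpos_nonpos) (auto simp: polar_cone_def)
    then show "z \<in> polar_cone (C + D)"
      by (auto simp: polar_cone_def inner_add_left elim!: set_plus_elim)
  qed
qed

section \<open>Polyhedral cones and their faces\<close>

text \<open>
  This makes the theory of polyhedra available. In a halfspace \<open>a \<bullet> x \<le> b\<close> that contains a cone, the
  bound \<open>b\<close> may be replaced by \<open>0\<close>, because arbitrarily large multiples of each point satisfy the inequality.
\<close>

lemma polyhedral_cone_iff:
  fixes C :: "(real^'d) set"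
  shows "polyhedral_cone C \<longleftrightarrow> polyhedron C \<and> convex_cone C"
proof safe
  assume "polyhedral_cone C"
  then obtain m and a :: "nat \<Rightarrow> real^'d" where C: "C = (\<Inter>i<m. {x. a i \<bullet> x \<le> 0})"
    unfolding polyhedral_cone_def by auto
  show "polyhedron C" unfolding C
    by (intro polyhedron_Inter) (auto simp: polyhedron_halfspace_le)
  show "convex_cone C" unfolding C
    by (intro convex_cone_Inter) (auto simp: convex_cone_halfspace_le)
next
  assume p: "polyhedron C" and c: "convex_cone C"
  from p obtain F where F: "finite F" "C = \<Inter>F" "\<forall>h\<in>F. \<exists>a b. a \<noteq> 0 \<and> h = {x. a \<bullet> x \<le> b}"
    unfolding polyhedron_def by auto
  from F(3) obtain a b where ab: "\<And>h. h \<in> F \<Longrightarrow> h = {x. a h \<bullet> x \<le> b h}"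
    by metis
  from F(1) obtain f and m :: nat where f: "F = f ` {i. i < m}"
    unfolding finite_conv_nat_seg_image by blast
  have "C = {x. \<forall>h\<in>F. a h \<bullet> x \<le> 0}"
  proof safe
    fix x h assume x: "x \<in> C" and h: "h \<in> F"
    have *: "c * (a h \<bullet> x) \<le> b h" if "c \<ge> 0" for c
    proof -
      have "c *\<^sub>R x \<in> h" using convex_cone_scaleR[OF c that x] F(2) h by auto
      then show ?thesis by (subst (asm) ab[OF h]) simp
    qed
    show "a h \<bullet> x \<le> 0"
    proof (rule ccontr)
      assume "\<not> a h \<bullet> x \<le> 0"
      then have "a h \<bullet> x > 0" by simp
      moreover have "b h \<ge> 0" using *[of 0] by simp
      ultimately show False
        using *[of "(b h + 1) / (a h \<bullet> x)"] by (simp add: field_simps)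
    qed
  next
    fix x assume x: "\<forall>h\<in>F. a h \<bullet> x \<le> 0"
    have "x \<in> h" if h: "h \<in> F" for h
    proof -
      have "0 \<in> h" using convex_cone_contains_0[OF c] F(2) h by auto
      then have "b h \<ge> 0" by (subst (asm) ab[OF h]) simp
      with x h show ?thesis by (subst ab[OF h]) force
    qed
    then show "x \<in> C" using F(2) by auto
  qed
  then have "C = {x. \<forall>i<m. a (f i) \<bullet> x \<le> 0}"
    unfolding f by auto
  then show "polyhedral_cone C"
    unfolding polyhedral_cone_def by (intro exI[of _ m] exI[of _ "\<lambda>i. a (f i)"])
qed

lemma polyhedral_cone_closed: "polyhedral_cone C \<Longrightarrow> closed_cone C"
  by (simp add: polyhedral_cone_iff closed_cone_def polyhedron_imp_closed)

lemma polar_convex_cone_hull: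
  "polar_cone (convex_cone hull S) = {z. \<forall>s\<in>S. s \<bullet> z \<le> 0}"
proof safe
  fix z s assume "z \<in> polar_cone (convex_cone hull S)" "s \<in> S"
  then show "s \<bullet> z \<le> 0"
    by (auto simp: polar_cone_def hull_inc)
next
  fix z assume z: "\<forall>s\<in>S. s \<bullet> z \<le> 0"
  have "convex_cone hull S \<subseteq> {x. z \<bullet> x \<le> 0}"
    using z by (intro hull_minimal convex_cone_halfspace_le) (auto simp: inner_commute)
  then show "z \<in> polar_cone (convex_cone hull S)"
    by (auto simp: polar_cone_def inner_commute)
qed

lemma closed_cone_convex_cone_hull: "finite S \<Longrightarrow> closed_cone (convex_cone hull S)"
  by (simp add: closed_cone_def closed_convex_cone_hull convex_cone_convex_cone_hull)

text \<open>
  Farkas' lemma. The cone generated by finitely many vectors is closed, so it is the polar of its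
  polar, and its polar is cut out by the generators.
\<close>

lemma polyhedral_cone_polar_hull:
  fixes C :: "(real^'d) set"
  assumes "polyhedral_cone C"
  obtains S where "finite S" "polar_cone C = convex_cone hull S"
proof -
  obtain m and a :: "nat \<Rightarrow> real^'d" where C: "C = {x. \<forall>i<m. a i \<bullet> x \<le> 0}"
    using assms unfolding polyhedral_cone_def by auto
  let ?S = "a ` {..<m}"
  have "C = polar_cone (convex_cone hull ?S)"
    unfolding polar_convex_cone_hull C by auto
  then have "polar_cone C = convex_cone hull ?S"
    by (simp add: polar_polar closed_cone_convex_cone_hull)
  then show ?thesis using that[of ?S] by auto
qed

lemma polyhedral_cone_hull: "finite S \<Longrightarrow> polyhedral_cone (convex_cone hull S)"
  by (simp add: polyhedral_cone_iff polyhedron_convex_cone_hull convex_cone_convex_cone_hull)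

lemma polyhedral_cone_polar: "polyhedral_cone C \<Longrightarrow> polyhedral_cone (polar_cone C)"
  by (metis polyhedral_cone_hull polyhedral_cone_polar_hull)

lemma polyhedral_cone_finitely_generated:
  assumes "polyhedral_cone C"
  obtains S where "finite S" "C = convex_cone hull S"
  by (metis assms polar_polar polyhedral_cone_closed polyhedral_cone_polar polyhedral_cone_polar_hull)

lemma polyhedral_cone_Int:
  "polyhedral_cone C \<Longrightarrow> polyhedral_cone D \<Longrightarrow> polyhedral_cone (C \<inter> D)"
  using convex_cone_Inter[of "{C, D}"] by (auto simp: polyhedral_cone_iff)

lemma polyhedral_cone_sum:
  assumes "polyhedral_cone C" "polyhedral_cone D"
  shows "polyhedral_cone (C + D)"
proof -
  obtain S where S: "finite S" "C = convex_cone hull S"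
    using polyhedral_cone_finitely_generated[OF assms(1)] .
  obtain T where T: "finite T" "D = convex_cone hull T"
    using polyhedral_cone_finitely_generated[OF assms(2)] .
  have "C + D = convex_cone hull (S \<union> T)"
    unfolding convex_cone_hull_Un S(2) T(2) set_plus_def by auto
  then show ?thesis using S(1) T(1) by (simp add: polyhedral_cone_hull)
qed

lemma polyhedral_cone_orthogonal_image:
  fixes f :: "real^'d \<Rightarrow> real^'d"
  assumes f: "orthogonal_transformation f" and C: "polyhedral_cone C"
  shows "polyhedral_cone (f ` C)"
proof -
  obtain S where S: "finite S" "C = convex_cone hull S"
    using polyhedral_cone_finitely_generated[OF C] .
  have "f ` C = convex_cone hull (f ` S)"
    unfolding S(2) by (simp add: convex_cone_hull_linear_image orthogonal_transformation_linear[OF f])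
  then show ?thesis using S(1) by (simp add: polyhedral_cone_hull)
qed

lemma polyhedral_cone_subspace: "subspace L \<Longrightarrow> polyhedral_cone L"
  by (simp add: polyhedral_cone_iff affine_imp_polyhedron subspace_imp_affine subspace_imp_convex_cone)

text \<open>
  The sum of two polyhedral cones is finitely generated and hence closed, so the bipolar theorem
  applies to it.
\<close>

lemma polar_Int:
  assumes "polyhedral_cone C" "polyhedral_cone D"
  shows "polar_cone (C \<inter> D) = polar_cone C + polar_cone D"
proof -
  have "polar_cone (polar_cone C + polar_cone D) = C \<inter> D"
    using polar_polar[OF polyhedral_cone_closed[OF assms(1)]] polar_polar[OF polyhedral_cone_closed[OF assms(2)]]
    by (subst polar_sum) (auto simp: closed_coneD(4)[OF closed_cone_polar])
  then show ?thesis
    by (metis assms polar_polar polyhedral_cone_closed polyhedral_cone_polar polyhedral_cone_sum)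
qed

definition all_face_spans :: "(real^'d) set \<Rightarrow> (real^'d) set set" where
  "all_face_spans C = {span F | F. cone_face F C}"

lemma finite_all_face_spans:
  assumes "polyhedral_cone C"
  shows "finite (all_face_spans C)"
proof -
  have "F face_of C" if "cone_face F C" for F
  proof -
    from that obtain z where z: "\<forall>x\<in>C. x \<bullet> z \<le> 0" and F: "F = {x \<in> C. x \<bullet> z = 0}"
      unfolding cone_face_def by auto
    have "F = C \<inter> {x. z \<bullet> x = 0}"
      unfolding F by (auto simp: inner_commute)
    moreover have "(C \<inter> {x. z \<bullet> x = 0}) face_of C"
      using z closed_coneD(1)[OF polyhedral_cone_closed[OF assms]]
      by (intro face_of_Int_supporting_hyperplane_le) (auto simp: inner_commute)
    ultimately show ?thesis by simp
  qed
  then have "all_face_spans C \<subseteq> span ` {F. F face_of C}"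
    unfolding all_face_spans_def by auto
  then show ?thesis
    using assms finite_polyhedron_faces[of C] by (auto simp: polyhedral_cone_iff intro: finite_subset)
qed

lemma subspace_all_face_spans: "L \<in> all_face_spans C \<Longrightarrow> subspace L"
  unfolding all_face_spans_def by auto

text \<open>
  The smallest face that contains \<open>x\<close> is cut out by the constraints that are active at \<open>x\<close>, and \<open>L\<close> is
  its span. For \<open>f\<close> in this face, \<open>x - e f\<close> stays in the cone for small \<open>e > 0\<close>. A linear functional
  that is nonpositive on the cone and zero at \<open>x\<close> is therefore zero on the whole face.
\<close>

lemma minimal_face_span:
  fixes C :: "(real^'d) set"
  assumes "polyhedral_cone C" "x \<in> C"
  obtains L where "L \<in> all_face_spans C" "x \<in> L"
    "\<And>y. y \<in> polar_cone C \<Longrightarrow> x \<bullet> y = 0 \<Longrightarrow> y \<in> orthogonal_comp L"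
proof -
  obtain m and a :: "nat \<Rightarrow> real^'d" where C: "C = {x. \<forall>i<m. a i \<bullet> x \<le> 0}"
    using assms unfolding polyhedral_cone_def by auto
  define I where "I = {i. i < m \<and> a i \<bullet> x = 0}"
  define z where "z = (\<Sum>i\<in>I. a i)"
  define F where "F = {y \<in> C. y \<bullet> z = 0}"
  have finI: "finite I" by (simp add: I_def)
  have Cz: "y \<bullet> z \<le> 0" if "y \<in> C" for y
    using that unfolding z_def inner_sum_right C by (intro sum_nonpos) (auto simp: I_def inner_commute)
  have F: "cone_face F C"
    unfolding cone_face_def F_def using Cz by auto
  have xF: "x \<in> F"
    using assms(2) by (auto simp: F_def z_def inner_sum_right I_def inner_commute intro!: sum.neutral)
  have aF: "a i \<bullet> f = 0" if "f \<in> F" "i \<in> I" for f i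
  proof -
    have "(\<Sum>i\<in>I. - (a i \<bullet> f)) = 0" "\<And>i. i \<in> I \<Longrightarrow> - (a i \<bullet> f) \<ge> 0"
      using that(1) by (auto simp: F_def z_def inner_sum_right inner_commute sum_negf C I_def)
    then show ?thesis
      using sum_nonneg_eq_0_iff[OF finI, of "\<lambda>i. - (a i \<bullet> f)"] that(2) by auto
  qed
  have step: "\<exists>e>0. x - e *\<^sub>R f \<in> C" if f: "f \<in> F" for f
  proof -
    have "\<forall>\<^sub>F e in at_right 0. a i \<bullet> (x - e *\<^sub>R f) \<le> 0" if i: "i < m" for i
    proof (cases "i \<in> I")
      case True
      then show ?thesis using aF[OF f True] by (simp add: I_def inner_diff_right)
    next
      case False
      then have "a i \<bullet> x < 0" using i assms(2) by (force simp: I_def C)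
      moreover have "((\<lambda>e. a i \<bullet> (x - e *\<^sub>R f)) \<longlongrightarrow> a i \<bullet> (x - 0 *\<^sub>R f)) (at_right 0)"
        by (intro tendsto_intros)
      ultimately have "\<forall>\<^sub>F e in at_right 0. a i \<bullet> (x - e *\<^sub>R f) < 0"
        by (intro order_tendstoD(2)) auto
      then show ?thesis by eventually_elim simp
    qed
    then have "\<forall>\<^sub>F e in at_right 0. \<forall>i\<in>{..<m}. a i \<bullet> (x - e *\<^sub>R f) \<le> 0"
      by (intro eventually_ball_finite) auto
    moreover have "\<forall>\<^sub>F e in at_right (0::real). e > 0"
      by (rule eventually_at_right_less)
    ultimately have "\<forall>\<^sub>F e in at_right 0. x - e *\<^sub>R f \<in> C \<and> e > 0"
      by eventually_elim (auto simp: C)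
    then show ?thesis
      using eventually_happens[of _ "at_right (0::real)"] by auto
  qed
  have y: "y \<in> orthogonal_comp (span F)" if y: "y \<in> polar_cone C" "x \<bullet> y = 0" for y
  proof -
    have "y \<bullet> f = 0" if f: "f \<in> F" for f
    proof -
      obtain e where e: "e > 0" "x - e *\<^sub>R f \<in> C" using step[OF f] by auto
      have "(x - e *\<^sub>R f) \<bullet> y \<le> 0" using y(1) e(2) by (auto simp: polar_cone_def)
      with y(2) e(1) have "f \<bullet> y \<ge> 0" by (simp add: inner_diff_left zero_le_mult_iff)
      moreover have "f \<bullet> y \<le> 0" using y(1) f by (auto simp: polar_cone_def F_def)
      ultimately show ?thesis by (simp add: inner_commute)
    qed
    then have "span F \<subseteq> {f. y \<bullet> f = 0}"
      by (intro span_minimal subspace_hyperplane) auto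
    then show ?thesis
      by (auto simp: orthogonal_comp_def orthogonal_def inner_commute)
  qed
  show ?thesis
    by (rule that[of "span F"]) (use F xF y in \<open>auto simp: all_face_spans_def span_base\<close>)
qed

section \<open>Comparison of measures through balls\<close>

text \<open>
  Christensen's argument for the uniqueness of uniformly distributed measures: integrate the
  indicator of \<open>dist x y < r\<close> over \<open>x\<close> in \<open>A\<close> and all \<open>y\<close>, in both orders. The points \<open>y\<close> that
  contribute are within distance \<open>r\<close> of \<open>A\<close>, and \<open>r\<close> tends to \<open>0\<close>. It serves twice, for the rotation
  invariance of Lebesgue measure and for measures that are invariant under a transitive group.
\<close>

lemma emeasure_closed_le_of_balls:
  fixes \<mu> \<nu> :: "'a::euclidean_space measure"
  assumes sf: "sigma_finite_measure \<mu>" "sigma_finite_measure \<nu>"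
    and sets [measurable_cong]: "sets \<mu> = sets borel" "sets \<nu> = sets borel"
    and AE: "AE x in \<mu>. x \<in> S" "AE x in \<nu>. x \<in> S"
    and ball: "\<And>r. 0 < r \<Longrightarrow> r \<le> 1 \<Longrightarrow> \<exists>c. 0 < c \<and> c < top \<and>
      (\<forall>y\<in>S. emeasure \<nu> (ball y r) = s * c \<and> emeasure \<mu> (ball y r) = t * c)"
    and A: "closed A" "emeasure \<nu> {y. infdist y A \<le> 1} < top" and t: "t < top"
  shows "s * emeasure \<mu> A \<le> t * emeasure \<nu> A"
proof (cases "A = {}")
  case False
  interpret pair_sigma_finite \<mu> \<nu> using sf by (simp add: pair_sigma_finite_def)
  have [measurable]: "A \<in> sets borel" using A(1) by (simp add: borel_closed)
  have [measurable]: "{y. infdist y A \<le> r} \<in> sets borel" for r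
    by (intro borel_closed closed_Collect_le continuous_intros)
  have bound: "s * emeasure \<mu> A \<le> t * emeasure \<nu> {y. infdist y A \<le> r}" if r: "0 < r" "r \<le> 1" for r
  proof -
    obtain c where c: "0 < c" "c < top"
      and balls: "\<And>y. y \<in> S \<Longrightarrow> emeasure \<nu> (ball y r) = s * c" "\<And>y. y \<in> S \<Longrightarrow> emeasure \<mu> (ball y r) = t * c"
      using ball[OF r] by metis
    have m: "(\<lambda>(x, y). indicator A x * indicator {p. dist (fst p) (snd p) < r} (x, y) :: ennreal)
        \<in> borel_measurable (\<mu> \<Otimes>\<^sub>M \<nu>)"
      by measurable
    have "s * c * emeasure \<mu> A = (\<integral>\<^sup>+x. indicator A x * (s * c) \<partial>\<mu>)"
      by (subst nn_integral_multc) (auto simp: mult.commute)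
    also have "\<dots> = (\<integral>\<^sup>+x. indicator A x * emeasure \<nu> (ball x r) \<partial>\<mu>)"
      using AE(1) by (intro nn_integral_cong_AE) (auto simp: balls)
    also have "\<dots> = (\<integral>\<^sup>+x. \<integral>\<^sup>+y. indicator A x * indicator {p. dist (fst p) (snd p) < r} (x, y) \<partial>\<nu> \<partial>\<mu>)"
    proof (intro nn_integral_cong)
      fix x
      have "(\<integral>\<^sup>+y. indicator A x * indicator {p. dist (fst p) (snd p) < r} (x, y) \<partial>\<nu>)
         = indicator A x * (\<integral>\<^sup>+y. indicator {p. dist (fst p) (snd p) < r} (x, y) \<partial>\<nu>)"
        by (rule nn_integral_cmult) measurable
      also have "(\<integral>\<^sup>+y. indicator {p. dist (fst p) (snd p) < r} (x, y) \<partial>\<nu>) = (\<integral>\<^sup>+y. indicator (ball x r) y \<partial>\<nu>)"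
        by (intro nn_integral_cong) (auto simp: indicator_def)
      finally show "indicator A x * emeasure \<nu> (ball x r) = (\<integral>\<^sup>+y. indicator A x * indicator {p. dist (fst p) (snd p) < r} (x, y) \<partial>\<nu>)"
        by (simp add: sets)
    qed
    also have "\<dots> = (\<integral>\<^sup>+y. \<integral>\<^sup>+x. indicator A x * indicator {p. dist (fst p) (snd p) < r} (x, y) \<partial>\<mu> \<partial>\<nu>)"
      using Fubini'[OF m] by simp
    also have "\<dots> \<le> (\<integral>\<^sup>+y. indicator {y. infdist y A \<le> r} y * emeasure \<mu> (ball y r) \<partial>\<nu>)"
    proof (intro nn_integral_mono)
      fix y
      have "(\<integral>\<^sup>+x. indicator A x * indicator {p. dist (fst p) (snd p) < r} (x, y) \<partial>\<mu>)
         \<le> (\<integral>\<^sup>+x. indicator {y. infdist y A \<le> r} y * indicator (ball y r) x \<partial>\<mu>)"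
      proof (intro nn_integral_mono)
        fix x
        have "infdist y A \<le> r" if "x \<in> A" "dist x y < r"
          using infdist_le[OF that(1), of y] that(2) by (simp add: dist_commute)
        then show "indicator A x * indicator {p. dist (fst p) (snd p) < r} (x, y)
          \<le> (indicator {y. infdist y A \<le> r} y * indicator (ball y r) x :: ennreal)"
          by (auto simp: indicator_def dist_commute)
      qed
      also have "\<dots> = indicator {y. infdist y A \<le> r} y * emeasure \<mu> (ball y r)"
      proof -
        have "ball y r \<in> sets \<mu>" by (simp add: sets)
        then show ?thesis by (rule nn_integral_cmult_indicator)
      qed
      finally show "(\<integral>\<^sup>+x. indicator A x * indicator {p. dist (fst p) (snd p) < r} (x, y) \<partial>\<mu>)
         \<le> indicator {y. infdist y A \<le> r} y * emeasure \<mu> (ball y r)" .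
    qed
    also have "\<dots> = (\<integral>\<^sup>+y. indicator {y. infdist y A \<le> r} y * (t * c) \<partial>\<nu>)"
      using AE(2) by (intro nn_integral_cong_AE) (auto simp: balls)
    also have "\<dots> = c * (t * emeasure \<nu> {y. infdist y A \<le> r})"
      by (subst nn_integral_multc) (simp_all add: mult_ac sets)
    finally have "c * (s * emeasure \<mu> A) \<le> c * (t * emeasure \<nu> {y. infdist y A \<le> r})"
      by (simp add: mult_ac)
    then show ?thesis
      using c by (subst (asm) ennreal_mult_le_mult_iff) auto
  qed
  define B where "B n = {y. infdist y A \<le> 1 / Suc n}" for n
  have lim: "(\<lambda>n. emeasure \<nu> (B n)) \<longlonglongrightarrow> emeasure \<nu> (\<Inter>n. B n)"
  proof (rule Lim_emeasure_decseq)
    show "range B \<subseteq> sets \<nu>" by (auto simp: B_def sets)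
    show "decseq B" unfolding B_def
    proof (intro decseq_SucI subsetI CollectI)
      fix n x assume "x \<in> {y. infdist y A \<le> 1 / real (Suc (Suc n))}"
      moreover have "1 / real (Suc (Suc n)) \<le> 1 / real (Suc n)" by (intro divide_left_mono) auto
      ultimately show "infdist x A \<le> 1 / real (Suc n)" by simp
    qed
    show "emeasure \<nu> (B n) \<noteq> \<infinity>" for n
    proof -
      have "emeasure \<nu> (B n) \<le> emeasure \<nu> {y. infdist y A \<le> 1}"
        unfolding B_def by (intro emeasure_mono) (auto simp: sets elim!: order_trans)
      then show ?thesis using A(2) by (auto simp: top_unique)
    qed
  qed
  have "(\<Inter>n. B n) = A"
  proof (intro set_eqI iffI)
    fix x assume x: "x \<in> (\<Inter>n. B n)"
    have "infdist x A \<le> 0"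
    proof (rule LIMSEQ_le_const)
      show "(\<lambda>n. 1 / real (Suc n)) \<longlonglongrightarrow> 0" by (rule LIMSEQ_Suc) (rule lim_1_over_n)
      show "\<exists>N. \<forall>n\<ge>N. infdist x A \<le> 1 / real (Suc n)" using x by (auto simp: B_def)
    qed
    then show "x \<in> A"
      using in_closed_iff_infdist_zero[OF A(1) False] infdist_nonneg[of x A] by auto
  qed (auto simp: B_def)
  then have "(\<lambda>n. t * emeasure \<nu> (B n)) \<longlonglongrightarrow> t * emeasure \<nu> A"
    using lim t by (intro ennreal_tendsto_cmult) auto
  then show ?thesis
    by (rule LIMSEQ_le_const) (auto simp: B_def intro!: exI[of _ 0] bound)
qed simp

section \<open>The standard Gaussian measure\<close>

abbreviation normal_measure :: "real measure" where
  "normal_measure \<equiv> density lborel std_normal_density"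

lemma prob_space_normal_measure: "prob_space normal_measure"
  by (rule prob_space_normal_density) simp

interpretation normal: product_prob_space "\<lambda>_. normal_measure" I for I
  by (simp add: product_prob_space_def product_prob_space_axioms_def prob_space_normal_measure
      product_sigma_finite_def prob_space_imp_sigma_finite)

interpretation lborel_product: product_sigma_finite "\<lambda>_. lborel :: real measure"
  by (simp add: product_sigma_finite_def sigma_finite_lborel)

lemma indicator_PiE:
  assumes "finite I" "x \<in> extensional I"
  shows "indicator (Pi\<^sub>E I A) x = (\<Prod>i\<in>I. indicator (A i) (x i) :: ennreal)"
proof (cases "x \<in> Pi\<^sub>E I A")
  case True
  then have "(\<Prod>i\<in>I. indicator (A i) (x i) :: ennreal) = (\<Prod>i\<in>I. 1)"
    by (intro prod.cong) (auto simp: PiE_iff)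
  then show ?thesis using True by simp
next
  case False
  then obtain i where "i \<in> I" "x i \<notin> A i" using assms(2) by (auto simp: PiE_iff)
  then have "(\<Prod>i\<in>I. indicator (A i) (x i) :: ennreal) = 0"
    using assms(1) by (intro prod_zero) (auto simp: indicator_def)
  then show ?thesis using False by simp
qed

lemma PiM_density_lborel:
  fixes f :: "real \<Rightarrow> ennreal"
  assumes I: "finite I" and [measurable]: "f \<in> borel_measurable borel"
    and sf: "sigma_finite_measure (density lborel f)"
  shows "density (PiM I (\<lambda>_. lborel)) (\<lambda>x. \<Prod>i\<in>I. f (x i)) = PiM I (\<lambda>_. density lborel f)"
proof -
  interpret D: product_sigma_finite "\<lambda>_. density lborel f"
    using sf by (simp add: product_sigma_finite_def)
  show ?thesis
  proof (rule D.PiM_eqI[OF I])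
    show "sets (density (PiM I (\<lambda>_. lborel)) (\<lambda>x. \<Prod>i\<in>I. f (x i))) = sets (PiM I (\<lambda>_. density lborel f))"
      unfolding sets_density by (rule sets_PiM_cong) auto
    fix A assume "\<And>i. i \<in> I \<Longrightarrow> A i \<in> sets (density lborel f)"
    then have A[measurable]: "\<And>i. i \<in> I \<Longrightarrow> A i \<in> sets borel" by simp
    have "emeasure (density (PiM I (\<lambda>_. lborel)) (\<lambda>x. \<Prod>i\<in>I. f (x i))) (Pi\<^sub>E I A)
        = (\<integral>\<^sup>+x. (\<Prod>i\<in>I. f (x i)) * indicator (Pi\<^sub>E I A) x \<partial>PiM I (\<lambda>_. lborel))"
      by (rule emeasure_density) (auto intro!: sets_PiM_I_finite I simp: A)
    also have "\<dots> = (\<integral>\<^sup>+x. (\<Prod>i\<in>I. f (x i) * indicator (A i) (x i)) \<partial>PiM I (\<lambda>_. lborel))"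
      using I by (intro nn_integral_cong) (simp add: indicator_PiE space_PiM PiE_iff prod.distrib)
    also have "\<dots> = (\<Prod>i\<in>I. \<integral>\<^sup>+x. f x * indicator (A i) x \<partial>lborel)"
      using A by (intro lborel_product.product_nn_integral_prod I) auto
    also have "\<dots> = (\<Prod>i\<in>I. emeasure (density lborel f) (A i))"
      by (intro prod.cong refl emeasure_density[symmetric]) (auto simp: A)
    finally show "emeasure (density (PiM I (\<lambda>_. lborel)) (\<lambda>x. \<Prod>i\<in>I. f (x i))) (Pi\<^sub>E I A)
      = (\<Prod>i\<in>I. emeasure (density lborel f) (A i))" .
  qed
qed

definition gauss_basis :: "(real^'d) set \<Rightarrow> (real^'d) measure" where
  "gauss_basis B = distr (PiM B (\<lambda>_. normal_measure)) borel (\<lambda>g. \<Sum>b\<in>B. g b *\<^sub>R b)"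

lemma measurable_basis_sum:
  "(\<lambda>g. \<Sum>b\<in>B. g b *\<^sub>R b) \<in> measurable (PiM B (\<lambda>_. normal_measure)) (borel :: (real^'d) measure)"
  by measurable

lemma gaussian_on_gauss_basis: "gaussian_on L = gauss_basis (onb_of L)"
  by (simp add: gaussian_on_def gauss_basis_def)

definition gauss_density :: "real^'d \<Rightarrow> ennreal" where
  "gauss_density x = (\<Prod>b\<in>Basis. ennreal (std_normal_density (x \<bullet> b)))"

lemma gauss_density_measurable [measurable]: "gauss_density \<in> borel_measurable borel"
  unfolding gauss_density_def by measurable

lemma gauss_density_norm:
  fixes x y :: "real^'d"
  shows "norm x = norm y \<Longrightarrow> gauss_density x = gauss_density y"
proof -
  have *: "gauss_density x = ennreal ((1 / sqrt (2 * pi)) ^ CARD('d) * exp (- (norm x)\<^sup>2 / 2))" for x :: "real^'d"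
  proof -
    have "gauss_density x = ennreal (\<Prod>b\<in>Basis. std_normal_density (x \<bullet> b))"
      unfolding gauss_density_def by (rule prod_ennreal) simp
    also have "(\<Prod>b\<in>Basis. std_normal_density (x \<bullet> b)) =
        (1 / sqrt (2 * pi)) ^ card (Basis :: (real^'d) set) * exp (\<Sum>b\<in>Basis. - (x \<bullet> b)\<^sup>2 / 2)"
      unfolding std_normal_density_def prod.distrib exp_sum[OF finite_Basis] by (simp add: power_one_over)
    also have "(\<Sum>b\<in>Basis. - (x \<bullet> b)\<^sup>2 / 2) = - (norm x)\<^sup>2 / 2"
    proof -
      have "(norm x)\<^sup>2 = (\<Sum>b\<in>Basis. (x \<bullet> b)\<^sup>2)"
        unfolding power2_norm_eq_inner by (subst euclidean_inner) (simp only: power2_eq_square)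
      then show ?thesis by (simp add: sum_negf sum_divide_distrib)
    qed
    finally show ?thesis by simp
  qed
  show "norm x = norm y \<Longrightarrow> gauss_density x = gauss_density y"
    unfolding *[of x] *[of y] by simp
qed

lemma gauss_basis_Basis: "gauss_basis Basis = density lborel (gauss_density :: real^'d \<Rightarrow> ennreal)"
proof -
  let ?S = "\<lambda>g. \<Sum>b\<in>(Basis :: (real^'d) set). g b *\<^sub>R b"
  have "density lborel (gauss_density :: real^'d \<Rightarrow> ennreal)
     = density (distr (PiM Basis (\<lambda>_. lborel)) borel ?S) gauss_density"
    by (subst lborel_eq) (rule refl)
  also have "\<dots> = distr (density (PiM Basis (\<lambda>_. lborel)) (\<lambda>g. gauss_density (?S g))) borel ?S"
    by (rule density_distr) auto
  also have "(\<lambda>g. gauss_density (?S g)) = (\<lambda>g. \<Prod>b\<in>Basis. ennreal (std_normal_density (g b)))"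
    by (auto simp: gauss_density_def fun_eq_iff intro!: prod.cong)
  also have "density (PiM Basis (\<lambda>_. lborel)) (\<lambda>g. \<Prod>b\<in>(Basis :: (real^'d) set). ennreal (std_normal_density (g b)))
      = PiM Basis (\<lambda>_. normal_measure)"
    by (intro PiM_density_lborel) (auto intro: prob_space_imp_sigma_finite prob_space_normal_measure)
  finally show ?thesis by (simp add: gauss_basis_def)
qed

lemma orthogonal_borel_measurable:
  fixes f :: "real^'d \<Rightarrow> real^'d"
  assumes "orthogonal_transformation f" shows "f \<in> borel_measurable borel"
  using assms by (intro borel_measurable_continuous_onI linear_continuous_on linear_conv_bounded_linear[THEN iffD1]
        orthogonal_transformation_linear)

text \<open>
  An isometry maps balls to balls of the same radius. So Lebesgue measure and its image agree on
  balls, hence on compact sets, and hence on boxes.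
\<close>

lemma distr_lborel_orthogonal:
  fixes f :: "real^'d \<Rightarrow> real^'d"
  assumes f: "orthogonal_transformation f"
  shows "distr lborel borel f = lborel"
proof -
  have [measurable]: "f \<in> borel_measurable borel" by (rule orthogonal_borel_measurable) fact
  let ?\<mu> = "distr lborel borel f"
  have inv: "f (inv f x) = x" "dist (inv f x) y = dist x (f y)" for x y
    using orthogonal_transformation_surj[OF f] f unfolding orthogonal_transformation_isometry
    by (auto simp: surj_f_inv_f) (metis surj_f_inv_f)
  have ball: "emeasure ?\<mu> (ball y r) = emeasure lborel (ball (0 :: real^'d) r)" if "r > 0" for y r
  proof -
    have "f -` ball y r = ball (inv f y) r" using inv by auto
    then show ?thesis using that by (simp add: emeasure_distr emeasure_ball)
  qed
  have pos: "0 < emeasure lborel (ball (0 :: real^'d) r)" if "r > 0" for r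
    using that by (simp add: emeasure_ball)
  have sf: "sigma_finite_measure ?\<mu>"
  proof
    have "emeasure ?\<mu> (ball 0 (real (Suc n))) \<noteq> \<infinity>" for n
      by (subst ball) (auto simp: emeasure_ball)
    moreover have "(\<Union>n. ball (0 :: real^'d) (real (Suc n))) = UNIV"
    proof safe
      fix x :: "real^'d"
      obtain n where "norm x < real n" using reals_Archimedean2 by blast
      then show "x \<in> (\<Union>n. ball 0 (real (Suc n)))" by (intro UN_I[of n]) auto
    qed simp
    ultimately show "\<exists>A. countable A \<and> A \<subseteq> sets ?\<mu> \<and> \<Union> A = space ?\<mu> \<and> (\<forall>a\<in>A. emeasure ?\<mu> a \<noteq> \<infinity>)"
      by (intro exI[of _ "range (\<lambda>n. ball 0 (real (Suc n)))"]) auto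
  qed
  have cmp: "emeasure ?\<mu> A = emeasure lborel A" if A: "compact A" for A
  proof (cases "A = {}")
    case ne: False
    show ?thesis
    proof (rule antisym)
    have K: "compact {y. infdist y A \<le> 1}" (is "compact ?K")
      using A ne by (intro compact_infdist_le) auto
    have fin: "emeasure lborel ?K < top" using emeasure_compact_finite[OF K] by simp
    obtain R where "\<And>x. x \<in> ?K \<Longrightarrow> norm x \<le> R"
      using compact_imp_bounded[OF K] bounded_iff by metis
    then have "bounded (f -` ?K)"
      using f unfolding bounded_iff by (metis orthogonal_transformation_norm vimageE)
    then have mfin: "emeasure ?\<mu> ?K < top"
    proof -
      have "?K \<in> sets borel" using K by (simp add: borel_compact)
      then show ?thesis
        using emeasure_bounded_finite[OF \<open>bounded (f -` ?K)\<close>] by (subst emeasure_distr) auto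
    qed
    have "1 * emeasure ?\<mu> A \<le> 1 * emeasure lborel A"
      by (rule emeasure_closed_le_of_balls[where S=UNIV])
        (use sf sigma_finite_lborel A fin ball pos in \<open>auto simp: compact_imp_closed emeasure_ball less_top intro!: exI[of _ "emeasure lborel (ball (0 :: real^'d) r)" for r]\<close>)
    then show "emeasure ?\<mu> A \<le> emeasure lborel A" by simp
    have "1 * emeasure lborel A \<le> 1 * emeasure ?\<mu> A"
      by (rule emeasure_closed_le_of_balls[where S=UNIV])
        (use sf sigma_finite_lborel A mfin ball pos in \<open>auto simp: compact_imp_closed emeasure_ball less_top intro!: exI[of _ "emeasure lborel (ball (0 :: real^'d) r)" for r]\<close>)
    then show "emeasure lborel A \<le> emeasure ?\<mu> A" by simp
    qed
  qed simp
  show ?thesis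
  proof (rule lborel_eqI[symmetric])
    fix l u :: "real^'d" assume lu: "\<And>b. b \<in> Basis \<Longrightarrow> l \<bullet> b \<le> u \<bullet> b"
    have k: "compact (cbox l u - box l u)" by (intro compact_diff) auto
    have eq: "box l u = cbox l u - (cbox l u - box l u)" using box_subset_cbox by auto
    have "emeasure ?\<mu> (box l u) = emeasure ?\<mu> (cbox l u) - emeasure ?\<mu> (cbox l u - box l u)"
      using cmp[OF k] emeasure_compact_finite[OF k] by (subst eq, subst emeasure_Diff) (auto simp: less_top)
    also have "\<dots> = emeasure lborel (cbox l u) - emeasure lborel (cbox l u - box l u)"
      using cmp[OF k] cmp[OF compact_cbox] by simp
    also have "\<dots> = emeasure lborel (box l u)"
      using emeasure_compact_finite[OF k] emeasure_Diff[of lborel "cbox l u - box l u" "cbox l u"]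
      by (simp add: eq[symmetric] borel_compact[OF k])
    also have "\<dots> = (\<Prod>b\<in>Basis. (u - l) \<bullet> b)"
      using lu by (simp add: emeasure_lborel_box_eq)
    finally show "emeasure ?\<mu> (box l u) = (\<Prod>b\<in>Basis. (u - l) \<bullet> b)" .
  qed simp
qed

lemma gauss_Basis_orthogonal:
  fixes f :: "real^'d \<Rightarrow> real^'d"
  assumes f: "orthogonal_transformation f"
  shows "distr (gauss_basis Basis) borel f = gauss_basis Basis"
proof -
  have [measurable]: "f \<in> borel_measurable borel" by (rule orthogonal_borel_measurable) fact
  have "gauss_density = (\<lambda>x. gauss_density (f x))"
    using f by (auto simp: fun_eq_iff intro!: gauss_density_norm simp: orthogonal_transformation_norm)
  then have "distr (gauss_basis Basis) borel f = distr (density lborel (\<lambda>x. gauss_density (f x))) borel f"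
    unfolding gauss_basis_Basis by simp
  also have "\<dots> = density (distr lborel borel f) gauss_density"
    by (rule density_distr[symmetric]) auto
  finally show ?thesis
    unfolding distr_lborel_orthogonal[OF f] gauss_basis_Basis .
qed

text \<open>
  The orthogonal map that carries the standard basis to \<open>B\<close> preserves the Gaussian law. In
  particular the choice of an orthonormal basis in the definition of the Gaussian measure of a
  subspace is immaterial.
\<close>

lemma gauss_basis_orthonormal:
  fixes B :: "(real^'d) set"
  assumes B: "pairwise orthogonal B" "\<And>b. b \<in> B \<Longrightarrow> norm b = 1" "span B = UNIV"
  shows "gauss_basis B = gauss_basis Basis"
proof -
  have "independent B"
    using B(1) B(2)[of 0] by (intro pairwise_orthogonal_independent) auto
  then have "card B = DIM(real^'d)" "finite B"
    using B(3) by (metis dim_UNIV dim_eq_card_independent dim_span) (simp add: \<open>independent B\<close> finiteI_independent)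
  then obtain h where h: "bij_betw h (Basis :: (real^'d) set) B"
    using finite_same_card_bij[of "Basis :: (real^'d) set" B] by auto
  define f where "f x = (\<Sum>e\<in>Basis. (x \<bullet> e) *\<^sub>R h e)" for x :: "real^'d"
  have hh: "h e \<bullet> h e' = (if e = e' then 1 else 0)" if "e \<in> Basis" "e' \<in> Basis" for e e'
  proof (cases "e = e'")
    case True
    then show ?thesis using B(2)[of "h e"] bij_betwE[OF h] that by (auto simp: norm_eq_1)
  next
    case False
    then have "h e \<noteq> h e'" using h that by (auto simp: bij_betw_def inj_on_def)
    then show ?thesis using B(1) bij_betwE[OF h] that False by (auto simp: pairwise_def orthogonal_def)
  qed
  have f: "orthogonal_transformation f"
    unfolding orthogonal_transformation_def
  proof (intro conjI allI)
    show "linear f" unfolding f_def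
      by (intro linearI) (simp_all add: inner_add_left scaleR_add_left sum.distrib scaleR_sum_right)
    show "f v \<bullet> f w = v \<bullet> w" for v w
      unfolding f_def inner_sum_left inner_sum_right inner_scaleR_left inner_scaleR_right
      by (subst euclidean_inner[of v w])
        (simp add: hh if_distrib[of "\<lambda>x. _ * x"] mult.commute cong: if_cong)
  qed
  have [measurable]: "f \<in> borel_measurable borel" by (rule orthogonal_borel_measurable) fact
  let ?N = "\<lambda>_. normal_measure"
  have "gauss_basis Basis = distr (gauss_basis Basis) borel f"
    using gauss_Basis_orthogonal[OF f] by simp
  also have "\<dots> = distr (PiM Basis ?N) borel (\<lambda>g. f (\<Sum>e\<in>Basis. g e *\<^sub>R e))"
    unfolding gauss_basis_def by (subst distr_distr) (auto simp: comp_def)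
  also have "(\<lambda>g. f (\<Sum>e\<in>Basis. g e *\<^sub>R e)) = (\<lambda>g. \<Sum>e\<in>Basis. g e *\<^sub>R h e)"
    by (auto simp: f_def fun_eq_iff)
  also have "PiM Basis ?N = distr (PiM B ?N) (PiM Basis ?N) (\<lambda>\<omega>. \<lambda>n\<in>Basis. \<omega> (h n))"
    using h by (intro distr_PiM_reindex[symmetric]) (auto simp: prob_space_normal_measure bij_betw_def)
  also have "distr \<dots> borel (\<lambda>g. \<Sum>e\<in>Basis. g e *\<^sub>R h e)
      = distr (PiM B ?N) borel (\<lambda>\<omega>. \<Sum>e\<in>Basis. \<omega> (h e) *\<^sub>R h e)"
    using bij_betwE[OF h] by (subst distr_distr) (auto simp: comp_def intro!: measurable_restrict)
  also have "(\<lambda>\<omega>. \<Sum>e\<in>Basis. \<omega> (h e) *\<^sub>R h e) = (\<lambda>\<omega>. \<Sum>b\<in>B. \<omega> b *\<^sub>R b)"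
    by (intro ext sum.reindex_bij_betw h)
  finally show ?thesis by (simp add: gauss_basis_def)
qed

lemma onb_of:
  fixes L :: "(real^'d) set"
  assumes "subspace L"
  shows "pairwise orthogonal (onb_of L)" "\<And>b. b \<in> onb_of L \<Longrightarrow> norm b = 1" "span (onb_of L) = L"
    "finite (onb_of L)" "card (onb_of L) = dim L" "onb_of L \<subseteq> L"
proof -
  have "\<exists>B. pairwise orthogonal B \<and> (\<forall>b\<in>B. norm b = 1) \<and> span B = L"
    using orthonormal_basis_subspace[OF assms] by metis
  then have *: "pairwise orthogonal (onb_of L) \<and> (\<forall>b\<in>onb_of L. norm b = 1) \<and> span (onb_of L) = L"
    unfolding onb_of_def by (rule someI_ex)
  then show "pairwise orthogonal (onb_of L)" "\<And>b. b \<in> onb_of L \<Longrightarrow> norm b = 1" "span (onb_of L) = L" by auto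
  have "independent (onb_of L)"
    using * by (intro pairwise_orthogonal_independent) auto
  then show "finite (onb_of L)" "card (onb_of L) = dim L"
    using * by (auto simp: finiteI_independent) (metis dim_eq_card_independent dim_span)
  show "onb_of L \<subseteq> L" using * span_superset by auto
qed

abbreviation std_gauss :: "(real^'d) measure" where
  "std_gauss \<equiv> gaussian_on UNIV"

lemma std_gauss_density: "std_gauss = density lborel (gauss_density :: real^'d \<Rightarrow> ennreal)"
  unfolding gaussian_on_gauss_basis gauss_basis_Basis[symmetric]
  by (rule gauss_basis_orthonormal) (use onb_of[of "UNIV :: (real^'d) set"] in auto)

lemma std_gauss_orthogonal:
  fixes f :: "real^'d \<Rightarrow> real^'d"
  assumes "orthogonal_transformation f"
  shows "distr std_gauss borel f = std_gauss"
  using gauss_Basis_orthogonal[OF assms] unfolding std_gauss_density gauss_basis_Basis .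

lemma sets_gaussian_on [simp, measurable_cong]: "sets (gaussian_on L) = sets borel"
  by (simp add: gaussian_on_def)

lemma space_gaussian_on [simp]: "space (gaussian_on L) = UNIV"
  by (simp add: gaussian_on_def)

lemma prob_space_gaussian_on: "prob_space (gaussian_on L)"
  unfolding gaussian_on_def
  by (intro prob_space.prob_space_distr measurable_basis_sum prob_space_PiM prob_space_normal_measure)

lemma AE_gaussian_on:
  fixes L :: "(real^'d) set"
  assumes L: "subspace L"
  shows "AE x in gaussian_on L. x \<in> L"
  unfolding gaussian_on_def
proof (subst AE_distr_iff[OF measurable_basis_sum])
  show "{x \<in> space borel. x \<in> L} \<in> sets borel"
    using closed_subspace[OF L] by (simp add: borel_closed)
  show "AE x in Pi\<^sub>M (onb_of L) (\<lambda>_. normal_measure). (\<Sum>b\<in>onb_of L. x b *\<^sub>R b) \<in> L"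
    using onb_of(6)[OF L] L by (intro AE_I2) (auto intro!: subspace_sum subspace_scale)
qed

text \<open>
  Orthonormal bases of \<open>L\<close> and of its complement together form an orthonormal basis of the space.
\<close>

lemma std_gauss_split:
  fixes L :: "(real^'d) set"
  assumes L: "subspace L"
  shows "std_gauss = distr (gaussian_on L \<Otimes>\<^sub>M gaussian_on (orthogonal_comp L)) borel (\<lambda>(x, y). x + y)"
proof -
  let ?N = "\<lambda>_. normal_measure"
  let ?B = "onb_of L" and ?B' = "onb_of (orthogonal_comp L)"
  note B = onb_of[OF L] and B' = onb_of[OF subspace_orthogonal_comp[of L]]
  have orth: "orthogonal b b'" if "b \<in> ?B" "b' \<in> ?B'" for b b'
    using that B(6) B'(6) by (auto simp: orthogonal_comp_def)
  have disj: "?B \<inter> ?B' = {}"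
  proof (rule ccontr)
    assume "?B \<inter> ?B' \<noteq> {}"
    then obtain b where "b \<in> ?B" "b \<in> ?B'" by auto
    with orth[of b b] B(2)[of b] show False by (auto simp: orthogonal_self)
  qed
  have sp: "span (?B \<union> ?B') = UNIV"
    using subspace_sum_orthogonal_comp[OF L] unfolding span_Un B(3) B'(3) set_plus_def by blast
  have "pairwise orthogonal (?B \<union> ?B')"
    using B(1) B'(1) orth by (auto simp: pairwise_def) (metis orthogonal_commute)
  then have "std_gauss = gauss_basis (?B \<union> ?B')"
    using gauss_basis_orthonormal[of "?B \<union> ?B'"] B(2) B'(2) sp
    unfolding std_gauss_density gauss_basis_Basis by (metis Un_iff)
  also have "\<dots> = distr (distr (PiM ?B ?N \<Otimes>\<^sub>M PiM ?B' ?N) (PiM (?B \<union> ?B') ?N) (merge ?B ?B')) borel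
      (\<lambda>g. \<Sum>b\<in>?B \<union> ?B'. g b *\<^sub>R b)"
    unfolding gauss_basis_def by (subst normal.distr_merge) (use disj B(4) B'(4) in auto)
  also have "\<dots> = distr (PiM ?B ?N \<Otimes>\<^sub>M PiM ?B' ?N) borel (\<lambda>g. \<Sum>b\<in>?B \<union> ?B'. merge ?B ?B' g b *\<^sub>R b)"
    by (subst distr_distr) (auto simp: comp_def measurable_merge)
  also have "\<dots> = distr (PiM ?B ?N \<Otimes>\<^sub>M PiM ?B' ?N) borel
      (\<lambda>(g, g'). (\<Sum>b\<in>?B. g b *\<^sub>R b) + (\<Sum>b\<in>?B'. g' b *\<^sub>R b))"
  proof (intro distr_cong refl)
    fix p :: "((real^'d) \<Rightarrow> real) \<times> ((real^'d) \<Rightarrow> real)"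
    obtain g g' where p: "p = (g, g')" by force
    have "(\<Sum>b\<in>?B \<union> ?B'. merge ?B ?B' p b *\<^sub>R b)
      = (\<Sum>b\<in>?B. merge ?B ?B' p b *\<^sub>R b) + (\<Sum>b\<in>?B'. merge ?B ?B' p b *\<^sub>R b)"
      by (rule sum.union_disjoint) (use disj B(4) B'(4) in auto)
    also have "\<dots> = (\<Sum>b\<in>?B. g b *\<^sub>R b) + (\<Sum>b\<in>?B'. g' b *\<^sub>R b)"
      using disj by (intro arg_cong2[where f="(+)"] sum.cong) (auto simp: p merge_def)
    finally show "(\<Sum>b\<in>?B \<union> ?B'. merge ?B ?B' p b *\<^sub>R b)
      = (case p of (g, g') \<Rightarrow> (\<Sum>b\<in>?B. g b *\<^sub>R b) + (\<Sum>b\<in>?B'. g' b *\<^sub>R b))"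
      by (simp add: p)
  qed
  also have "\<dots> = distr (distr (PiM ?B ?N \<Otimes>\<^sub>M PiM ?B' ?N) (borel \<Otimes>\<^sub>M borel)
       (\<lambda>(g, g'). (\<Sum>b\<in>?B. g b *\<^sub>R b, \<Sum>b\<in>?B'. g' b *\<^sub>R b))) borel (\<lambda>(x, y). x + y)"
    by (subst distr_distr) (auto simp: comp_def case_prod_beta')
  also have "distr (PiM ?B ?N \<Otimes>\<^sub>M PiM ?B' ?N) (borel \<Otimes>\<^sub>M borel)
       (\<lambda>(g, g'). (\<Sum>b\<in>?B. g b *\<^sub>R b, \<Sum>b\<in>?B'. g' b *\<^sub>R b))
     = gaussian_on L \<Otimes>\<^sub>M gaussian_on (orthogonal_comp L)"
    unfolding gaussian_on_def
    by (rule pair_measure_distr[symmetric])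
      (auto intro!: prob_space_imp_sigma_finite prob_space_gaussian_on simp flip: gaussian_on_def)
  finally show ?thesis .
qed

lemma null_proper_subspace:
  fixes V :: "(real^'d) set"
  assumes "subspace V" "V \<noteq> UNIV"
  shows "AE g in std_gauss. g \<notin> V"
proof -
  have "dim V < DIM(real^'d)"
    using assms by (metis dim_eq_full dim_subset_UNIV less_le span_eq_iff)
  then have "negligible V" by (rule negligible_lowdim)
  then have "V \<in> null_sets lborel"
    using closed_subspace[OF assms(1)]
    by (metis borel_closed negligible_iff_null_sets null_sets_completion_iff sets_lborel)
  then have "AE g in lborel. g \<notin> V" by (rule AE_not_in)
  then show ?thesis
    unfolding std_gauss_density by (subst AE_density) auto
qed

section \<open>Gaussian weights\<close>

text \<open>
  The function \<open>exp (- s |x|\<^sup>2)\<close> for \<open>1 / u\<^sup>2 = 1 + 2 s\<close>. In the parameter \<open>u\<close> its Gaussian mean over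
  a \<open>k\<close>-dimensional space is the monomial \<open>u ^ k\<close>.
\<close>

definition gauss_weight :: "real \<Rightarrow> real^'d \<Rightarrow> real" where
  "gauss_weight u x = exp (- ((1 / u\<^sup>2 - 1) / 2) * (norm x)\<^sup>2)"

lemma gauss_weight_measurable [measurable]: "gauss_weight u \<in> borel_measurable borel"
  unfolding gauss_weight_def by measurable

text \<open>
  The weight turns the standard normal density into \<open>u\<close> times the density of a centred normal
  variable of standard deviation \<open>u\<close>.
\<close>

lemma normal_measure_weight:
  assumes u: "0 < u" and A[measurable]: "A \<in> sets borel"
  shows "(\<integral>\<^sup>+x. ennreal (exp (- ((1 / u\<^sup>2 - 1) / 2) * x\<^sup>2)) * indicator A x \<partial>normal_measure)
     = ennreal u * emeasure normal_measure ((\<lambda>x. u * x) -` A)"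
proof -
  have [measurable]: "(\<lambda>x. u * x) -` A \<in> sets borel"
    using measurable_sets[of "\<lambda>x. u * x" borel borel A] by simp
  have "(\<integral>\<^sup>+x. ennreal (exp (- ((1 / u\<^sup>2 - 1) / 2) * x\<^sup>2)) * indicator A x \<partial>normal_measure)
    = (\<integral>\<^sup>+x. ennreal (std_normal_density (x / u)) * indicator A x \<partial>lborel)"
  proof (subst nn_integral_density)
    show "(\<integral>\<^sup>+x. ennreal (std_normal_density x) * (ennreal (exp (- ((1 / u\<^sup>2 - 1) / 2) * x\<^sup>2)) * indicator A x) \<partial>lborel)
      = (\<integral>\<^sup>+x. ennreal (std_normal_density (x / u)) * indicator A x \<partial>lborel)"
    proof (intro nn_integral_cong)
      fix x :: real
      have "std_normal_density x * exp (- ((1 / u\<^sup>2 - 1) / 2) * x\<^sup>2) = std_normal_density (x / u)"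
        using u by (simp add: std_normal_density_def exp_add[symmetric] field_simps power2_eq_square)
      then show "ennreal (std_normal_density x) * (ennreal (exp (- ((1 / u\<^sup>2 - 1) / 2) * x\<^sup>2)) * indicator A x)
         = ennreal (std_normal_density (x / u)) * indicator A x"
        by (metis ennreal_mult' exp_ge_zero mult.assoc mult.commute)
    qed
  qed auto
  also have "\<dots> = ennreal \<bar>u\<bar> * (\<integral>\<^sup>+x. ennreal (std_normal_density ((0 + u * x) / u)) * indicator A (0 + u * x) \<partial>lborel)"
    by (rule nn_integral_real_affine) (use u in auto)
  also have "(\<integral>\<^sup>+x. ennreal (std_normal_density ((0 + u * x) / u)) * indicator A (0 + u * x) \<partial>lborel)
     = (\<integral>\<^sup>+x. ennreal (std_normal_density x) * indicator ((\<lambda>x. u * x) -` A) x \<partial>lborel)"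
    using u by (intro nn_integral_cong) (auto simp: indicator_def)
  also have "\<dots> = emeasure normal_measure ((\<lambda>x. u * x) -` A)"
    by (rule emeasure_density[symmetric]) auto
  finally show ?thesis using u by simp
qed

lemma PiM_normal_weight:
  assumes u: "0 < u" and I: "finite I"
  shows "density (PiM I (\<lambda>_. normal_measure)) (\<lambda>x. \<Prod>i\<in>I. ennreal (exp (- ((1 / u\<^sup>2 - 1) / 2) * (x i)\<^sup>2)))
     = scale_measure (ennreal u ^ card I)
        (distr (PiM I (\<lambda>_. normal_measure)) (PiM I (\<lambda>_. normal_measure)) (\<lambda>x. \<lambda>i\<in>I. u * x i))" (is "?L = ?R")
proof -
  let ?N = "\<lambda>_. normal_measure"
  let ?M = "\<lambda>_ :: 'a. scale_measure (ennreal u) (distr normal_measure borel (\<lambda>x. u * x))"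
  have S: "prob_space (distr normal_measure borel (\<lambda>x. u * x))"
    by (intro prob_space.prob_space_distr prob_space_normal_measure) auto
  have "finite_measure (scale_measure (ennreal u) (distr normal_measure borel (\<lambda>x. u * x)))"
    using prob_space.emeasure_space_1[OF S]
    by (intro finite_measureI) (simp add: space_scale_measure ennreal_mult_less_top)
  then have "sigma_finite_measure (scale_measure (ennreal u) (distr normal_measure borel (\<lambda>x. u * x)))"
    by (simp add: finite_measure_def)
  then interpret S: product_sigma_finite ?M
    by (simp add: product_sigma_finite_def)
  have eM: "emeasure (?M i) A = (\<integral>\<^sup>+x. ennreal (exp (- ((1 / u\<^sup>2 - 1) / 2) * x\<^sup>2)) * indicator A x \<partial>normal_measure)"
    if "A \<in> sets borel" for A i
    using that by (subst normal_measure_weight[OF u that]) (simp add: emeasure_distr)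
  have sM: "sets (PiM I ?N) = sets (PiM I ?M)" by (intro sets_PiM_cong) auto
  have "?L = PiM I ?M"
  proof (rule S.PiM_eqI[OF I])
    show "sets ?L = sets (PiM I ?M)" using sM by simp
    fix A assume "\<And>i. i \<in> I \<Longrightarrow> A i \<in> sets (?M i)"
    then have A[measurable]: "\<And>i. i \<in> I \<Longrightarrow> A i \<in> sets borel" by simp
    have "emeasure ?L (Pi\<^sub>E I A)
      = (\<integral>\<^sup>+x. (\<Prod>i\<in>I. ennreal (exp (- ((1 / u\<^sup>2 - 1) / 2) * (x i)\<^sup>2))) * indicator (Pi\<^sub>E I A) x \<partial>PiM I ?N)"
      by (rule emeasure_density) (auto intro!: sets_PiM_I_finite I simp: A)
    also have "\<dots> = (\<integral>\<^sup>+x. (\<Prod>i\<in>I. ennreal (exp (- ((1 / u\<^sup>2 - 1) / 2) * (x i)\<^sup>2)) * indicator (A i) (x i)) \<partial>PiM I ?N)"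
      using I by (intro nn_integral_cong) (simp add: indicator_PiE space_PiM PiE_iff prod.distrib)
    also have "\<dots> = (\<Prod>i\<in>I. \<integral>\<^sup>+x. ennreal (exp (- ((1 / u\<^sup>2 - 1) / 2) * x\<^sup>2)) * indicator (A i) x \<partial>normal_measure)"
      using A by (intro normal.product_nn_integral_prod I) auto
    also have "\<dots> = (\<Prod>i\<in>I. emeasure (?M i) (A i))"
      by (intro prod.cong refl eM[symmetric]) (auto simp: A)
    finally show "emeasure ?L (Pi\<^sub>E I A) = (\<Prod>i\<in>I. emeasure (?M i) (A i))" .
  qed
  moreover have "?R = PiM I ?M"
  proof (rule S.PiM_eqI[OF I])
    show "sets ?R = sets (PiM I ?M)" using sM by simp
    fix A assume "\<And>i. i \<in> I \<Longrightarrow> A i \<in> sets (?M i)"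
    then have A[measurable]: "\<And>i. i \<in> I \<Longrightarrow> A i \<in> sets borel" by simp
    have Au: "(\<lambda>x. u * x) -` A i \<in> sets borel" if "i \<in> I" for i
      using measurable_sets[OF _ A[OF that], of "\<lambda>x. u * x" borel] by simp
    have m: "(\<lambda>x. \<lambda>i\<in>I. u * x i) \<in> measurable (PiM I ?N) (PiM I ?N)"
      by (intro measurable_restrict) auto
    have pre: "(\<lambda>x. \<lambda>i\<in>I. u * x i) -` Pi\<^sub>E I A \<inter> space (PiM I ?N) = Pi\<^sub>E I (\<lambda>i. (\<lambda>x. u * x) -` A i)"
      by (auto simp: space_PiM PiE_iff)
    have "emeasure ?R (Pi\<^sub>E I A) = ennreal u ^ card I * emeasure (PiM I ?N) (Pi\<^sub>E I (\<lambda>i. (\<lambda>x. u * x) -` A i))"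
      by (simp add: emeasure_distr[OF m] pre[symmetric] sets_PiM_I_finite I A)
    also have "\<dots> = (\<Prod>i\<in>I. ennreal u * emeasure normal_measure ((\<lambda>x. u * x) -` A i))"
      using Au by (subst normal.emeasure_PiM) (auto simp: I prod.distrib)
    also have "\<dots> = (\<Prod>i\<in>I. emeasure (?M i) (A i))"
      using A by (intro prod.cong refl) (simp add: emeasure_distr)
    finally show "emeasure ?R (Pi\<^sub>E I A) = (\<Prod>i\<in>I. emeasure (?M i) (A i))" .
  qed
  ultimately show ?thesis by simp
qed

text \<open>
  The weighted Gaussian measure is a multiple of a rescaled Gaussian measure, and a cone is not
  changed by the rescaling.
\<close>

lemma gaussian_on_weight:
  fixes L :: "(real^'d) set"
  assumes u: "0 < u" and L: "subspace L" and A[measurable]: "A \<in> sets borel"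
    and cone: "\<And>x c. 0 < c \<Longrightarrow> x \<in> A \<longleftrightarrow> c *\<^sub>R x \<in> A"
  shows "(\<integral>\<^sup>+x. ennreal (gauss_weight u x) * indicator A x \<partial>gaussian_on L) = ennreal u ^ dim L * emeasure (gaussian_on L) A"
proof -
  let ?N = "\<lambda>_. normal_measure" and ?B = "onb_of L"
  let ?S = "\<lambda>g. \<Sum>b\<in>?B. g b *\<^sub>R b"
  note B = onb_of[OF L]
  have norm: "gauss_weight u (?S g) = (\<Prod>b\<in>?B. exp (- ((1 / u\<^sup>2 - 1) / 2) * (g b)\<^sup>2))" for g
  proof -
    have "(norm (?S g))\<^sup>2 = (\<Sum>b\<in>?B. (norm (g b *\<^sub>R b))\<^sup>2)"
      using B(1,4) by (intro norm_sum_Pythagorean) (auto simp: pairwise_def orthogonal_def)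
    also have "\<dots> = (\<Sum>b\<in>?B. (g b)\<^sup>2)" using B(2) by simp
    finally show ?thesis
      by (simp add: gauss_weight_def sum_distrib_left exp_sum B(4))
  qed
  have S: "?S \<in> measurable (PiM ?B ?N) borel" by (rule measurable_basis_sum)
  have "(\<integral>\<^sup>+x. ennreal (gauss_weight u x) * indicator A x \<partial>gaussian_on L)
     = (\<integral>\<^sup>+g. ennreal (gauss_weight u (?S g)) * indicator A (?S g) \<partial>PiM ?B ?N)"
    unfolding gaussian_on_def by (subst nn_integral_distr[OF S]) auto
  also have "\<dots> = (\<integral>\<^sup>+g. (\<Prod>b\<in>?B. ennreal (exp (- ((1 / u\<^sup>2 - 1) / 2) * (g b)\<^sup>2))) * indicator A (?S g) \<partial>PiM ?B ?N)"
    unfolding norm by (simp add: prod_ennreal)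
  also have "\<dots> = (\<integral>\<^sup>+g. indicator A (?S g) \<partial>density (PiM ?B ?N) (\<lambda>g. \<Prod>b\<in>?B. ennreal (exp (- ((1 / u\<^sup>2 - 1) / 2) * (g b)\<^sup>2))))"
    using S by (subst nn_integral_density) auto
  also have "\<dots> = ennreal u ^ card ?B * (\<integral>\<^sup>+g. indicator A (?S (\<lambda>i\<in>?B. u * g i)) \<partial>PiM ?B ?N)"
    unfolding PiM_normal_weight[OF u B(4)] using S
    by (subst nn_integral_scale_measure) (auto simp: nn_integral_distr)
  also have "(\<integral>\<^sup>+g. indicator A (?S (\<lambda>i\<in>?B. u * g i)) \<partial>PiM ?B ?N) = (\<integral>\<^sup>+g. indicator A (?S g) \<partial>PiM ?B ?N)"
  proof (intro nn_integral_cong)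
    fix g :: "real^'d \<Rightarrow> real"
    have "?S (\<lambda>i\<in>?B. u * g i) = u *\<^sub>R ?S g"
      by (simp add: scaleR_sum_right)
    then show "indicator A (?S (\<lambda>i\<in>?B. u * g i)) = (indicator A (?S g) :: ennreal)"
      using cone[OF u, of "?S g"] by (simp add: indicator_def)
  qed
  also have "\<dots> = (\<integral>\<^sup>+x. indicator A x \<partial>gaussian_on L)"
    unfolding gaussian_on_def by (subst nn_integral_distr[OF S]) auto
  finally show ?thesis by (simp add: B(5))
qed

section \<open>Tiles and the Steiner formula\<close>

lemma borel_closed_cone: "closed_cone C \<Longrightarrow> C \<in> sets borel"
  by (simp add: borel_closed closed_coneD(2))

lemma borel_subspace: "subspace L \<Longrightarrow> L \<in> sets (borel :: (real^'d) measure)"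
  by (simp add: borel_closed_cone closed_cone_subspace)

lemma continuous_closest_point_cone: "closed_cone C \<Longrightarrow> continuous_on UNIV (closest_point C)"
  by (simp add: continuous_on_closest_point closed_coneD)

lemma measurable_closest_point_cone: "closed_cone C \<Longrightarrow> closest_point C \<in> borel_measurable borel"
  by (rule borel_measurable_continuous_onI) (rule continuous_closest_point_cone)

lemma measurable_closest_point_subspace:
  "subspace L \<Longrightarrow> closest_point L \<in> borel_measurable (borel :: (real^'d) measure)"
  by (rule measurable_closest_point_cone) (rule closed_cone_subspace)

text \<open>
  The orthogonal projections of a Gaussian vector to \<open>L\<close> and to its complement are independent.
\<close>

lemma std_gauss_split_integral:
  fixes L :: "(real^'d) set"
  assumes L: "subspace L" and [measurable]: "f \<in> borel_measurable borel" "h \<in> borel_measurable borel"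
  shows "(\<integral>\<^sup>+g. f (closest_point L g) * h (closest_point (orthogonal_comp L) g) \<partial>std_gauss)
     = (\<integral>\<^sup>+x. f x \<partial>gaussian_on L) * (\<integral>\<^sup>+y. h y \<partial>gaussian_on (orthogonal_comp L))"
proof -
  let ?L' = "orthogonal_comp L"
  note [measurable] = measurable_closest_point_subspace[OF L] measurable_closest_point_subspace[OF subspace_orthogonal_comp[of L]]
  interpret G: prob_space "gaussian_on ?L'" by (rule prob_space_gaussian_on)
  have proj: "closest_point L (x + y) = x" "closest_point ?L' (x + y) = y" if "x \<in> L" "y \<in> ?L'" for x y
  proof -
    show "closest_point L (x + y) = x" using L that by (intro closest_point_subspace_unique) auto
    then show "closest_point ?L' (x + y) = y" by (simp add: closest_point_orthogonal_comp[OF L])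
  qed
  have "(\<integral>\<^sup>+g. f (closest_point L g) * h (closest_point ?L' g) \<partial>std_gauss)
    = (\<integral>\<^sup>+p. f (closest_point L (fst p + snd p)) * h (closest_point ?L' (fst p + snd p)) \<partial>(gaussian_on L \<Otimes>\<^sub>M gaussian_on ?L'))"
    by (subst std_gauss_split[OF L], subst nn_integral_distr) (auto simp: case_prod_beta')
  also have "\<dots> = (\<integral>\<^sup>+x. \<integral>\<^sup>+y. f (closest_point L (x + y)) * h (closest_point ?L' (x + y)) \<partial>gaussian_on ?L' \<partial>gaussian_on L)"
    by (subst G.nn_integral_fst[symmetric]) auto
  also have "\<dots> = (\<integral>\<^sup>+x. \<integral>\<^sup>+y. f x * h y \<partial>gaussian_on ?L' \<partial>gaussian_on L)"
  proof (rule nn_integral_cong_AE)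
    show "AE x in gaussian_on L. (\<integral>\<^sup>+y. f (closest_point L (x + y)) * h (closest_point ?L' (x + y)) \<partial>gaussian_on ?L')
       = (\<integral>\<^sup>+y. f x * h y \<partial>gaussian_on ?L')"
      using AE_gaussian_on[OF L]
    proof eventually_elim
      case (elim x)
      show ?case
        using AE_gaussian_on[OF subspace_orthogonal_comp[of L]]
        by (intro nn_integral_cong_AE) (auto simp: proj elim)
    qed
  qed
  also have "\<dots> = (\<integral>\<^sup>+x. f x \<partial>gaussian_on L) * (\<integral>\<^sup>+y. h y \<partial>gaussian_on ?L')"
    by (simp add: nn_integral_cmult nn_integral_multc)
  finally show ?thesis .
qed

text \<open>
  For a face span \<open>L\<close>, these are up to a null set the points whose projection to \<open>C\<close> lies in the
  relative interior of the face with span \<open>L\<close>.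
\<close>

definition tile :: "(real^'d) set \<Rightarrow> (real^'d) set \<Rightarrow> (real^'d) set" where
  "tile C L = {g. closest_point L g \<in> C \<and> closest_point (orthogonal_comp L) g \<in> polar_cone C}"

lemma closed_tile:
  assumes C: "closed_cone C" and L: "subspace (L :: (real^'d) set)"
  shows "closed (tile C L)"
proof -
  have "closed (closest_point L -` C)" "closed (closest_point (orthogonal_comp L) -` polar_cone C)"
    by (auto intro!: closed_vimage closed_coneD(2)[OF C] closed_coneD(2)[OF closed_cone_polar] continuous_closest_point_cone
       closed_cone_subspace L subspace_orthogonal_comp)
  moreover have "tile C L = closest_point L -` C \<inter> closest_point (orthogonal_comp L) -` polar_cone C"
    by (auto simp: tile_def)
  ultimately show ?thesis by auto
qed

lemma cone_iff_scale: "closed_cone C \<Longrightarrow> 0 < c \<Longrightarrow> x \<in> C \<longleftrightarrow> c *\<^sub>R x \<in> C"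
  using closed_coneD(6)[of C x c] closed_coneD(6)[of C "c *\<^sub>R x" "1 / c"] by auto

lemma tile_weight:
  fixes L :: "(real^'d) set"
  assumes C: "closed_cone C" and L: "subspace L" and u: "0 < u"
  shows "(\<integral>\<^sup>+g. ennreal (gauss_weight u (closest_point L g)) * indicator (tile C L) g \<partial>std_gauss)
     = ennreal u ^ dim L * emeasure std_gauss (tile C L)"
    and "(\<integral>\<^sup>+g. ennreal (gauss_weight u (closest_point (orthogonal_comp L) g)) * indicator (tile C L) g \<partial>std_gauss)
     = ennreal u ^ (CARD('d) - dim L) * emeasure std_gauss (tile C L)"
    and "emeasure std_gauss (tile C L) =
      emeasure (gaussian_on L) C * emeasure (gaussian_on (orthogonal_comp L)) (polar_cone C)"
proof -
  let ?L' = "orthogonal_comp L" and ?C' = "polar_cone C"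
  have [measurable]: "C \<in> sets borel" "?C' \<in> sets borel" "tile C L \<in> sets borel"
    using C L by (auto simp: borel_closed_cone closed_cone_polar closed_tile borel_closed)
  have ind: "indicator (tile C L) g = (indicator C (closest_point L g) * indicator ?C' (closest_point ?L' g) :: ennreal)" for g
    by (auto simp: tile_def indicator_def)
  show 0: "emeasure std_gauss (tile C L) = emeasure (gaussian_on L) C * emeasure (gaussian_on ?L') ?C'"
    using std_gauss_split_integral[OF L, of "indicator C" "indicator ?C'"]
    by (simp add: ind[symmetric])
  show "(\<integral>\<^sup>+g. ennreal (gauss_weight u (closest_point L g)) * indicator (tile C L) g \<partial>std_gauss)
     = ennreal u ^ dim L * emeasure std_gauss (tile C L)"
    using std_gauss_split_integral[OF L, of "\<lambda>x. ennreal (gauss_weight u x) * indicator C x" "indicator ?C'"]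
      gaussian_on_weight[OF u L _ cone_iff_scale[OF C]]
    unfolding 0 ind by (simp add: mult.assoc)
  show "(\<integral>\<^sup>+g. ennreal (gauss_weight u (closest_point ?L' g)) * indicator (tile C L) g \<partial>std_gauss)
     = ennreal u ^ (CARD('d) - dim L) * emeasure std_gauss (tile C L)"
    using std_gauss_split_integral[OF L, of "indicator C" "\<lambda>x. ennreal (gauss_weight u x) * indicator ?C' x"]
      gaussian_on_weight[OF u subspace_orthogonal_comp[of L] _ cone_iff_scale[OF closed_cone_polar[of C]]]
    unfolding 0 ind by (simp add: mult_ac dim_orthogonal_comp[OF L])
qed

lemma gauss_weight_subspace:
  fixes L :: "(real^'d) set"
  assumes L: "subspace L" and u: "0 < u"
  shows "(\<integral>\<^sup>+g. ennreal (gauss_weight u (closest_point L g)) \<partial>std_gauss) = ennreal u ^ dim L"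
proof -
  interpret G: prob_space "gaussian_on L" by (rule prob_space_gaussian_on)
  interpret G': prob_space "gaussian_on (orthogonal_comp L)" by (rule prob_space_gaussian_on)
  show ?thesis
    using std_gauss_split_integral[OF L, of "\<lambda>x. ennreal (gauss_weight u x)" "\<lambda>_. 1"]
      gaussian_on_weight[OF u L, of UNIV] G.emeasure_space_1 G'.emeasure_space_1 by simp
qed

lemma tile_project:
  assumes C: "closed_cone C" and L: "subspace (L :: (real^'d) set)" and g: "g \<in> tile C L"
  shows "closest_point C g = closest_point L g"
proof (rule closest_point_cone_unique[OF C])
  show "closest_point L g \<in> C" "g - closest_point L g \<in> polar_cone C"
    using g by (auto simp: tile_def closest_point_orthogonal_comp[OF L])
  show "closest_point L g \<bullet> (g - closest_point L g) = 0"
    using closest_point_cone(3)[OF closed_cone_subspace[OF L]] .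
qed

lemma AE_closest_point_not_in:
  fixes L L' :: "(real^'d) set"
  assumes L: "subspace L" and L': "subspace L'" and n: "\<not> L \<subseteq> L'"
  shows "AE g in std_gauss. closest_point L g \<notin> L'"
proof -
  have "subspace (closest_point L -` L')"
    by (rule linear_subspace_vimage[OF linear_closest_point[OF L] L'])
  moreover obtain x where "x \<in> L" "x \<notin> L'" using n by auto
  then have "x \<notin> closest_point L -` L'" by (simp add: closest_point_self)
  ultimately show ?thesis using null_proper_subspace[of "closest_point L -` L'"] by auto
qed

text \<open>
  The span of the smallest face at the projection of \<open>g\<close> has a tile that contains \<open>g\<close>. If \<open>g\<close> is in
  the tiles of \<open>L\<close> and \<open>L'\<close>, then its projections to \<open>L\<close>, \<open>L'\<close> and \<open>C\<close> coincide and lie in \<open>L \<inter> L'\<close>. This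
  has probability \<open>0\<close> unless \<open>L\<close> and \<open>L'\<close> contain each other.
\<close>

lemma AE_unique_tile:
  fixes C :: "(real^'d) set"
  assumes C: "polyhedral_cone C"
  shows "AE g in std_gauss. \<exists>L\<in>all_face_spans C. closest_point L g = closest_point C g \<and>
     (\<forall>L'\<in>all_face_spans C. g \<in> tile C L' \<longleftrightarrow> L' = L)"
proof -
  note fin = finite_all_face_spans[OF C] and cc = polyhedral_cone_closed[OF C]
  have "AE g in std_gauss. \<forall>L\<in>all_face_spans C. \<forall>L'\<in>all_face_spans C. \<not> L \<subseteq> L' \<longrightarrow> closest_point L g \<notin> L'"
    using fin AE_closest_point_not_in subspace_all_face_spans by (intro AE_finite_allI) (auto intro!: AE_finite_allI)
  then show ?thesis
  proof eventually_elim
    case (elim g)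
    let ?x = "closest_point C g"
    note x = closest_point_cone[OF cc, of g]
    obtain L where L: "L \<in> all_face_spans C" "?x \<in> L" "\<And>y. y \<in> polar_cone C \<Longrightarrow> ?x \<bullet> y = 0 \<Longrightarrow> y \<in> orthogonal_comp L"
      using minimal_face_span[OF C x(1)] by metis
    note sL = subspace_all_face_spans[OF L(1)]
    have Lx: "closest_point L g = ?x"
      using sL L(2) L(3)[OF x(2,3)] by (rule closest_point_subspace_unique)
    have t: "g \<in> tile C L"
      unfolding tile_def using x(1,2) by (simp add: closest_point_orthogonal_comp[OF sL] Lx)
    have "L' = L" if L': "L' \<in> all_face_spans C" "g \<in> tile C L'" for L'
    proof -
      note sL' = subspace_all_face_spans[OF L'(1)]
      have Lx': "closest_point L' g = ?x" using tile_project[OF cc sL' L'(2)] by simp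
      have "?x \<in> L'" using closest_point_subspace(1)[OF sL', of g] by (simp add: Lx')
      then have "L \<subseteq> L'" using elim L(1) L'(1) Lx by metis
      moreover have "L' \<subseteq> L" using elim L(1,2) L'(1) Lx' by metis
      ultimately show ?thesis by auto
    qed
    with L(1) Lx t show ?case by blast
  qed
qed

lemma intrinsic_volume_tiles:
  fixes C :: "(real^'d) set"
  assumes C: "polyhedral_cone C"
  shows "intrinsic_volume k C = (\<Sum>L\<in>{L \<in> all_face_spans C. dim L = k}. measure std_gauss (tile C L))"
proof -
  note cc = polyhedral_cone_closed[OF C]
  have fs: "face_spans k C = {L \<in> all_face_spans C. dim L = k}"
    by (auto simp: face_spans_def all_face_spans_def)
  have red: "measure (gaussian_on L) (K \<inter> L) = measure (gaussian_on L) K"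
    if "subspace L" "closed_cone K" for L K :: "(real^'d) set"
  proof (rule measure_eq_AE)
    show "AE x in gaussian_on L. (x \<in> K \<inter> L) = (x \<in> K)"
      using AE_gaussian_on[OF that(1)] by eventually_elim auto
  qed (use that in \<open>auto simp: borel_closed_cone borel_subspace\<close>)
  show ?thesis
    unfolding intrinsic_volume_def fs
  proof (intro sum.cong refl)
    fix L assume "L \<in> {L \<in> all_face_spans C. dim L = k}"
    then have L: "subspace L" using subspace_all_face_spans by auto
    show "measure (gaussian_on L) (C \<inter> L) * measure (gaussian_on (orthogonal_comp L)) (polar_cone C \<inter> orthogonal_comp L)
        = measure std_gauss (tile C L)"
      using tile_weight(3)[OF cc L, of 1]
      unfolding red[OF L cc] red[OF subspace_orthogonal_comp closed_cone_polar]
      by (simp add: measure_def enn2real_mult)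
  qed
qed

lemma sum_intrinsic_volume:
  fixes C :: "(real^'d) set" and f :: "nat \<Rightarrow> real"
  assumes C: "polyhedral_cone C"
  shows "(\<Sum>k\<le>CARD('d). intrinsic_volume k C * f k) = (\<Sum>L\<in>all_face_spans C. measure std_gauss (tile C L) * f (dim L))"
proof -
  have "(\<Sum>L\<in>all_face_spans C. measure std_gauss (tile C L) * f (dim L)) =
    (\<Sum>k\<le>CARD('d). \<Sum>L\<in>{L \<in> all_face_spans C. dim L = k}. measure std_gauss (tile C L) * f (dim L))"
    using finite_all_face_spans[OF C] dim_orthogonal_comp(2)[OF subspace_all_face_spans]
    by (intro sum.group[symmetric]) auto
  also have "\<dots> = (\<Sum>k\<le>CARD('d). intrinsic_volume k C * f k)"
    unfolding intrinsic_volume_tiles[OF C] sum_distrib_right by (intro sum.cong) auto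
  finally show ?thesis by simp
qed

lemma intrinsic_volume_nonneg: "polyhedral_cone C \<Longrightarrow> 0 \<le> intrinsic_volume k C"
  by (auto simp: intrinsic_volume_tiles intro!: sum_nonneg)

text \<open>
  Almost every point lies in exactly one tile, so the expectation splits into a sum over the tiles. It is
  used for the projection to the cone and for the projection to its polar, which on the tile of \<open>L\<close> are
  the projections to \<open>L\<close> and to its complement.
\<close>

lemma tile_sum_integral:
  fixes C :: "(real^'d) set" and e :: "nat \<Rightarrow> nat"
  assumes C: "polyhedral_cone C" and u: "0 < u"
    and agree: "\<And>L g. L \<in> all_face_spans C \<Longrightarrow> closest_point L g = closest_point C g \<Longrightarrow> Y g = X L g"
    and meas: "\<And>L. L \<in> all_face_spans C \<Longrightarrow> X L \<in> borel_measurable borel"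
    and weight: "\<And>L. L \<in> all_face_spans C \<Longrightarrow>
      (\<integral>\<^sup>+g. ennreal (gauss_weight u (X L g)) * indicator (tile C L) g \<partial>std_gauss)
        = ennreal u ^ e (dim L) * emeasure std_gauss (tile C L)"
  shows "(\<integral>\<^sup>+g. ennreal (gauss_weight u (Y g)) \<partial>std_gauss) = ennreal (\<Sum>k\<le>CARD('d). intrinsic_volume k C * u ^ e k)"
proof -
  interpret G: prob_space "std_gauss :: (real^'d) measure" by (rule prob_space_gaussian_on)
  note [measurable] = meas
  have [measurable]: "tile C L \<in> sets borel" if "L \<in> all_face_spans C" for L
    using subspace_all_face_spans[OF that] by (simp add: closed_tile borel_closed polyhedral_cone_closed C)
  note fin = finite_all_face_spans[OF C]
  have "(\<integral>\<^sup>+g. ennreal (gauss_weight u (Y g)) \<partial>std_gauss)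
    = (\<integral>\<^sup>+g. (\<Sum>L\<in>all_face_spans C. ennreal (gauss_weight u (X L g)) * indicator (tile C L) g) \<partial>std_gauss)"
  proof (rule nn_integral_cong_AE)
    show "AE g in std_gauss. ennreal (gauss_weight u (Y g))
      = (\<Sum>L\<in>all_face_spans C. ennreal (gauss_weight u (X L g)) * indicator (tile C L) g)"
      using AE_unique_tile[OF C]
    proof eventually_elim
      case (elim g)
      then obtain L where L: "L \<in> all_face_spans C" "closest_point L g = closest_point C g"
        "\<And>L'. L' \<in> all_face_spans C \<Longrightarrow> g \<in> tile C L' \<longleftrightarrow> L' = L" by blast
      have "(\<Sum>L\<in>all_face_spans C. ennreal (gauss_weight u (X L g)) * indicator (tile C L) g)
        = (\<Sum>L'\<in>all_face_spans C. if L' = L then ennreal (gauss_weight u (Y g)) else 0)"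
        using L(3) agree[OF L(1,2)] by (intro sum.cong) auto
      then show ?case using L(1) fin by simp
    qed
  qed
  also have "\<dots> = (\<Sum>L\<in>all_face_spans C. ennreal u ^ e (dim L) * emeasure std_gauss (tile C L))"
    using weight by (subst nn_integral_sum) auto
  also have "\<dots> = ennreal (\<Sum>L\<in>all_face_spans C. measure std_gauss (tile C L) * u ^ e (dim L))"
    using u by (subst sum_ennreal[symmetric]) (auto simp: G.emeasure_eq_measure ennreal_power ennreal_mult'[symmetric] mult.commute)
  finally show ?thesis
    unfolding sum_intrinsic_volume[OF C, of "\<lambda>k. u ^ e k"] .
qed

lemma steiner_nn:
  fixes C :: "(real^'d) set"
  assumes C: "polyhedral_cone C" and u: "0 < u"
  shows "(\<integral>\<^sup>+g. ennreal (gauss_weight u (closest_point C g)) \<partial>std_gauss)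
      = ennreal (\<Sum>k\<le>CARD('d). intrinsic_volume k C * u ^ k)"
    and "(\<integral>\<^sup>+g. ennreal (gauss_weight u (closest_point (polar_cone C) g)) \<partial>std_gauss)
      = ennreal (\<Sum>k\<le>CARD('d). intrinsic_volume k C * u ^ (CARD('d) - k))"
proof -
  note cc = polyhedral_cone_closed[OF C] and sub = subspace_all_face_spans[of _ C]
  show "(\<integral>\<^sup>+g. ennreal (gauss_weight u (closest_point C g)) \<partial>std_gauss)
      = ennreal (\<Sum>k\<le>CARD('d). intrinsic_volume k C * u ^ k)"
    by (rule tile_sum_integral[OF C u, where X=closest_point])
      (use sub tile_weight(1)[OF cc _ u] in \<open>auto intro: measurable_closest_point_subspace\<close>)
  show "(\<integral>\<^sup>+g. ennreal (gauss_weight u (closest_point (polar_cone C) g)) \<partial>std_gauss)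
      = ennreal (\<Sum>k\<le>CARD('d). intrinsic_volume k C * u ^ (CARD('d) - k))"
  proof (rule tile_sum_integral[OF C u, where X="\<lambda>L. closest_point (orthogonal_comp L)"])
    fix L g assume L: "L \<in> all_face_spans C" and "closest_point L g = closest_point C g"
    then show "closest_point (polar_cone C) g = closest_point (orthogonal_comp L) g"
      by (simp add: closest_point_polar[OF cc] closest_point_orthogonal_comp[OF sub[OF L]])
  qed (use sub tile_weight(2)[OF cc _ u] in \<open>auto intro: measurable_closest_point_subspace subspace_orthogonal_comp\<close>)
qed

lemma gauss_weight_1 [simp]: "gauss_weight 1 x = 1"
  by (simp add: gauss_weight_def)

lemma gauss_weight_nonneg: "0 \<le> gauss_weight u x"
  by (simp add: gauss_weight_def)

lemma gauss_weight_le_1: "0 < u \<Longrightarrow> u \<le> 1 \<Longrightarrow> gauss_weight u x \<le> 1"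
proof -
  assume u: "0 < u" "u \<le> 1"
  then have "u\<^sup>2 \<le> 1" by (simp add: power_le_one)
  then have "1 / u\<^sup>2 - 1 \<ge> 0" using u by simp
  then have "(1 / u\<^sup>2 - 1) / 2 * (norm x)\<^sup>2 \<ge> 0" by (intro mult_nonneg_nonneg) auto
  then show ?thesis by (simp add: gauss_weight_def)
qed

lemma gauss_weight_norm: "norm x = norm y \<Longrightarrow> gauss_weight u x = gauss_weight u y"
  by (simp add: gauss_weight_def)

lemma steiner:
  fixes C :: "(real^'d) set"
  assumes C: "polyhedral_cone C" and u: "0 < u"
  shows "(\<integral>g. gauss_weight u (closest_point C g) \<partial>std_gauss) = (\<Sum>k\<le>CARD('d). intrinsic_volume k C * u ^ k)"
proof -
  have [measurable]: "closest_point C \<in> borel_measurable borel"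
    by (intro measurable_closest_point_cone polyhedral_cone_closed C)
  show ?thesis
    using steiner_nn(1)[OF C u] u
    by (subst integral_eq_nn_integral)
      (auto simp: gauss_weight_nonneg intrinsic_volume_nonneg[OF C] sum_nonneg)
qed

lemma polynomial_coeffs_eq:
  fixes a b :: "nat \<Rightarrow> real"
  assumes "\<And>u. 0 < u \<Longrightarrow> u < 1 \<Longrightarrow> (\<Sum>k\<le>n. a k * u ^ k) = (\<Sum>k\<le>n. b k * u ^ k)" and "k \<le> n"
  shows "a k = b k"
proof (rule ccontr)
  assume "a k \<noteq> b k"
  then have "finite {u. (\<Sum>k\<le>n. (a k - b k) * u ^ k) = 0}"
    using polyfun_finite_roots[of "\<lambda>k. a k - b k" n] assms(2) by auto
  moreover have "{0<..<1} \<subseteq> {u. (\<Sum>k\<le>n. (a k - b k) * u ^ k) = 0}"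
    using assms(1) by (auto simp: left_diff_distrib sum_subtractf)
  ultimately have "finite {0<..<1::real}" by (rule finite_subset[rotated])
  then show False using infinite_Ioo[of "0::real" 1] by simp
qed

lemma sum_intrinsic_volume_1:
  fixes C :: "(real^'d) set"
  assumes C: "polyhedral_cone C"
  shows "(\<Sum>k\<le>CARD('d). intrinsic_volume k C) = 1"
proof -
  interpret G: prob_space "std_gauss :: (real^'d) measure" by (rule prob_space_gaussian_on)
  show ?thesis using steiner[OF C, of 1] G.prob_space by simp
qed

lemma intrinsic_volume_gt:
  fixes C :: "(real^'d) set"
  assumes C: "polyhedral_cone C" and "CARD('d) < k"
  shows "intrinsic_volume k C = 0"
proof -
  have "{L \<in> all_face_spans C. dim L = k} = {}"
    using dim_orthogonal_comp(2)[OF subspace_all_face_spans, of _ C] assms(2) by force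
  then show ?thesis unfolding intrinsic_volume_tiles[OF C] by (simp only: sum.empty)
qed

lemma intrinsic_volume_le_1:
  fixes C :: "(real^'d) set"
  assumes C: "polyhedral_cone C"
  shows "intrinsic_volume k C \<le> 1"
proof (cases "k \<le> CARD('d)")
  case True
  then show ?thesis
    unfolding sum_intrinsic_volume_1[OF C, symmetric]
    by (intro member_le_sum) (auto simp: intrinsic_volume_nonneg[OF C])
qed (use intrinsic_volume_gt[OF C, of k] in auto)

text \<open>
  The Steiner polynomial of the polar cone has the coefficients of that of \<open>C\<close> in reverse order.
\<close>

lemma intrinsic_volume_polar:
  fixes C :: "(real^'d) set"
  assumes C: "polyhedral_cone C" and k: "k \<le> CARD('d)"
  shows "intrinsic_volume k (polar_cone C) = intrinsic_volume (CARD('d) - k) C"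
proof (rule polynomial_coeffs_eq[OF _ k])
  fix u :: real assume u: "0 < u" "u < 1"
  have "ennreal (\<Sum>k\<le>CARD('d). intrinsic_volume k (polar_cone C) * u ^ k)
    = ennreal (\<Sum>k\<le>CARD('d). intrinsic_volume k C * u ^ (CARD('d) - k))"
    using steiner_nn(1)[OF polyhedral_cone_polar[OF C] u(1)] steiner_nn(2)[OF C u(1)] by simp
  then have "(\<Sum>k\<le>CARD('d). intrinsic_volume k (polar_cone C) * u ^ k)
    = (\<Sum>k\<le>CARD('d). intrinsic_volume k C * u ^ (CARD('d) - k))"
    using u by (subst (asm) ennreal_inj)
      (auto intro!: sum_nonneg mult_nonneg_nonneg intrinsic_volume_nonneg polyhedral_cone_polar C)
  also have "\<dots> = (\<Sum>k\<le>CARD('d). intrinsic_volume (CARD('d) - k) C * u ^ k)"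
    by (rule sum.reindex_bij_witness[of _ "\<lambda>k. CARD('d) - k" "\<lambda>k. CARD('d) - k"]) auto
  finally show "(\<Sum>k\<le>CARD('d). intrinsic_volume k (polar_cone C) * u ^ k)
    = (\<Sum>k\<le>CARD('d). intrinsic_volume (CARD('d) - k) C * u ^ k)" .
qed

lemma intrinsic_volume_orthogonal_image:
  fixes f :: "real^'d \<Rightarrow> real^'d"
  assumes f: "orthogonal_transformation f" and C: "polyhedral_cone C"
  shows "intrinsic_volume k (f ` C) = intrinsic_volume k C"
proof (cases "k \<le> CARD('d)")
  case True
  note fC = polyhedral_cone_orthogonal_image[OF f C]
  note [measurable] = orthogonal_borel_measurable[OF f]
  have [measurable]: "closest_point C \<in> borel_measurable borel" "closest_point (f ` C) \<in> borel_measurable borel"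
    by (intro measurable_closest_point_cone polyhedral_cone_closed C fC)+
  show ?thesis
  proof (rule polynomial_coeffs_eq[OF _ True])
    fix u :: real assume u: "0 < u" "u < 1"
    have "(\<integral>g. gauss_weight u (closest_point (f ` C) g) \<partial>std_gauss)
      = (\<integral>g. gauss_weight u (closest_point (f ` C) (f g)) \<partial>std_gauss)"
      by (subst std_gauss_orthogonal[OF f, symmetric], subst integral_distr) auto
    also have "\<dots> = (\<integral>g. gauss_weight u (closest_point C g) \<partial>std_gauss)"
      using f by (intro Bochner_Integration.integral_cong refl gauss_weight_norm)
        (simp add: closest_point_orthogonal_image[OF f polyhedral_cone_closed[OF C]] orthogonal_transformation_norm)
    finally show "(\<Sum>k\<le>CARD('d). intrinsic_volume k (f ` C) * u ^ k) = (\<Sum>k\<le>CARD('d). intrinsic_volume k C * u ^ k)"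
      unfolding steiner[OF C u(1)] steiner[OF fC u(1)] .
  qed
qed (simp add: intrinsic_volume_gt C polyhedral_cone_orthogonal_image[OF f C])

lemma intrinsic_volume_subspace:
  fixes L :: "(real^'d) set"
  assumes L: "subspace L"
  shows "intrinsic_volume k L = (if k = dim L then 1 else 0)"
proof -
  interpret G: prob_space "std_gauss :: (real^'d) measure" by (rule prob_space_gaussian_on)
  have "\<And>z x. \<forall>x\<in>L. x \<bullet> z \<le> 0 \<Longrightarrow> x \<in> L \<Longrightarrow> x \<bullet> z = 0"
    using polar_subspace[OF L] unfolding polar_cone_def orthogonal_comp_def orthogonal_def by auto
  then have "cone_face F L \<longleftrightarrow> F = L" for F
    unfolding cone_face_def by (auto intro!: exI[of _ 0])
  then have sp: "all_face_spans L = {L}"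
    using L by (auto simp: all_face_spans_def span_eq_iff)
  have "tile L L = UNIV"
    unfolding tile_def using closest_point_subspace(1)[OF L] closest_point_subspace(1)[OF subspace_orthogonal_comp[of L]]
    by (simp add: polar_subspace[OF L])
  then show ?thesis
    unfolding intrinsic_volume_tiles[OF polyhedral_cone_subspace[OF L]] sp
    using G.prob_space by (cases "k = dim L") (auto simp: Collect_conv_if)
qed

section \<open>Measurability of vectors and matrices\<close>

lemma borel_measurable_vecI:
  fixes f :: "'w \<Rightarrow> ('b::euclidean_space)^'n"
  assumes "\<And>i. (\<lambda>x. f x $ i) \<in> borel_measurable M"
  shows "f \<in> borel_measurable M"
proof (subst borel_measurable_euclidean_space, intro ballI)
  fix e :: "'b^'n" assume "e \<in> Basis"
  then obtain i b where e: "e = axis i b" by (auto simp: Basis_vec_def)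
  have "(\<lambda>x. f x $ i \<bullet> b) \<in> borel_measurable M" using assms by measurable
  then show "(\<lambda>x. f x \<bullet> e) \<in> borel_measurable M"
    by (simp add: e inner_axis)
qed

lemma borel_measurable_vec_nth [measurable]:
  fixes f :: "'w \<Rightarrow> ('b::euclidean_space)^'n"
  assumes "f \<in> borel_measurable M"
  shows "(\<lambda>x. f x $ i) \<in> borel_measurable M"
  using assms by (rule borel_measurable_continuous_on[rotated]) (intro continuous_intros)

lemma borel_measurable_vec_lambda [measurable]:
  fixes f :: "'w \<Rightarrow> 'n::finite \<Rightarrow> 'b::euclidean_space"
  assumes "\<And>i. (\<lambda>x. f x i) \<in> borel_measurable M"
  shows "(\<lambda>x. \<chi> i. f x i) \<in> borel_measurable M"
  using assms by (intro borel_measurable_vecI) simp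

lemma borel_measurable_matrix_vector_mult [measurable]:
  fixes A :: "'w \<Rightarrow> real^'n^'m"
  assumes [measurable]: "A \<in> borel_measurable M" "x \<in> borel_measurable M"
  shows "(\<lambda>w. A w *v x w) \<in> borel_measurable M"
  unfolding matrix_vector_mult_def by measurable

lemma borel_measurable_matrix_matrix_mult [measurable]:
  fixes A :: "'w \<Rightarrow> real^'n^'m" and B :: "'w \<Rightarrow> real^'p^'n"
  assumes [measurable]: "A \<in> borel_measurable M" "B \<in> borel_measurable M"
  shows "(\<lambda>w. A w ** B w) \<in> borel_measurable M"
  unfolding matrix_matrix_mult_def by measurable

lemma borel_measurable_transpose [measurable]:
  fixes A :: "'w \<Rightarrow> real^'n^'m"
  assumes [measurable]: "A \<in> borel_measurable M"
  shows "(\<lambda>w. transpose (A w)) \<in> borel_measurable M"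
  unfolding transpose_def by measurable

lemma borel_measurable_det [measurable]:
  fixes A :: "'w \<Rightarrow> real^'n^'n"
  assumes [measurable]: "A \<in> borel_measurable M"
  shows "(\<lambda>w. det (A w)) \<in> borel_measurable M"
  unfolding det_def by measurable

lemma orthogonal_matrix_transformation: "orthogonal_matrix (Q :: real^'d^'d) \<longleftrightarrow> orthogonal_transformation ((*v) Q)"
  by (simp add: orthogonal_transformation_matrix)

lemma orthogonal_matrix_transpose_mult:
  assumes "orthogonal_matrix (Q :: real^'d^'d)"
  shows "transpose Q *v (Q *v x) = x" "Q *v (transpose Q *v x) = x"
  using assms by (simp_all add: orthogonal_matrix_def matrix_vector_mul_assoc del: transpose_matrix_vector)

section \<open>Random cones\<close>

text \<open>
  The second argument is replaced by the first point of a countable dense sequence that is within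
  distance \<open>1 / (k + 1)\<close> of it, and \<open>k\<close> tends to infinity.
\<close>

lemma borel_measurable_Caratheodory:
  fixes f :: "'w \<Rightarrow> 'a::{second_countable_topology, metric_space} \<Rightarrow> 'b::metric_space"
  assumes m: "\<And>x. (\<lambda>w. f w x) \<in> borel_measurable N"
    and c: "\<And>w. w \<in> space N \<Longrightarrow> continuous_on UNIV (f w)"
  shows "(\<lambda>(w, x). f w x) \<in> borel_measurable (N \<Otimes>\<^sub>M borel)"
proof -
  obtain D :: "'a set" where D: "countable D" "\<And>X. open X \<Longrightarrow> X \<noteq> {} \<Longrightarrow> \<exists>d\<in>D. d \<in> X"
    using countable_dense_setE by metis
  \<comment> \<open>The enumeration repeats points if \<open>D\<close> is finite, which does no harm.\<close>
  define q where "q = from_nat_into D"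
  have q: "\<exists>n. dist x (q n) < e" if "e > 0" for x e
  proof -
    have "ball x e \<noteq> {}" using that by auto
    then obtain d where "d \<in> D" "d \<in> ball x e" using D(2)[of "ball x e"] by blast
    then show ?thesis
      using from_nat_into_surj[OF D(1), of d] by (auto simp: q_def)
  qed
  define n where "n k x = (LEAST n. dist x (q n) < 1 / real (Suc k))" for k x
  have n: "dist x (q (n k x)) < 1 / real (Suc k)" for k x
    unfolding n_def by (rule LeastI_ex) (rule q, simp)
  have [measurable]: "n k \<in> measurable borel (count_space UNIV)" for k
    unfolding n_def by measurable
  have conv: "(\<lambda>k. q (n k x)) \<longlonglongrightarrow> x" for x
  proof (rule metric_LIMSEQ_I)
    fix r :: real assume "0 < r"
    then obtain K where K: "1 / real (Suc K) < r" using nat_approx_posE by blast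
    show "\<exists>no. \<forall>k\<ge>no. dist (q (n k x)) x < r"
    proof (intro exI allI impI)
      fix k assume "K \<le> k"
      then have "1 / real (Suc k) \<le> 1 / real (Suc K)" by (intro divide_left_mono) auto
      with n[of x k] K show "dist (q (n k x)) x < r" by (simp add: dist_commute)
    qed
  qed
  have "(\<lambda>p. f (fst p) (snd p)) \<in> borel_measurable (N \<Otimes>\<^sub>M borel)"
  proof (rule borel_measurable_LIMSEQ_metric)
    show "(\<lambda>p. f (fst p) (q (n k (snd p)))) \<in> borel_measurable (N \<Otimes>\<^sub>M borel)" for k
    proof (rule measurable_compose_countable[where g="\<lambda>p. n k (snd p)" and f="\<lambda>i p. f (fst p) (q i)"])
      show "(\<lambda>p. f (fst p) (q i)) \<in> borel_measurable (N \<Otimes>\<^sub>M borel)" for i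
        using m by (rule measurable_compose[OF measurable_fst])
    qed measurable
    fix p assume "p \<in> space (N \<Otimes>\<^sub>M (borel :: 'a measure))"
    then have "continuous_on UNIV (f (fst p))" using c by (auto simp: space_pair_measure)
    then show "(\<lambda>k. f (fst p) (q (n k (snd p)))) \<longlonglongrightarrow> f (fst p) (snd p)"
      using conv by (intro continuous_on_tendsto_compose[where s=UNIV and f="f (fst p)"]) auto
  qed
  then show ?thesis by (simp add: case_prod_beta')
qed

text \<open>
  Measurability of the projections is stable under polars, rotations and sums, and it is what the
  Steiner formula needs in order to make the intrinsic volumes measurable.
\<close>

definition random_cone :: "'w measure \<Rightarrow> ('w \<Rightarrow> (real^'d) set) \<Rightarrow> bool" where
  "random_cone N C \<longleftrightarrow> (\<forall>w\<in>space N. closed_cone (C w)) \<and> (\<forall>g. (\<lambda>w. closest_point (C w) g) \<in> borel_measurable N)"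

lemma random_coneD:
  assumes "random_cone N C"
  shows "\<And>w. w \<in> space N \<Longrightarrow> closed_cone (C w)" "(\<lambda>w. closest_point (C w) g) \<in> borel_measurable N"
  using assms by (auto simp: random_cone_def)

lemma random_cone_joint:
  fixes C :: "'w \<Rightarrow> (real^'d) set"
  assumes "random_cone N C"
  shows "(\<lambda>(w, g). closest_point (C w) g) \<in> borel_measurable (N \<Otimes>\<^sub>M borel)"
  using assms continuous_closest_point_cone
  by (intro borel_measurable_Caratheodory) (auto simp: random_cone_def)

lemma random_cone_compose:
  fixes C :: "'w \<Rightarrow> (real^'d) set"
  assumes C: "random_cone N C" and f: "f \<in> borel_measurable N"
  shows "(\<lambda>w. closest_point (C w) (f w)) \<in> borel_measurable N"
proof -
  have "(\<lambda>w. (w, f w)) \<in> measurable N (N \<Otimes>\<^sub>M borel)" using f by measurable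
  from measurable_compose[OF this random_cone_joint[OF C]] show ?thesis by simp
qed

lemma random_cone_const: "closed_cone C \<Longrightarrow> random_cone N (\<lambda>_. C)"
  by (simp add: random_cone_def)

lemma random_cone_cong:
  "random_cone N C \<Longrightarrow> (\<And>w. w \<in> space N \<Longrightarrow> C w = D w) \<Longrightarrow> random_cone N D"
  unfolding random_cone_def by (auto cong: measurable_cong)

lemma random_cone_reparam:
  assumes "random_cone N C" "f \<in> measurable M N"
  shows "random_cone M (\<lambda>w. C (f w))"
  using assms unfolding random_cone_def by (auto dest: measurable_space intro: measurable_compose)

lemma random_cone_polar:
  fixes C :: "'w \<Rightarrow> (real^'d) set"
  assumes C: "random_cone N C"
  shows "random_cone N (\<lambda>w. polar_cone (C w))"
  unfolding random_cone_def
proof (intro conjI ballI allI)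
  fix g
  have "(\<lambda>w. g - closest_point (C w) g) \<in> borel_measurable N" using random_coneD(2)[OF C] by measurable
  also have "?this \<longleftrightarrow> (\<lambda>w. closest_point (polar_cone (C w)) g) \<in> borel_measurable N"
    by (intro measurable_cong) (simp add: closest_point_polar random_coneD(1)[OF C])
  finally show "(\<lambda>w. closest_point (polar_cone (C w)) g) \<in> borel_measurable N" .
qed (rule closed_cone_polar)

lemma random_cone_rotate:
  fixes C :: "'w \<Rightarrow> (real^'d) set"
  assumes C: "random_cone N C" and Q[measurable]: "Q \<in> borel_measurable N"
    and orth: "\<And>w. w \<in> space N \<Longrightarrow> orthogonal_matrix (Q w)"
  shows "random_cone N (\<lambda>w. (*v) (Q w) ` C w)"
  unfolding random_cone_def
proof (intro conjI ballI allI)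
  show "closed_cone ((*v) (Q w) ` C w)" if "w \<in> space N" for w
    using orth[OF that] random_coneD(1)[OF C that]
    by (intro closed_cone_orthogonal_image) (auto simp: orthogonal_matrix_transformation)
  fix g
  have [measurable]: "(\<lambda>w. closest_point (C w) (transpose (Q w) *v g)) \<in> borel_measurable N"
    by (rule random_cone_compose[OF C]) measurable
  have "(\<lambda>w. Q w *v closest_point (C w) (transpose (Q w) *v g)) \<in> borel_measurable N" by measurable
  also have "?this \<longleftrightarrow> (\<lambda>w. closest_point ((*v) (Q w) ` C w) g) \<in> borel_measurable N"
  proof (intro measurable_cong)
    fix w assume w: "w \<in> space N"
    show "Q w *v closest_point (C w) (transpose (Q w) *v g) = closest_point ((*v) (Q w) ` C w) g"
      using closest_point_orthogonal_image[of "(*v) (Q w)" "C w" "transpose (Q w) *v g"] orth[OF w]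
        random_coneD(1)[OF C w]
      by (simp add: orthogonal_matrix_transformation[symmetric] orthogonal_matrix_transpose_mult del: transpose_matrix_vector)
  qed
  finally show "(\<lambda>w. closest_point ((*v) (Q w) ` C w) g) \<in> borel_measurable N" .
qed

lemma closest_point_cone_norm:
  assumes "closed_cone C"
  shows "closest_point C g \<bullet> g = (norm (closest_point C g))\<^sup>2"
    "(norm (g - closest_point C g))\<^sup>2 = (norm g)\<^sup>2 - (norm (closest_point C g))\<^sup>2"
proof -
  show 1: "closest_point C g \<bullet> g = (norm (closest_point C g))\<^sup>2"
    using closest_point_cone(3)[OF assms, of g] by (simp add: inner_diff_right power2_norm_eq_inner)
  show "(norm (g - closest_point C g))\<^sup>2 = (norm g)\<^sup>2 - (norm (closest_point C g))\<^sup>2"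
    using 1 by (simp add: power2_norm_eq_inner inner_diff_left inner_diff_right inner_commute)
qed

text \<open>
  Half the squared norm of the projection is the supremum of \<open>\<langle>g, z\<rangle> - |z|\<^sup>2 / 2\<close> over \<open>z\<close> in the cone.
  It is a convex function of \<open>g\<close> whose gradient is the projection.
\<close>

lemma closest_point_cone_gradient:
  assumes C: "closed_cone C"
  shows "\<bar>((norm (closest_point C (g + h)))\<^sup>2 - (norm (closest_point C g))\<^sup>2) / 2 - closest_point C g \<bullet> h\<bar> \<le> (norm h)\<^sup>2"
proof -
  let ?P = "closest_point C"
  have lower: "(norm (?P a))\<^sup>2 \<le> (norm (?P b))\<^sup>2 + 2 * (?P a \<bullet> (a - b))" for a b
  proof -
    have "dist b (?P b) \<le> dist b (?P a)"
      using closest_point_cone(1)[OF C] closed_coneD(2)[OF C] by (intro closest_point_le)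
    then have "(norm (b - ?P b))\<^sup>2 \<le> (norm (b - ?P a))\<^sup>2"
      by (simp add: dist_norm)
    also have "(norm (b - ?P a))\<^sup>2 = (norm b)\<^sup>2 - 2 * (?P a \<bullet> b) + (norm (?P a))\<^sup>2"
      by (simp add: power2_norm_eq_inner inner_diff_left inner_diff_right inner_commute)
    finally show ?thesis
      using closest_point_cone_norm[OF C, of a] closest_point_cone_norm[OF C, of b]
      by (simp add: inner_diff_right)
  qed
  have "(?P (g + h) - ?P g) \<bullet> h \<le> norm (?P (g + h) - ?P g) * norm h" by (rule norm_cauchy_schwarz)
  also have "norm (?P (g + h) - ?P g) \<le> norm h"
    using closest_point_lipschitz[OF closed_coneD(1-3)[OF C], of "g + h" g] by (simp add: dist_norm)
  finally have "(?P (g + h) - ?P g) \<bullet> h \<le> (norm h)\<^sup>2" by (simp add: power2_eq_square mult_right_mono)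
  moreover have "0 \<le> (norm h)\<^sup>2" by simp
  ultimately show ?thesis
    using lower[of g "g + h"] lower[of "g + h" g] unfolding abs_le_iff inner_diff_left
    by (auto simp: field_simps)
qed

text \<open>
  The coordinates of the projection are limits of difference quotients of half its squared norm.
\<close>

lemma random_cone_norm:
  fixes C :: "'w \<Rightarrow> (real^'d) set"
  assumes C: "\<And>w. w \<in> space N \<Longrightarrow> closed_cone (C w)"
    and m: "\<And>g. (\<lambda>w. norm (closest_point (C w) g)) \<in> borel_measurable N"
  shows "random_cone N C"
  unfolding random_cone_def
proof (intro conjI ballI allI)
  fix g
  show "(\<lambda>w. closest_point (C w) g) \<in> borel_measurable N"
  proof (subst borel_measurable_euclidean_space, intro ballI)
    fix e :: "real^'d" assume e: "e \<in> Basis"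
    note [measurable] = m
    show "(\<lambda>w. closest_point (C w) g \<bullet> e) \<in> borel_measurable N"
    proof (rule borel_measurable_LIMSEQ_real)
      let ?f = "\<lambda>n w. real (Suc n) * (((norm (closest_point (C w) (g + (1 / real (Suc n)) *\<^sub>R e)))\<^sup>2 - (norm (closest_point (C w) g))\<^sup>2) / 2)"
      show "?f n \<in> borel_measurable N" for n by measurable
      fix w assume w: "w \<in> space N"
      show "(\<lambda>n. ?f n w) \<longlonglongrightarrow> closest_point (C w) g \<bullet> e"
      proof (rule LIM_zero_cancel, rule Lim_null_comparison)
        show "\<forall>\<^sub>F n in sequentially. norm (?f n w - closest_point (C w) g \<bullet> e) \<le> 1 / real (Suc n)"
        proof (intro always_eventually allI)
          fix n
          define h where "h = (1 / real (Suc n)) *\<^sub>R e"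
          let ?D = "((norm (closest_point (C w) (g + h)))\<^sup>2 - (norm (closest_point (C w) g))\<^sup>2) / 2 - closest_point (C w) g \<bullet> h"
          have "?f n w - closest_point (C w) g \<bullet> e = real (Suc n) * ?D"
            unfolding h_def by (simp add: right_diff_distrib)
          moreover have "\<bar>?D\<bar> \<le> (norm h)\<^sup>2" by (rule closest_point_cone_gradient[OF C[OF w]])
          moreover have "(norm h)\<^sup>2 = 1 / (real (Suc n))\<^sup>2"
            using e by (simp add: h_def power_divide)
          ultimately have "norm (?f n w - closest_point (C w) g \<bullet> e) \<le> real (Suc n) * (1 / (real (Suc n))\<^sup>2)"
            by (simp only: real_norm_def abs_mult abs_of_nat) (intro mult_left_mono, auto)
          also have "\<dots> = 1 / real (Suc n)" by (simp add: power2_eq_square)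
          finally show "norm (?f n w - closest_point (C w) g \<bullet> e) \<le> 1 / real (Suc n)" .
        qed
        show "(\<lambda>n. 1 / real (Suc n)) \<longlonglongrightarrow> 0" by (rule LIMSEQ_Suc) (rule lim_1_over_n)
      qed
    qed
  qed
qed (rule C)

text \<open>
  The distance from \<open>g\<close> to \<open>C + D\<close> is the infimum over \<open>x\<close> in \<open>C\<close> of the distance from \<open>g - x\<close> to \<open>D\<close>.
  By continuity, \<open>x\<close> need only range over the projections to \<open>C\<close> of a countable dense set.
\<close>

lemma random_cone_sum:
  fixes C D :: "'w \<Rightarrow> (real^'d) set"
  assumes C: "random_cone N C" and D: "random_cone N D"
    and S: "\<And>w. w \<in> space N \<Longrightarrow> closed_cone (C w + D w)"
  shows "random_cone N (\<lambda>w. C w + D w)"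
proof (rule random_cone_norm[OF S])
  fix g
  obtain Q :: "(real^'d) set" where Q: "countable Q" "\<And>X. open X \<Longrightarrow> X \<noteq> {} \<Longrightarrow> \<exists>d\<in>Q. d \<in> X"
    using countable_dense_setE by metis
  have ne: "Q \<noteq> {}" using Q(2)[of UNIV] by auto
  define a where "a q w = norm ((g - closest_point (C w) q) - closest_point (D w) (g - closest_point (C w) q))" for q w
  have a: "a q \<in> borel_measurable N" for q
  proof -
    note [measurable] = random_coneD(2)[OF C]
    have [measurable]: "(\<lambda>w. closest_point (D w) (g - closest_point (C w) q)) \<in> borel_measurable N"
      by (rule random_cone_compose[OF D]) measurable
    show ?thesis unfolding a_def by measurable
  qed
  have "(\<lambda>w. INF q\<in>Q. a q w) \<in> borel_measurable N"
  proof (rule borel_measurable_cINF[OF Q(1) a])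
    show "bdd_below ((\<lambda>q. a q w) ` Q)" for w by (rule bdd_belowI[of _ 0]) (auto simp: a_def)
  qed
  then have "(\<lambda>w. sqrt ((norm g)\<^sup>2 - (INF q\<in>Q. a q w)\<^sup>2)) \<in> borel_measurable N" by measurable
  also have "?this \<longleftrightarrow> (\<lambda>w. norm (closest_point (C w + D w) g)) \<in> borel_measurable N"
  proof (rule measurable_cong)
    fix w assume w: "w \<in> space N"
    note c = random_coneD(1)[OF C w] and d = random_coneD(1)[OF D w] and s = S[OF w]
    let ?p = "closest_point (C w + D w) g"
    have "(INF q\<in>Q. a q w) = norm (g - ?p)"
    proof (rule antisym)
      show "norm (g - ?p) \<le> (INF q\<in>Q. a q w)"
      proof (rule cINF_greatest[OF ne])
        fix q
        have "closest_point (C w) q + closest_point (D w) (g - closest_point (C w) q) \<in> C w + D w"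
          by (intro set_plus_intro closest_point_cone c d)
        from closest_point_le[OF closed_coneD(2)[OF s] this, of g]
        show "norm (g - ?p) \<le> a q w" by (simp add: a_def dist_norm algebra_simps)
      qed
      obtain x y where xy: "x \<in> C w" "y \<in> D w" "?p = x + y"
        using closest_point_cone(1)[OF s, of g] by (auto elim: set_plus_elim)
      show "(INF q\<in>Q. a q w) \<le> norm (g - ?p)"
      proof (rule field_le_epsilon)
        fix e :: real assume "0 < e"
        then have "ball x e \<noteq> {}" by auto
        then obtain q where q: "q \<in> Q" "q \<in> ball x e" using Q(2)[of "ball x e"] by blast
        have "(INF q\<in>Q. a q w) \<le> a q w"
          by (rule cINF_lower[OF bdd_belowI[of _ 0] q(1)]) (auto simp: a_def)
        also have "a q w \<le> norm ((g - closest_point (C w) q) - y)"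
          using closest_point_le[OF closed_coneD(2)[OF d] xy(2), of "g - closest_point (C w) q"]
          by (simp add: a_def dist_norm)
        also have "\<dots> = norm ((g - ?p) + (closest_point (C w) x - closest_point (C w) q))"
          using xy by (simp add: closest_point_self algebra_simps)
        also have "\<dots> \<le> norm (g - ?p) + norm (closest_point (C w) x - closest_point (C w) q)"
          by (rule norm_triangle_ineq)
        also have "norm (closest_point (C w) x - closest_point (C w) q) \<le> dist x q"
          using closest_point_lipschitz[OF closed_coneD(1-3)[OF c], of x q] by (simp add: dist_norm)
        finally show "(INF q\<in>Q. a q w) \<le> norm (g - ?p) + e" using q(2) by simp
      qed
    qed
    then show "sqrt ((norm g)\<^sup>2 - (INF q\<in>Q. a q w)\<^sup>2) = norm ?p"
      using closest_point_cone_norm(2)[OF s, of g] by simp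
  qed
  finally show "(\<lambda>w. norm (closest_point (C w + D w) g)) \<in> borel_measurable N" .
qed

text \<open>
  The constant coefficient is the limit of the values as \<open>u\<close> tends to \<open>0\<close>. Subtracting it and dividing
  by \<open>u\<close> lowers the degree.
\<close>

lemma measurable_polynomial_coeffs:
  fixes a :: "nat \<Rightarrow> 'w \<Rightarrow> real"
  assumes "\<And>u. 0 < u \<Longrightarrow> u < 1 \<Longrightarrow> (\<lambda>w. \<Sum>k\<le>n. a k w * u ^ k) \<in> borel_measurable N" and "k \<le> n"
  shows "a k \<in> borel_measurable N"
  using assms
proof (induction n arbitrary: a k)
  case 0
  then show ?case using "0.prems"(1)[of "1/2"] by simp
next
  case (Suc n)
  have a0: "a 0 \<in> borel_measurable N"
  proof (rule borel_measurable_LIMSEQ_real)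
    \<comment> \<open>The shift by two keeps the arguments below \<open>1\<close>.\<close>
    let ?u = "\<lambda>m. 1 / real (Suc (Suc m))"
    show "(\<lambda>w. \<Sum>k\<le>Suc n. a k w * ?u m ^ k) \<in> borel_measurable N" for m
      by (rule Suc.prems(1)) auto
    fix w
    have "?u \<longlonglongrightarrow> 0" by (intro LIMSEQ_Suc lim_1_over_n)
    then have "(\<lambda>m. \<Sum>k\<le>Suc n. a k w * ?u m ^ k) \<longlonglongrightarrow> (\<Sum>k\<le>Suc n. a k w * 0 ^ k)"
      by (intro tendsto_intros)
    also have "(\<Sum>k\<le>Suc n. a k w * 0 ^ k) = a 0 w"
      by (subst sum.atMost_Suc_shift) simp
    finally show "(\<lambda>m. \<Sum>k\<le>Suc n. a k w * ?u m ^ k) \<longlonglongrightarrow> a 0 w" .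
  qed
  have "a (Suc j) \<in> borel_measurable N" if "j \<le> n" for j
  proof (rule Suc.IH[of "\<lambda>j. a (Suc j)", OF _ that])
    fix u :: real assume u: "0 < u" "u < 1"
    have "(\<lambda>w. ((\<Sum>k\<le>Suc n. a k w * u ^ k) - a 0 w) / u) \<in> borel_measurable N"
      using Suc.prems(1)[OF u] a0 by (intro borel_measurable_divide borel_measurable_diff) auto
    also have "(\<lambda>w. ((\<Sum>k\<le>Suc n. a k w * u ^ k) - a 0 w) / u) = (\<lambda>w. \<Sum>k\<le>n. a (Suc k) w * u ^ k)"
      using u by (subst sum.atMost_Suc_shift) (auto simp: fun_eq_iff sum_divide_distrib mult.assoc)
    finally show "(\<lambda>w. \<Sum>k\<le>n. a (Suc k) w * u ^ k) \<in> borel_measurable N" .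
  qed
  with a0 Suc.prems(2) show ?case by (cases k) auto
qed

lemma measurable_intrinsic_volume:
  fixes C :: "'w \<Rightarrow> (real^'d) set"
  assumes C: "random_cone N C" and P: "\<And>w. w \<in> space N \<Longrightarrow> polyhedral_cone (C w)"
  shows "(\<lambda>w. intrinsic_volume k (C w)) \<in> borel_measurable N"
proof (cases "k \<le> CARD('d)")
  case True
  interpret G: prob_space "std_gauss :: (real^'d) measure" by (rule prob_space_gaussian_on)
  note [measurable] = random_cone_joint[OF C]
  have [measurable]: "(\<lambda>(w, g). closest_point (C w) g) \<in> borel_measurable (N \<Otimes>\<^sub>M std_gauss)"
    by (subst measurable_cong_sets[OF sets_pair_measure_cong[OF refl sets_gaussian_on] refl]) measurable
  show ?thesis
  proof (rule measurable_polynomial_coeffs[OF _ True])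
    fix u :: real assume u: "0 < u" "u < 1"
    have "(\<lambda>w. \<integral>g. gauss_weight u (closest_point (C w) g) \<partial>std_gauss) \<in> borel_measurable N"
      by (rule G.borel_measurable_lebesgue_integral) measurable
    then show "(\<lambda>w. \<Sum>k\<le>CARD('d). intrinsic_volume k (C w) * u ^ k) \<in> borel_measurable N"
      using steiner[OF P u(1)] by (simp cong: measurable_cong)
  qed
next
  case False
  then have "(\<lambda>w. intrinsic_volume k (C w)) \<in> borel_measurable N \<longleftrightarrow> (\<lambda>w. 0 :: real) \<in> borel_measurable N"
    by (intro measurable_cong) (simp add: intrinsic_volume_gt P)
  then show ?thesis by simp
qed

section \<open>Reflections\<close>

definition reflection :: "real^'d \<Rightarrow> real^'d \<Rightarrow> real^'d" where
  "reflection e v = v - (2 * (v \<bullet> e) / (e \<bullet> e)) *\<^sub>R e"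

lemma orthogonal_transformation_reflection: "orthogonal_transformation (reflection e)"
  unfolding orthogonal_transformation_def
proof (intro conjI allI)
  show "linear (reflection e)"
    by (intro linearI) (simp_all add: reflection_def inner_add_left algebra_simps add_divide_distrib)
  show "reflection e v \<bullet> reflection e w = v \<bullet> w" for v w
    by (cases "e = 0") (simp_all add: reflection_def inner_diff_left inner_diff_right inner_commute)
qed

lemma reflection_swap:
  assumes "norm x = norm y"
  shows "reflection (x - y) x = y"
proof (cases "x = y")
  case False
  have "x \<bullet> x = y \<bullet> y" using assms by (simp add: norm_eq)
  then have "2 * (x \<bullet> (x - y)) = (x - y) \<bullet> (x - y)"
    by (simp add: inner_diff_left inner_diff_right inner_commute)
  moreover have "(x - y) \<bullet> (x - y) \<noteq> 0" using False by simp
  ultimately show ?thesis by (simp add: reflection_def)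
qed (simp add: reflection_def)

lemma reflection_fix: "v \<bullet> e = 0 \<Longrightarrow> reflection e v = v"
  by (simp add: reflection_def)

section \<open>Haar measure\<close>

lemma space_orthogonal_group: "space orthogonal_group = {Q. orthogonal_matrix Q}"
  by (simp add: orthogonal_group_def space_restrict_space)

lemma normalized_haarD:
  assumes "normalized_haar H"
  shows "prob_space H" "sets H = sets orthogonal_group" "space H = {Q. orthogonal_matrix Q}"
    "\<And>U. orthogonal_matrix U \<Longrightarrow> distr H H (\<lambda>Q. U ** Q) = H"
  using assms sets_eq_imp_space_eq[of H orthogonal_group]
  by (auto simp: normalized_haar_def space_orthogonal_group)

lemma measurable_haar_borel:
  assumes "normalized_haar H"
  shows "(\<lambda>Q. Q) \<in> borel_measurable H"
proof -
  have "(\<lambda>Q. Q) \<in> borel_measurable orthogonal_group"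
    unfolding orthogonal_group_def by (rule measurable_restrict_space1) simp
  then show ?thesis
    using normalized_haarD(2)[OF assms] by (simp cong: measurable_cong_sets)
qed

lemma measurable_into_haar:
  assumes "normalized_haar H" "f \<in> borel_measurable N" "\<And>w. w \<in> space N \<Longrightarrow> orthogonal_matrix (f w)"
  shows "f \<in> measurable N H"
proof -
  have "f \<in> measurable N orthogonal_group"
    unfolding orthogonal_group_def using assms(2,3) by (intro measurable_restrict_space2) auto
  then show ?thesis
    using normalized_haarD(2)[OF assms(1)] by (simp cong: measurable_cong_sets)
qed

lemma measurable_haar_ops:
  assumes H: "normalized_haar H"
  shows "orthogonal_matrix U \<Longrightarrow> (\<lambda>Q. U ** Q) \<in> measurable H H"
    "orthogonal_matrix U \<Longrightarrow> (\<lambda>Q. Q ** U) \<in> measurable H H"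
    "transpose \<in> measurable H H"
    "(\<lambda>(P, Q). transpose P ** Q) \<in> measurable (H \<Otimes>\<^sub>M H) H"
proof -
  note [measurable] = measurable_haar_borel[OF H]
  note sp = normalized_haarD(3)[OF H]
  show "orthogonal_matrix U \<Longrightarrow> (\<lambda>Q. U ** Q) \<in> measurable H H"
    by (rule measurable_into_haar[OF H]) (measurable, simp add: sp orthogonal_matrix_mul)
  show "orthogonal_matrix U \<Longrightarrow> (\<lambda>Q. Q ** U) \<in> measurable H H"
    by (rule measurable_into_haar[OF H]) (measurable, simp add: sp orthogonal_matrix_mul)
  show "transpose \<in> measurable H H"
    by (rule measurable_into_haar[OF H]) (measurable, simp add: sp)
  have [measurable]: "fst \<in> borel_measurable (H \<Otimes>\<^sub>M H)" "snd \<in> borel_measurable (H \<Otimes>\<^sub>M H)"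
    using measurable_compose[OF measurable_fst measurable_haar_borel[OF H]]
      measurable_compose[OF measurable_snd measurable_haar_borel[OF H]] by auto
  show "(\<lambda>(P, Q). transpose P ** Q) \<in> measurable (H \<Otimes>\<^sub>M H) H"
    unfolding case_prod_beta'
    by (rule measurable_into_haar[OF H]) (measurable, auto simp: sp space_pair_measure orthogonal_matrix_mul)
qed

lemma haar_left_integral:
  assumes H: "normalized_haar H" and U: "orthogonal_matrix U" and f: "f \<in> borel_measurable H"
  shows "(\<integral>\<^sup>+Q. f (U ** Q) \<partial>H) = (\<integral>\<^sup>+Q. f Q \<partial>H)"
  using nn_integral_distr[OF measurable_haar_ops(1)[OF H U], of f] f
  by (simp add: normalized_haarD(4)[OF H U])

text \<open>
  For independent \<open>P\<close> and \<open>Q\<close>, the law of \<open>transpose P ** Q\<close> is that of \<open>Q\<close>, by left invariance for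
  fixed \<open>P\<close>, and that of \<open>transpose P\<close>, by left invariance for fixed \<open>Q\<close>.
\<close>

lemma haar_transpose_integral:
  assumes H: "normalized_haar (H :: (real^'d^'d) measure)" and [measurable]: "f \<in> borel_measurable H"
  shows "(\<integral>\<^sup>+Q. f (transpose Q) \<partial>H) = (\<integral>\<^sup>+Q. f Q \<partial>H)"
proof -
  interpret H: prob_space H by (rule normalized_haarD) fact
  interpret HH: pair_sigma_finite H H by unfold_locales
  note sp = normalized_haarD(3)[OF H]
  note [measurable] = measurable_haar_ops(3,4)[OF H]
  have ft: "(\<lambda>Q. f (transpose Q)) \<in> borel_measurable H" by measurable
  have m: "(\<lambda>(P, Q). f (transpose P ** Q)) \<in> borel_measurable (H \<Otimes>\<^sub>M H)"
    using measurable_compose[OF measurable_haar_ops(4)[OF H], of f borel] by (simp add: case_prod_beta')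
  have "(\<integral>\<^sup>+Q. f Q \<partial>H) = (\<integral>\<^sup>+P. (\<integral>\<^sup>+Q. f Q \<partial>H) \<partial>H)" by (simp add: H.emeasure_space_1)
  also have "\<dots> = (\<integral>\<^sup>+P. (\<integral>\<^sup>+Q. f (transpose P ** Q) \<partial>H) \<partial>H)"
    by (intro nn_integral_cong haar_left_integral[symmetric] H) (auto simp: sp)
  also have "\<dots> = (\<integral>\<^sup>+Q. (\<integral>\<^sup>+P. f (transpose P ** Q) \<partial>H) \<partial>H)"
    using HH.Fubini'[OF m] by simp
  also have "\<dots> = (\<integral>\<^sup>+Q. (\<integral>\<^sup>+P. f (transpose P) \<partial>H) \<partial>H)"
  proof (rule nn_integral_cong)
    fix Q :: "real^'d^'d" assume "Q \<in> space H"
    then have Q: "orthogonal_matrix (transpose Q)" by (simp add: sp)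
    show "(\<integral>\<^sup>+P. f (transpose P ** Q) \<partial>H) = (\<integral>\<^sup>+P. f (transpose P) \<partial>H)"
      using haar_left_integral[OF H Q ft] by (simp add: matrix_transpose_mul)
  qed
  also have "\<dots> = (\<integral>\<^sup>+P. f (transpose P) \<partial>H)" by (simp add: H.emeasure_space_1)
  finally show ?thesis by simp
qed

lemma haar_right_integral:
  assumes H: "normalized_haar (H :: (real^'d^'d) measure)" and U: "orthogonal_matrix U" and [measurable]: "f \<in> borel_measurable H"
  shows "(\<integral>\<^sup>+Q. f (Q ** U) \<partial>H) = (\<integral>\<^sup>+Q. f Q \<partial>H)"
proof -
  have U': "orthogonal_matrix (transpose U)" using U by simp
  note [measurable] = measurable_haar_ops(2)[OF H U] measurable_haar_ops(3)[OF H]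
  have "(\<integral>\<^sup>+Q. f (Q ** U) \<partial>H) = (\<integral>\<^sup>+Q. f (transpose Q ** U) \<partial>H)"
    by (rule haar_transpose_integral[OF H, symmetric]) measurable
  also have "\<dots> = (\<integral>\<^sup>+Q. f (transpose (transpose U ** Q)) \<partial>H)"
    by (simp add: matrix_transpose_mul)
  also have "\<dots> = (\<integral>\<^sup>+Q. f (transpose Q) \<partial>H)"
    by (rule haar_left_integral[OF H U']) measurable
  also have "\<dots> = (\<integral>\<^sup>+Q. f Q \<partial>H)" by (rule haar_transpose_integral[OF H]) measurable
  finally show ?thesis .
qed

section \<open>General position\<close>

lemma subspace_plus: "subspace L \<Longrightarrow> subspace M \<Longrightarrow> subspace (L + M)"
proof -
  assume *: "subspace L" "subspace M"
  have "L + M = {x + y |x y. x \<in> L \<and> y \<in> M}" by (auto simp: set_plus_def)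
  then show ?thesis using subspace_sums[OF *] by simp
qed

lemma dim_plus_le:
  fixes L M :: "'a::euclidean_space set"
  assumes "subspace L" "subspace M"
  shows "dim (L + M) \<le> dim L + dim M"
proof -
  have "L + M = {x + y |x y. x \<in> L \<and> y \<in> M}" by (auto simp: set_plus_def)
  then show ?thesis using dim_sums_Int[OF assms] by simp
qed

lemma random_cone_rotated_subspace:
  fixes M :: "(real^'d) set"
  assumes H: "normalized_haar H" and M: "subspace M"
  shows "random_cone H (\<lambda>Q. (*v) Q ` M)"
  using normalized_haarD(3)[OF H]
  by (intro random_cone_rotate random_cone_const closed_cone_subspace M measurable_haar_borel H) auto

lemma subspace_rotated: "subspace M \<Longrightarrow> subspace ((*v) (Q :: real^'d^'d) ` M)"
  by (intro linear_subspace_image) auto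

text \<open>
  Adding a basis vector \<open>f\<close> to \<open>B\<close> destroys general position only if \<open>Q f\<close> lies in \<open>L + Q (span B)\<close>,
  which is a proper subspace by the bound on the dimensions. By right invariance the probability of
  \<open>Q v \<in> L + Q (span B)\<close> is the same for all \<open>v\<close> outside \<open>span B\<close>. Its mean over a Gaussian vector \<open>v\<close>
  is \<open>0\<close>, because for fixed \<open>Q\<close> the event says that \<open>v\<close> is in a proper subspace.
\<close>

lemma haar_general_position_onb:
  fixes L :: "(real^'d) set"
  assumes H: "normalized_haar H" and L: "subspace L"
    and B: "finite B" "pairwise orthogonal B" "\<And>b. b \<in> B \<Longrightarrow> norm b = 1" "dim L + card B \<le> CARD('d)"
  shows "AE Q in H. L \<inter> (*v) Q ` span B = {0}"
  using B
proof (induction B rule: finite_induct)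
  case empty
  then show ?case using subspace_0[OF L] by auto
next
  case (insert f B)
  interpret H: prob_space H by (rule normalized_haarD) fact
  interpret G: prob_space "std_gauss :: (real^'d) measure" by (rule prob_space_gaussian_on)
  interpret HG: pair_sigma_finite H "std_gauss :: (real^'d) measure" by unfold_locales
  note [measurable] = measurable_haar_borel[OF H]
  note sp = normalized_haarD(3)[OF H]
  have ortho: "pairwise orthogonal B" "\<And>b. b \<in> B \<Longrightarrow> orthogonal f b"
    using insert.prems(1) insert.hyps(2) by (auto simp: pairwise_insert)
  have cB: "dim L + card B < CARD('d)" using insert by simp
  define W where "W Q = L + (*v) Q ` span B" for Q :: "real^'d^'d"
  have W: "subspace (W Q)" for Q
    unfolding W_def by (intro subspace_plus L subspace_rotated) auto
  have W_ne: "W Q \<noteq> UNIV" for Q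
  proof -
    have "dim (W Q) \<le> dim L + dim ((*v) Q ` span B)"
      unfolding W_def by (intro dim_plus_le L subspace_rotated) auto
    also have "dim ((*v) Q ` span B) \<le> dim (span B)" by (rule dim_image_le) auto
    also have "dim (span B) \<le> card B" by (simp add: dim_le_card' insert.hyps(1))
    finally have "dim (W Q) < CARD('d)" using cB by simp
    then show ?thesis by (metis dim_UNIV less_irrefl DIM_cart DIM_real mult.right_neutral)
  qed
  have rW: "random_cone H W"
    unfolding W_def
    by (intro random_cone_sum random_cone_rotated_subspace[OF H] random_cone_const closed_cone_subspace
        L subspace_plus subspace_rotated subspace_span)
  define Z where "Z = {p \<in> space (H \<Otimes>\<^sub>M std_gauss). fst p *v snd p \<in> W (fst p)}"
  have Z: "Z \<in> sets (H \<Otimes>\<^sub>M std_gauss)"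
  proof -
    have [measurable]: "fst \<in> borel_measurable (H \<Otimes>\<^sub>M (std_gauss :: (real^'d) measure))"
      using measurable_compose[OF measurable_fst measurable_haar_borel[OF H]] by auto
    have rW': "random_cone (H \<Otimes>\<^sub>M (std_gauss :: (real^'d) measure)) (\<lambda>p. W (fst p))"
      by (rule random_cone_reparam[OF rW]) measurable
    have [measurable]: "(\<lambda>p. closest_point (W (fst p)) (fst p *v snd p)) \<in> borel_measurable (H \<Otimes>\<^sub>M std_gauss)"
      by (rule random_cone_compose[OF rW']) measurable
    have "Z = {p \<in> space (H \<Otimes>\<^sub>M std_gauss). closest_point (W (fst p)) (fst p *v snd p) = fst p *v snd p}"
      unfolding Z_def using closest_point_refl[OF closed_subspace[OF W]] W subspace_0 by blast
    also have "\<dots> \<in> sets (H \<Otimes>\<^sub>M std_gauss)" by measurable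
    finally show ?thesis .
  qed
  define p where "p v = emeasure H {Q \<in> space H. Q *v v \<in> W Q}" for v
  have pZ: "p v = (\<integral>\<^sup>+Q. indicator Z (Q, v) \<partial>H)" for v
  proof -
    have "{Q \<in> space H. Q *v v \<in> W Q} = (\<lambda>Q. (Q, v)) -` Z"
      by (auto simp: Z_def space_pair_measure)
    also have "\<dots> \<in> sets H" using Z by (rule sets_Pair2)
    finally have "{Q \<in> space H. Q *v v \<in> W Q} \<in> sets H" .
    then have "p v = (\<integral>\<^sup>+Q. indicator {Q \<in> space H. Q *v v \<in> W Q} Q \<partial>H)"
      by (simp add: p_def)
    also have "\<dots> = (\<integral>\<^sup>+Q. indicator Z (Q, v) \<partial>H)"
      by (intro nn_integral_cong) (auto simp: Z_def space_pair_measure indicator_def)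
    finally show ?thesis .
  qed
  have const: "p v = p f" if v: "v \<notin> span B" for v
  proof -
    define v0 where "v0 = closest_point (span B) v"
    define v1 where "v1 = v - v0"
    have v0: "v0 \<in> span B" and v1: "v1 \<in> orthogonal_comp (span B)"
      unfolding v0_def v1_def by (auto intro: closest_point_subspace)
    have v1_ne: "v1 \<noteq> 0" using v v0 by (auto simp: v1_def)
    define w where "w = v1 /\<^sub>R norm v1"
    have w: "norm w = 1" "v1 = norm v1 *\<^sub>R w" using v1_ne by (auto simp: w_def)
    have orthw: "s \<bullet> w = 0" if "s \<in> span B" for s
      using v1 that by (auto simp: w_def orthogonal_comp_def orthogonal_def)
    have orthf: "s \<bullet> f = 0" if "s \<in> span B" for s
      using orthogonal_to_span[OF that, of f] ortho(2) by (auto simp: orthogonal_def inner_commute)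
    \<comment> \<open>The reflection fixes \<open>span B\<close> pointwise and moves \<open>f\<close> to the direction of the component of \<open>v\<close> orthogonal to \<open>span B\<close>.\<close>
    define S where "S = matrix (reflection (f - w))"
    have Sv: "S *v x = reflection (f - w) x" for x
      unfolding S_def
    by (rule matrix_works) (use orthogonal_transformation_linear[OF orthogonal_transformation_reflection, of "f - w"] in
      \<open>simp add: linear_def scalar_mult_eq_scaleR\<close>)
    have S: "orthogonal_matrix S"
      unfolding S_def using orthogonal_transformation_reflection orthogonal_transformation_matrix by blast
    have Sf: "S *v f = w" unfolding Sv using w insert.prems(2)[of f] by (intro reflection_swap) auto
    have SB: "(*v) S ` span B = span B"
      using orthw orthf by (force simp: Sv reflection_fix inner_diff_right image_def)
    have WS: "W (Q ** S) = W Q" for Q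
    proof -
      have "(*v) (Q ** S) ` span B = (*v) Q ` ((*v) S ` span B)"
        by (simp add: image_image matrix_vector_mul_assoc)
      then show ?thesis by (simp add: W_def SB)
    qed
    have mem: "Q *v v \<in> W Q \<longleftrightarrow> (Q ** S) *v f \<in> W (Q ** S)" for Q
    proof -
      have "0 + Q *v v0 \<in> W Q"
        unfolding W_def using v0 subspace_0[OF L] by (intro set_plus_intro) auto
      then have Qv0: "Q *v v0 \<in> W Q" by simp
      have "Q *v v = norm v1 *\<^sub>R (Q *v w) + Q *v v0"
        using w(2) by (metis v1_def diff_add_cancel matrix_vector_right_distrib matrix_vector_mult_scaleR)
      then have "Q *v v \<in> W Q \<longleftrightarrow> norm v1 *\<^sub>R (Q *v w) \<in> W Q"
        using subspace_add[OF W _ Qv0] subspace_diff[OF W _ Qv0] by (metis add_diff_cancel_right')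
      also have "\<dots> \<longleftrightarrow> Q *v w \<in> W Q"
        using v1_ne subspace_scale[OF W, of _ Q] 
        by (metis norm_eq_zero real_vector_affinity_eq scaleR_one scaleR_scaleR left_inverse)
      also have "\<dots> \<longleftrightarrow> (Q ** S) *v f \<in> W (Q ** S)"
        by (simp add: WS matrix_vector_mul_assoc[symmetric] Sf)
      finally show ?thesis .
    qed
    have "p v = (\<integral>\<^sup>+Q. indicator Z (Q ** S, f) \<partial>H)"
      unfolding pZ using mem S by (intro nn_integral_cong) (auto simp: Z_def space_pair_measure sp orthogonal_matrix_mul indicator_def)
    also have "\<dots> = (\<integral>\<^sup>+Q. indicator Z (Q, f) \<partial>H)"
      by (rule haar_right_integral[OF H S]) (use Z in measurable)
    finally show ?thesis by (simp add: pZ)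
  qed
  have "span B \<noteq> UNIV"
    using W_ne[of "mat 1"] subspace_0[OF L] by (auto simp: W_def) (metis UNIV_I add.left_neutral set_plus_intro)
  then have "AE v in std_gauss. p v = p f"
    using null_proper_subspace[of "span B"] const by (auto elim: eventually_mono)
  then have "(\<integral>\<^sup>+v. p v \<partial>std_gauss) = (\<integral>\<^sup>+v. p f \<partial>(std_gauss :: (real^'d) measure))"
    by (intro nn_integral_cong_AE) auto
  then have "p f = (\<integral>\<^sup>+v. p v \<partial>std_gauss)"
    using G.emeasure_space_1 by simp
  also have "\<dots> = (\<integral>\<^sup>+Q. \<integral>\<^sup>+v. indicator Z (Q, v) \<partial>std_gauss \<partial>H)"
    unfolding pZ using HG.Fubini'[of "\<lambda>Q v. indicator Z (Q, v)"] Z by (simp add: case_prod_eta)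
  also have "\<dots> = (\<integral>\<^sup>+Q. 0 \<partial>H)"
  proof (intro nn_integral_cong)
    fix Q assume Q: "Q \<in> space H"
    have "subspace ((*v) Q -` W Q)" by (intro linear_subspace_vimage W) auto
    moreover have "(*v) Q -` W Q \<noteq> UNIV"
    proof
      assume u: "(*v) Q -` W Q = UNIV"
      have "x \<in> W Q" for x
      proof -
        have "transpose Q *v x \<in> (*v) Q -` W Q" using u by simp
        then show ?thesis using Q by (simp add: sp orthogonal_matrix_transpose_mult del: transpose_matrix_vector)
      qed
      then show False using W_ne by auto
    qed
    ultimately have "AE v in std_gauss. v \<notin> (*v) Q -` W Q" by (rule null_proper_subspace)
    then have "(\<integral>\<^sup>+v. indicator Z (Q, v) \<partial>std_gauss) = (\<integral>\<^sup>+v. 0 \<partial>(std_gauss :: (real^'d) measure))"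
      by (intro nn_integral_cong_AE) (auto simp: Z_def elim!: eventually_mono)
    then show "(\<integral>\<^sup>+v. indicator Z (Q, v) \<partial>std_gauss) = 0" by simp
  qed
  finally have p0: "p f = 0" by simp
  have "(\<lambda>Q. (Q, f)) -` Z \<in> sets H" using Z by (rule sets_Pair2)
  also have "(\<lambda>Q. (Q, f)) -` Z = {Q \<in> space H. Q *v f \<in> W Q}" by (auto simp: Z_def space_pair_measure)
  finally have "{Q \<in> space H. Q *v f \<in> W Q} \<in> null_sets H" using p0 by (auto simp: p_def null_sets_def)
  then have "AE Q in H. Q \<notin> {Q \<in> space H. Q *v f \<in> W Q}" by (rule AE_not_in)
  then have ae1: "AE Q in H. Q *v f \<notin> W Q" using AE_space by eventually_elim auto
  have ae2: "AE Q in H. L \<inter> (*v) Q ` span B = {0}"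
    using insert.IH[OF ortho(1)] insert.prems(2) cB by auto
  from ae1 ae2 show ?case
  proof eventually_elim
    case (elim Q)
    have "x = 0" if x: "x \<in> L" "x \<in> (*v) Q ` span (insert f B)" for x
    proof -
      obtain z where z: "z \<in> span (insert f B)" "x = Q *v z" using x(2) by auto
      obtain c where c: "z - c *\<^sub>R f \<in> span B" using z(1) by (auto simp: span_insert)
      define s where "s = z - c *\<^sub>R f"
      have xs: "x = c *\<^sub>R (Q *v f) + Q *v s"
        by (simp add: z(2) s_def matrix_vector_mult_diff_distrib matrix_vector_mult_scaleR)
      have s: "s \<in> span B" using c by (simp add: s_def)
      have "c = 0"
      proof (rule ccontr)
        assume c0: "c \<noteq> 0"
        have "(1 / c) *\<^sub>R x + Q *v ((- 1 / c) *\<^sub>R s) \<in> W Q"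
          unfolding W_def using x(1) s
          by (intro set_plus_intro subspace_scale[OF L] imageI span_scale)
        also have "(1 / c) *\<^sub>R x + Q *v ((- 1 / c) *\<^sub>R s) = Q *v f"
          unfolding xs matrix_vector_mult_scaleR using c0 by (simp add: scaleR_add_right)
        finally show False using elim(1) by simp
      qed
      then have "x \<in> L \<inter> (*v) Q ` span B" using xs x(1) s by auto
      with elim(2) show ?thesis by auto
    qed
    moreover have "0 \<in> L \<inter> (*v) Q ` span (insert f B)"
      using subspace_0[OF L] span_zero by (force simp: image_def)
    ultimately show ?case by auto
  qed
qed

lemma haar_general_position:
  fixes L M :: "(real^'d) set"
  assumes H: "normalized_haar H" and L: "subspace L" and M: "subspace M" and d: "dim L + dim M \<le> CARD('d)"
  shows "AE Q in H. L \<inter> (*v) Q ` M = {0}"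
  using haar_general_position_onb[OF H L onb_of(4)[OF M] onb_of(1)[OF M] onb_of(2)[OF M]] d
  by (simp add: onb_of(3,5)[OF M])

section \<open>Uniqueness of invariant measures\<close>

text \<open>
  By transitivity all balls of radius \<open>r\<close> around points of \<open>S\<close> have the same measure, for \<open>\<nu>\<close> as
  well as for \<open>\<sigma>\<close>. By Fubini these two constants have the ratio of the total masses.
\<close>

lemma invariant_measure_unique:
  fixes \<nu> \<sigma> :: "'a::euclidean_space measure"
  assumes "finite_measure \<nu>" "prob_space \<sigma>"
    and sets [simp, measurable_cong]: "sets \<nu> = sets borel" "sets \<sigma> = sets borel"
    and AE: "AE x in \<nu>. x \<in> S" "AE x in \<sigma>. x \<in> S"
    and K: "\<And>f. f \<in> K \<Longrightarrow> orthogonal_transformation f" "\<And>f. f \<in> K \<Longrightarrow> f \<in> borel_measurable borel"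
      "\<And>f. f \<in> K \<Longrightarrow> distr \<nu> borel f = \<nu>" "\<And>f. f \<in> K \<Longrightarrow> distr \<sigma> borel f = \<sigma>"
      "\<And>x y. x \<in> S \<Longrightarrow> y \<in> S \<Longrightarrow> \<exists>f\<in>K. f x = y"
    and A: "closed A"
  shows "emeasure \<nu> A = emeasure \<nu> UNIV * emeasure \<sigma> A"
proof -
  interpret nu: finite_measure \<nu> by fact
  interpret sg: prob_space \<sigma> by fact
  interpret pair_sigma_finite \<nu> \<sigma> by unfold_locales
  have sp: "space \<nu> = UNIV" "space \<sigma> = UNIV" using sets[THEN sets_eq_imp_space_eq] by auto
  have "S \<noteq> {}"
  proof
    assume "S = {}"
    then have "AE x in \<sigma>. False" using AE(2) by simp
    then show False using sg.AE_False by simp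
  qed
  then obtain z where z: "z \<in> S" by auto
  define t where "t = emeasure \<nu> UNIV"
  have t: "t < top" unfolding t_def less_top[symmetric] using nu.emeasure_finite[of UNIV] by simp
  have vim: "f -` ball (f x) r = ball x r" if "f \<in> K" for f x r
    using K(1)[OF that] by (auto simp: orthogonal_transformation_isometry)
  have ball_const: "emeasure \<tau> (ball y r) = emeasure \<tau> (ball z r)"
    if y: "y \<in> S" and \<tau>: "sets \<tau> = sets borel" "\<And>f. f \<in> K \<Longrightarrow> distr \<tau> borel f = \<tau>" for \<tau> y r
  proof -
    obtain f where f: "f \<in> K" "f z = y" using K(5)[OF z y] by auto
    have sp\<tau>: "space \<tau> = UNIV" using sets_eq_imp_space_eq[OF \<tau>(1)] by simp
    have "f \<in> measurable \<tau> borel" using K(2)[OF f(1)] by (simp add: measurable_cong_sets[OF \<tau>(1) refl])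
    then have "emeasure (distr \<tau> borel f) (ball y r) = emeasure \<tau> (f -` ball (f z) r)"
      by (subst emeasure_distr) (auto simp: f sp\<tau>)
    then show ?thesis by (simp only: \<tau>(2)[OF f(1)] vim[OF f(1)])
  qed
  have ball_nu: "emeasure \<nu> (ball y r) = emeasure \<nu> (ball z r)" if "y \<in> S" for y r
    by (rule ball_const[OF that sets(1)]) (rule K(3))
  have ball_sg: "emeasure \<sigma> (ball y r) = emeasure \<sigma> (ball z r)" if "y \<in> S" for y r
    by (rule ball_const[OF that sets(2)]) (rule K(4))
  \<comment> \<open>Countably many balls of radius \<open>r\<close> cover \<open>S\<close>.\<close>
  have pos: "0 < emeasure \<sigma> (ball z r)" if r: "0 < r" for r
  proof (rule ccontr)
    assume "\<not> 0 < emeasure \<sigma> (ball z r)"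
    then have 0: "emeasure \<sigma> (ball y r) = 0" if "y \<in> S" for y using ball_sg[OF that] by (simp add: not_gr_zero)
    obtain F where F: "F \<subseteq> (\<lambda>y. ball y r) ` S" "countable F" "\<Union>F = \<Union>((\<lambda>y. ball y r) ` S)"
      using Lindelof[of "(\<lambda>y. ball y r) ` S"] by (metis (no_types, lifting) imageE open_ball)
    have "(\<Union>X\<in>F. X) \<in> null_sets \<sigma>"
      using F(1,2) 0 by (intro null_sets_UN') (auto simp: null_sets_def)
    moreover have "S \<subseteq> (\<Union>X\<in>F. X)" using F(3) r by (auto intro: centre_in_ball[THEN iffD2])
    ultimately have "AE x in \<sigma>. x \<notin> S"
      using AE_not_in by (metis (mono_tags, lifting) eventually_mono subsetD)
    with AE(2) have "AE x in \<sigma>. False" by eventually_elim auto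
    then show False using sg.AE_False by simp
  qed
  \<comment> \<open>Both sides integrate the indicator of \<open>dist x y < r\<close> with respect to the product of the two measures.\<close>
  have ball_eq: "emeasure \<nu> (ball z r) = t * emeasure \<sigma> (ball z r)" for r
  proof -
    have m: "(\<lambda>(x, y). indicator {p. dist (fst p) (snd p) < r} (x, y) :: ennreal) \<in> borel_measurable (\<nu> \<Otimes>\<^sub>M \<sigma>)"
      by measurable
    have i\<sigma>: "(\<integral>\<^sup>+y. indicator {p. dist (fst p) (snd p) < r} (x, y) \<partial>\<sigma>) = emeasure \<sigma> (ball x r)" for x
    proof -
      have "(\<integral>\<^sup>+y. indicator {p. dist (fst p) (snd p) < r} (x, y) \<partial>\<sigma>) = (\<integral>\<^sup>+y. indicator (ball x r) y \<partial>\<sigma>)"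
        by (intro nn_integral_cong) (auto simp: indicator_def)
      then show ?thesis by simp
    qed
    have i\<nu>: "(\<integral>\<^sup>+x. indicator {p. dist (fst p) (snd p) < r} (x, y) \<partial>\<nu>) = emeasure \<nu> (ball y r)" for y
    proof -
      have "(\<integral>\<^sup>+x. indicator {p. dist (fst p) (snd p) < r} (x, y) \<partial>\<nu>) = (\<integral>\<^sup>+x. indicator (ball y r) x \<partial>\<nu>)"
        by (intro nn_integral_cong) (auto simp: indicator_def dist_commute)
      then show ?thesis by simp
    qed
    have "emeasure \<nu> (ball z r) = (\<integral>\<^sup>+y. emeasure \<nu> (ball z r) \<partial>\<sigma>)" using sg.emeasure_space_1 by simp
    also have "\<dots> = (\<integral>\<^sup>+y. emeasure \<nu> (ball y r) \<partial>\<sigma>)"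
      using AE(2) by (intro nn_integral_cong_AE) (auto simp: ball_nu)
    also have "\<dots> = (\<integral>\<^sup>+x. emeasure \<sigma> (ball x r) \<partial>\<nu>)"
      using Fubini'[OF m] by (simp add: i\<sigma> i\<nu>)
    also have "\<dots> = (\<integral>\<^sup>+x. emeasure \<sigma> (ball z r) \<partial>\<nu>)"
      using AE(1) by (intro nn_integral_cong_AE) (auto simp: ball_sg)
    also have "\<dots> = t * emeasure \<sigma> (ball z r)" by (simp add: t_def sp mult.commute)
    finally show ?thesis .
  qed
  have fin: "emeasure \<sigma> B < top" "emeasure \<nu> B < top" for B
    unfolding less_top[symmetric] using nu.emeasure_finite[of B] sg.emeasure_finite[of B] by simp_all
  have sf: "sigma_finite_measure \<nu>" "sigma_finite_measure \<sigma>" by unfold_locales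
  have balls: "0 < emeasure \<sigma> (ball z r) \<and> emeasure \<sigma> (ball z r) < top \<and>
      (\<forall>y\<in>S. emeasure \<sigma> (ball y r) = 1 * emeasure \<sigma> (ball z r) \<and> emeasure \<nu> (ball y r) = t * emeasure \<sigma> (ball z r))"
    if "0 < r" for r
  proof (intro conjI ballI)
    show "0 < emeasure \<sigma> (ball z r)" by (rule pos[OF that])
    show "emeasure \<sigma> (ball z r) < top" by (rule fin)
    fix y assume y: "y \<in> S"
    show "emeasure \<sigma> (ball y r) = 1 * emeasure \<sigma> (ball z r)" unfolding mult_1 by (rule ball_sg[OF y])
    show "emeasure \<nu> (ball y r) = t * emeasure \<sigma> (ball z r)" unfolding ball_nu[OF y] by (rule ball_eq)
  qed
  have "1 * emeasure \<nu> A \<le> t * emeasure \<sigma> A"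
  proof (rule emeasure_closed_le_of_balls[OF sf sets AE _ A fin(1) t])
    fix r :: real assume r: "0 < r"
    show "\<exists>c. 0 < c \<and> c < top \<and> (\<forall>y\<in>S. emeasure \<sigma> (ball y r) = 1 * c \<and> emeasure \<nu> (ball y r) = t * c)"
      using balls[OF r] by blast
  qed
  moreover have "t * emeasure \<sigma> A \<le> 1 * emeasure \<nu> A"
  proof (rule emeasure_closed_le_of_balls[OF sf(2,1) sets(2,1) AE(2,1) _ A fin(2)])
    show "(1 :: ennreal) < top" by simp
    fix r :: real assume r: "0 < r"
    show "\<exists>c. 0 < c \<and> c < top \<and> (\<forall>y\<in>S. emeasure \<nu> (ball y r) = t * c \<and> emeasure \<sigma> (ball y r) = 1 * c)"
      using balls[OF r] by blast
  qed
  ultimately show ?thesis by (simp add: t_def)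
qed

section \<open>Directions in a subspace and its complement\<close>

text \<open>
  A point of the product of the unit spheres of \<open>L\<close> and of its complement, written as a sum. The
  convention \<open>sgn 0 = 0\<close> covers the trivial and the full subspace.
\<close>

definition unit_parts :: "(real^'d) set \<Rightarrow> real^'d \<Rightarrow> real^'d" where
  "unit_parts L w = sgn (closest_point L w) + sgn (closest_point (orthogonal_comp L) w)"

definition nondegenerate :: "(real^'d) set \<Rightarrow> real^'d \<Rightarrow> bool" where
  "nondegenerate L w \<longleftrightarrow> (L \<noteq> {0} \<longrightarrow> closest_point L w \<noteq> 0) \<and>
     (orthogonal_comp L \<noteq> {0} \<longrightarrow> closest_point (orthogonal_comp L) w \<noteq> 0)"

definition unit_pairs :: "(real^'d) set \<Rightarrow> (real^'d) set" where
  "unit_pairs L = {w. norm (closest_point L w) = (if L = {0} then 0 else 1) \<and>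
     norm (closest_point (orthogonal_comp L) w) = (if orthogonal_comp L = {0} then 0 else 1)}"

definition stabilizer :: "(real^'d) set \<Rightarrow> (real^'d \<Rightarrow> real^'d) set" where
  "stabilizer L = {f. orthogonal_transformation f \<and> f ` L = L}"

lemma closest_point_sum:
  fixes L :: "(real^'d) set"
  assumes "subspace L" "x \<in> L" "y \<in> orthogonal_comp L"
  shows "closest_point L (x + y) = x" "closest_point (orthogonal_comp L) (x + y) = y"
proof -
  show 1: "closest_point L (x + y) = x"
    using assms by (intro closest_point_subspace_unique) auto
  show "closest_point (orthogonal_comp L) (x + y) = y"
    using closest_point_orthogonal_comp[OF assms(1), of "x + y"] 1 by simp
qed

lemma sgn_in_subspace: "subspace L \<Longrightarrow> x \<in> L \<Longrightarrow> sgn (x :: real^'d) \<in> L"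
  by (simp add: sgn_div_norm subspace_scale)

lemma closest_point_unit_parts:
  fixes L :: "(real^'d) set"
  assumes L: "subspace L"
  shows "closest_point L (unit_parts L w) = sgn (closest_point L w)"
    "closest_point (orthogonal_comp L) (unit_parts L w) = sgn (closest_point (orthogonal_comp L) w)"
  unfolding unit_parts_def using L
  by (auto intro!: closest_point_sum sgn_in_subspace closest_point_subspace(1) subspace_orthogonal_comp)

lemma unit_parts_in_unit_pairs:
  fixes L :: "(real^'d) set"
  assumes L: "subspace L" and w: "nondegenerate L w"
  shows "unit_parts L w \<in> unit_pairs L"
proof -
  have "closest_point L w = 0" if "L = {0}"
    using closest_point_subspace(1)[OF L, of w] that by auto
  moreover have "closest_point (orthogonal_comp L) w = 0" if "orthogonal_comp L = {0}"
    using closest_point_subspace(1)[OF subspace_orthogonal_comp, of L w] that by auto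
  ultimately show ?thesis
    using w unfolding unit_pairs_def nondegenerate_def by (auto simp: closest_point_unit_parts[OF L] norm_sgn)
qed

lemma stabilizer_orthogonal_comp:
  fixes L :: "(real^'d) set"
  assumes "subspace L" "f \<in> stabilizer L" shows "f ` orthogonal_comp L = orthogonal_comp L"
  using assms orthogonal_comp_orthogonal_image[of f L] by (auto simp: stabilizer_def)

lemma unit_parts_stabilizer:
  fixes L :: "(real^'d) set"
  assumes L: "subspace L" and f: "f \<in> stabilizer L"
  shows "unit_parts L (f w) = f (unit_parts L w)"
proof -
  have o: "orthogonal_transformation f" and fL: "f ` L = L" using f by (auto simp: stabilizer_def)
  have sgnf: "sgn (f v) = f (sgn v)" for v
    using orthogonal_transformation_linear[OF o] orthogonal_transformation_norm[OF o]
    by (simp add: sgn_div_norm linear_scale)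
  have "closest_point L (f w) = f (closest_point L w)"
    using closest_point_orthogonal_image[OF o closed_cone_subspace[OF L], of w] by (simp add: fL)
  moreover have "closest_point (orthogonal_comp L) (f w) = f (closest_point (orthogonal_comp L) w)"
    using closest_point_orthogonal_image[OF o closed_cone_subspace[OF subspace_orthogonal_comp[of L]], of w]
    by (simp add: stabilizer_orthogonal_comp[OF L f])
  ultimately show ?thesis
    unfolding unit_parts_def using orthogonal_transformation_linear[OF o] by (simp add: sgnf linear_add)
qed

lemma reflection_stabilizer:
  fixes L :: "(real^'d) set"
  assumes L: "subspace L" and e: "e \<in> L \<or> e \<in> orthogonal_comp L"
  shows "reflection e \<in> stabilizer L"
proof -
  have inv: "reflection e (reflection e v) = v" for v
    by (cases "e = 0") (simp_all add: reflection_def inner_diff_left)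
  have sub: "reflection e v \<in> L" if "v \<in> L" for v
  proof (cases "e \<in> L")
    case True
    then show ?thesis unfolding reflection_def using that L by (intro subspace_diff subspace_scale) auto
  next
    case False
    then have "v \<bullet> e = 0" using e that by (auto simp: orthogonal_comp_def orthogonal_def)
    then show ?thesis using that by (simp add: reflection_fix)
  qed
  have "reflection e ` L = L"
    using sub inv by (metis image_eqI image_subsetI subset_antisym subsetI)
  then show ?thesis by (simp add: stabilizer_def orthogonal_transformation_reflection)
qed

text \<open>
  A reflection in a vector of \<open>L\<close> fixes the complement of \<open>L\<close> pointwise, and conversely, so the two
  components can be adjusted one after the other.
\<close>

lemma stabilizer_transitive:
  fixes L :: "(real^'d) set"
  assumes L: "subspace L" and x: "x \<in> unit_pairs L" and y: "y \<in> unit_pairs L"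
  shows "\<exists>f\<in>stabilizer L. f x = y"
proof -
  let ?L' = "orthogonal_comp L"
  let ?x1 = "closest_point L x" and ?y1 = "closest_point L y"
  let ?x2 = "closest_point ?L' x" and ?y2 = "closest_point ?L' y"
  have mem: "?x1 \<in> L" "?y1 \<in> L" "?x2 \<in> ?L'" "?y2 \<in> ?L'"
    using L by (auto intro: closest_point_subspace(1) subspace_orthogonal_comp)
  have n: "norm ?x1 = norm ?y1" "norm ?x2 = norm ?y2" using x y by (auto simp: unit_pairs_def)
  have dec: "x = ?x1 + ?x2" "y = ?y1 + ?y2" by (simp_all add: closest_point_orthogonal_comp[OF L])
  let ?f1 = "reflection (?x1 - ?y1)" and ?f2 = "reflection (?x2 - ?y2)"
  have e: "?x1 - ?y1 \<in> L" "?x2 - ?y2 \<in> ?L'"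
    using mem L by (auto intro: subspace_diff subspace_orthogonal_comp)
  have lin: "linear ?f1" "linear ?f2"
    by (auto intro: orthogonal_transformation_linear orthogonal_transformation_reflection)
  have "?f1 x = ?f1 ?x1 + ?f1 ?x2" using dec(1) linear_add[OF lin(1)] by metis
  also have "?f1 ?x2 = ?x2"
    using mem(3) e(1) by (intro reflection_fix) (auto simp: orthogonal_comp_def orthogonal_def inner_commute)
  finally have "?f2 (?f1 x) = ?f2 ?y1 + ?f2 ?x2" using linear_add[OF lin(2)] by (simp add: reflection_swap n)
  also have "?f2 ?y1 = ?y1"
    using mem(2) e(2) by (intro reflection_fix) (auto simp: orthogonal_comp_def orthogonal_def)
  finally have "(?f2 \<circ> ?f1) x = y" using dec(2) by (simp add: reflection_swap n)
  moreover have "?f2 \<circ> ?f1 \<in> stabilizer L"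
  proof -
    have "?f1 ` L = L" "?f2 ` L = L"
      using reflection_stabilizer[OF L, of "?x1 - ?y1"] reflection_stabilizer[OF L, of "?x2 - ?y2"] e
      by (auto simp only: stabilizer_def mem_Collect_eq)
    then have "(?f2 \<circ> ?f1) ` L = L" by (simp only: image_comp[symmetric])
    moreover have "orthogonal_transformation (?f2 \<circ> ?f1)"
      by (intro orthogonal_transformation_compose orthogonal_transformation_reflection)
    ultimately show ?thesis by (simp only: stabilizer_def mem_Collect_eq simp_thms)
  qed
  ultimately show ?thesis by blast
qed

lemma measurable_unit_parts: "subspace L \<Longrightarrow> unit_parts L \<in> borel_measurable borel"
  unfolding unit_parts_def sgn_div_norm
  using measurable_closest_point_subspace[of L] measurable_closest_point_subspace[OF subspace_orthogonal_comp[of L]]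
  by measurable

lemma AE_nondegenerate:
  fixes L :: "(real^'d) set"
  assumes L: "subspace L"
  shows "AE w in std_gauss. nondegenerate L w"
proof -
  have "AE w in std_gauss. M \<noteq> {0} \<longrightarrow> closest_point M w \<noteq> 0" if M: "subspace M" for M :: "(real^'d) set"
  proof (cases "M = {0}")
    case False
    then have "\<not> M \<subseteq> {0}" using subspace_0[OF M] by auto
    then show ?thesis using AE_closest_point_not_in[OF M, of "{0}"] by (auto elim: eventually_mono)
  qed simp
  from this[OF L] this[OF subspace_orthogonal_comp[of L]] show ?thesis
    unfolding nondegenerate_def by eventually_elim auto
qed

text \<open>
  The law of the directions of \<open>W\<close> and that of the directions of a Gaussian vector are both invariant
  under the stabilizer of \<open>L\<close>, which acts transitively on the pairs of directions.
\<close>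

lemma uniform_directions:
  fixes W :: "'w \<Rightarrow> real^'d"
  assumes N: "finite_measure N" and L: "subspace L" and W[measurable]: "W \<in> borel_measurable N"
    and nd: "AE w in N. nondegenerate L (W w)"
    and inv: "\<And>f. f \<in> stabilizer L \<Longrightarrow>
      distr N borel (\<lambda>w. f (unit_parts L (W w))) = distr N borel (\<lambda>w. unit_parts L (W w))"
    and A: "closed A" "\<And>w. nondegenerate L w \<Longrightarrow> unit_parts L w \<in> A \<longleftrightarrow> w \<in> A"
  shows "emeasure N {w \<in> space N. W w \<in> A} = emeasure N (space N) * emeasure std_gauss A"
proof -
  note [measurable] = measurable_unit_parts[OF L]
  have [measurable]: "A \<in> sets borel" using A(1) by simp
  have fm: "f \<in> borel_measurable borel" if "f \<in> stabilizer L" for f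
    using that by (intro orthogonal_borel_measurable) (auto simp: stabilizer_def)
  interpret G: prob_space "std_gauss :: (real^'d) measure" by (rule prob_space_gaussian_on)
  let ?\<nu> = "distr N borel (\<lambda>w. unit_parts L (W w))" and ?\<sigma> = "distr std_gauss borel (unit_parts L)"
  have "emeasure ?\<nu> A = emeasure ?\<nu> UNIV * emeasure ?\<sigma> A"
  proof (rule invariant_measure_unique[where S="unit_pairs L" and K="stabilizer L"])
    show "finite_measure ?\<nu>" by (rule finite_measure.finite_measure_distr[OF N]) measurable
    show "prob_space ?\<sigma>" by (rule G.prob_space_distr) measurable
    have cl: "{x \<in> space borel. x \<in> unit_pairs L} \<in> sets borel"
    proof -
      note [measurable] = measurable_closest_point_subspace[OF L] measurable_closest_point_subspace[OF subspace_orthogonal_comp[of L]]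
      show ?thesis unfolding unit_pairs_def mem_Collect_eq by measurable
    qed
    show "AE x in ?\<nu>. x \<in> unit_pairs L"
      using nd by (subst AE_distr_iff[OF _ cl]) (auto elim!: eventually_mono intro: unit_parts_in_unit_pairs[OF L])
    show "AE x in ?\<sigma>. x \<in> unit_pairs L"
      using AE_nondegenerate[OF L] by (subst AE_distr_iff[OF _ cl]) (auto elim!: eventually_mono intro: unit_parts_in_unit_pairs[OF L])
    fix f assume f: "f \<in> stabilizer L"
    show "orthogonal_transformation f" "f \<in> borel_measurable borel" using f fm by (auto simp: stabilizer_def)
    note [measurable] = fm[OF f]
    show "distr ?\<nu> borel f = ?\<nu>"
      using inv[OF f] by (subst distr_distr) (auto simp: comp_def)
    have "distr ?\<sigma> borel f = distr std_gauss borel (\<lambda>w. unit_parts L (f w))"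
      by (subst distr_distr) (auto simp: comp_def unit_parts_stabilizer[OF L f])
    also have "\<dots> = distr (distr std_gauss borel f) borel (unit_parts L)"
      by (subst distr_distr) (auto simp: comp_def)
    also have "distr std_gauss borel f = std_gauss"
      using f by (intro std_gauss_orthogonal) (auto simp: stabilizer_def)
    finally show "distr ?\<sigma> borel f = ?\<sigma>" .
  qed (use A(1) stabilizer_transitive[OF L] in auto)
  also have "emeasure ?\<nu> UNIV = emeasure N (space N)"
    by (subst emeasure_distr) auto
  also have "emeasure ?\<nu> A = emeasure N {w \<in> space N. unit_parts L (W w) \<in> A}"
    by (subst emeasure_distr) (auto intro!: arg_cong[where f="emeasure N"])
  also have "\<dots> = emeasure N {w \<in> space N. W w \<in> A}"
    using nd A(2) by (intro emeasure_eq_AE) (auto elim!: eventually_mono)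
  also have "emeasure ?\<sigma> A = emeasure std_gauss {w. unit_parts L w \<in> A}"
    by (subst emeasure_distr) (auto intro!: arg_cong[where f="emeasure std_gauss"])
  also have "\<dots> = emeasure std_gauss A"
  proof (rule emeasure_eq_AE)
    show "{w. unit_parts L w \<in> A} \<in> sets std_gauss"
      using measurable_sets[OF measurable_unit_parts[OF L], of A] by (simp add: vimage_def)
  qed (use AE_nondegenerate[OF L] A(2) in \<open>auto elim!: eventually_mono\<close>)
  finally show ?thesis .
qed

section \<open>Oblique decomposition\<close>

text \<open>
  Equivalently, \<open>L + N\<close> is the whole space. This is general position for subspaces whose dimensions
  add up to at least that of the space, and it makes the decomposition that follows unique.
\<close>

definition transversal :: "(real^'d) set \<Rightarrow> (real^'d) set \<Rightarrow> bool" where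
  "transversal L N \<longleftrightarrow> orthogonal_comp L \<inter> orthogonal_comp N = {0}"

definition splits :: "(real^'d) set \<Rightarrow> (real^'d) set \<Rightarrow> real^'d \<Rightarrow> real^'d \<Rightarrow> real^'d \<Rightarrow> real^'d \<Rightarrow> bool" where
  "splits L N g x a b \<longleftrightarrow> x \<in> L \<and> x \<in> N \<and> a \<in> orthogonal_comp L \<and> b \<in> orthogonal_comp N \<and> g = x + a + b"

lemma transversal_sym: "transversal L N \<longleftrightarrow> transversal N L"
  by (auto simp: transversal_def)

lemma splits_sym: "splits L N g x a b \<longleftrightarrow> splits N L g x b a"
  by (auto simp: splits_def algebra_simps)

lemma splits_image:
  fixes f :: "real^'d \<Rightarrow> real^'d"
  assumes f: "orthogonal_transformation f" and "subspace L" "subspace N" and s: "splits L N g x a b"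
  shows "splits (f ` L) (f ` N) (f g) (f x) (f a) (f b)"
  using s orthogonal_transformation_linear[OF f] unfolding splits_def
  by (auto simp: orthogonal_comp_orthogonal_image f assms linear_add)

lemma transversal_image:
  fixes f :: "real^'d \<Rightarrow> real^'d"
  assumes f: "orthogonal_transformation f" and "subspace L" "subspace N" and s: "transversal L N"
  shows "transversal (f ` L) (f ` N)"
proof -
  have "f ` orthogonal_comp L \<inter> f ` orthogonal_comp N = f ` (orthogonal_comp L \<inter> orthogonal_comp N)"
    using image_Int[OF orthogonal_transformation_inj[OF f]] by simp
  then show ?thesis
    using s orthogonal_transformation_linear[OF f] unfolding transversal_def
    by (simp add: orthogonal_comp_orthogonal_image f assms linear_0)
qed

lemma splits_exists:
  fixes L N :: "(real^'d) set"
  assumes L: "subspace L" and N: "subspace N"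
  shows "\<exists>x a b. splits L N g x a b"
proof -
  let ?V = "L \<inter> N"
  have V: "subspace ?V" using L N by (rule subspace_inter)
  have "orthogonal_comp ?V = orthogonal_comp L + orthogonal_comp N"
    using polar_Int[OF polyhedral_cone_subspace[OF L] polyhedral_cone_subspace[OF N]]
    by (simp add: polar_subspace L N V)
  then have "g - closest_point ?V g \<in> orthogonal_comp L + orthogonal_comp N"
    using closest_point_subspace(2)[OF V] by metis
  then obtain a b where "a \<in> orthogonal_comp L" "b \<in> orthogonal_comp N" "g - closest_point ?V g = a + b"
    by (auto elim: set_plus_elim)
  then show ?thesis
    using closest_point_subspace(1)[OF V, of g] by (intro exI[of _ "closest_point ?V g"] exI[of _ a] exI[of _ b])
      (auto simp: splits_def algebra_simps)
qed

lemma splits_closest_point: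
  fixes L N :: "(real^'d) set"
  assumes L: "subspace L" and N: "subspace N" and s: "splits L N g x a b"
  shows "closest_point (L \<inter> N) g = x"
proof (rule closest_point_subspace_unique)
  show "subspace (L \<inter> N)" using L N by (rule subspace_inter)
  show "x \<in> L \<inter> N" using s by (auto simp: splits_def)
  have "g - x = a + b" using s by (auto simp: splits_def)
  then show "g - x \<in> orthogonal_comp (L \<inter> N)"
    using s unfolding splits_def by (auto simp: orthogonal_comp_def orthogonal_def inner_add_right)
qed

definition proj_matrix :: "(real^'d) set \<Rightarrow> real^'d^'d" where
  "proj_matrix L = matrix (closest_point L)"

lemma proj_matrix: "subspace L \<Longrightarrow> proj_matrix L *v x = closest_point L x"
  unfolding proj_matrix_def
  by (rule matrix_works) (use linear_closest_point[of L] in \<open>simp add: linear_def scalar_mult_eq_scaleR\<close>)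

text \<open>
  If \<open>g = x + a + b\<close> is split along \<open>L\<close> and \<open>N = Q M\<close>, projecting first to \<open>N\<close> and then to the
  complement of \<open>L\<close> kills \<open>b\<close> and \<open>x\<close>. So \<open>a\<close> solves a linear equation whose right-hand side is the
  image of \<open>g\<close>. Adding the projection to \<open>L\<close> makes the matrix regular in the transversal case, and
  Cramer's rule then exhibits \<open>a\<close> as a measurable function of \<open>Q\<close> and \<open>g\<close>.
\<close>

definition oblique_matrix :: "(real^'d) set \<Rightarrow> (real^'d) set \<Rightarrow> real^'d^'d \<Rightarrow> real^'d^'d" where
  "oblique_matrix L M Q = proj_matrix (orthogonal_comp L) ** (Q ** (proj_matrix M ** transpose Q))
      ** proj_matrix (orthogonal_comp L) + proj_matrix L"

definition oblique_rhs :: "(real^'d) set \<Rightarrow> (real^'d) set \<Rightarrow> real^'d^'d \<Rightarrow> real^'d \<Rightarrow> real^'d" where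
  "oblique_rhs L M Q g = (proj_matrix (orthogonal_comp L) ** (Q ** (proj_matrix M ** transpose Q))) *v g"

definition oblique :: "(real^'d) set \<Rightarrow> (real^'d) set \<Rightarrow> real^'d^'d \<Rightarrow> real^'d \<Rightarrow> real^'d" where
  "oblique L M Q g = (\<chi> k. det (\<chi> i j. if j = k then oblique_rhs L M Q g $ i else oblique_matrix L M Q $ i $ j)
     / det (oblique_matrix L M Q))"

lemma measurable_oblique:
  fixes Q :: "'w \<Rightarrow> real^'d^'d"
  assumes [measurable]: "Q \<in> borel_measurable N" "g \<in> borel_measurable N"
  shows "(\<lambda>w. oblique L M (Q w) (g w)) \<in> borel_measurable N"
proof -
  have [measurable]: "(\<lambda>w. oblique_matrix L M (Q w)) \<in> borel_measurable N"
    unfolding oblique_matrix_def by measurable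
  have [measurable]: "(\<lambda>w. oblique_rhs L M (Q w) (g w)) \<in> borel_measurable N"
    unfolding oblique_rhs_def by measurable
  have [measurable]: "(\<lambda>w. if j = k then oblique_rhs L M (Q w) (g w) $ i else oblique_matrix L M (Q w) $ i $ j) \<in> borel_measurable N"
    for i j k by (cases "j = k") simp_all
  show ?thesis unfolding oblique_def by measurable
qed

lemma oblique_eq:
  fixes L M :: "(real^'d) set"
  assumes L: "subspace L" and M: "subspace M" and Q: "orthogonal_matrix Q"
    and t: "transversal L ((*v) Q ` M)" and s: "splits L ((*v) Q ` M) g x a b"
  shows "oblique L M Q g = a"
proof -
  let ?N = "(*v) Q ` M" and ?L' = "orthogonal_comp L"
  have N: "subspace ?N" by (rule subspace_rotated[OF M])
  have L': "subspace ?L'" by (rule subspace_orthogonal_comp)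
  have PN: "(Q ** (proj_matrix M ** transpose Q)) *v y = closest_point ?N y" for y
  proof -
    have "(Q ** (proj_matrix M ** transpose Q)) *v y = Q *v closest_point M (transpose Q *v y)"
      by (simp add: proj_matrix[OF M] matrix_vector_mul_assoc[symmetric] del: transpose_matrix_vector)
    also have "\<dots> = closest_point ?N (Q *v (transpose Q *v y))"
      using Q by (intro closest_point_orthogonal_image[symmetric] closed_cone_subspace M)
        (simp add: orthogonal_matrix_transformation)
    finally show ?thesis by (simp add: orthogonal_matrix_transpose_mult[OF Q] del: transpose_matrix_vector)
  qed
  have R: "oblique_matrix L M Q *v y = closest_point ?L' (closest_point ?N (closest_point ?L' y)) + closest_point L y" for y
    unfolding oblique_matrix_def
    by (simp add: matrix_vector_mult_add_rdistrib matrix_vector_mul_assoc[symmetric] proj_matrix L L' PN[unfolded matrix_vector_mul_assoc[symmetric]]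
       del: transpose_matrix_vector)
  have rhs: "oblique_rhs L M Q g = closest_point ?L' (closest_point ?N g)"
    unfolding oblique_rhs_def
    by (simp add: matrix_vector_mul_assoc[symmetric] proj_matrix L' PN[unfolded matrix_vector_mul_assoc[symmetric]] del: transpose_matrix_vector)
  have sx: "x \<in> L" "x \<in> ?N" "a \<in> ?L'" "b \<in> orthogonal_comp ?N" "g = x + a + b"
    using s by (auto simp: splits_def)
  have Pa: "closest_point ?L' a = a" "closest_point L a = 0"
    using closest_point_sum[OF L subspace_0[OF L] sx(3)] by auto
  have "oblique_matrix L M Q *v a = oblique_rhs L M Q g"
  proof -
    note lN = linear_closest_point[OF N] and lL' = linear_closest_point[OF L']
    have "closest_point ?N g = closest_point ?N x + closest_point ?N a + closest_point ?N b"
      using sx(5) by (simp add: linear_add[OF lN])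
    moreover have "closest_point ?N x = x" using sx(2) by (rule closest_point_self)
    moreover have "closest_point ?N b = 0"
      using closest_point_sum(1)[OF N subspace_0[OF N] sx(4)] by simp
    ultimately have "closest_point ?L' (closest_point ?N g) = closest_point ?L' x + closest_point ?L' (closest_point ?N a)"
      by (simp add: linear_add[OF lL'])
    moreover have "closest_point ?L' x = 0"
      using closest_point_sum(2)[OF L sx(1) subspace_0[OF L']] by simp
    ultimately show ?thesis unfolding R rhs Pa by simp
  qed
  moreover have "det (oblique_matrix L M Q) \<noteq> 0"
  proof -
    have "v = 0" if v: "oblique_matrix L M Q *v v = 0" for v
    proof -
      let ?z = "closest_point ?L' (closest_point ?N (closest_point ?L' v))"
      have eq: "closest_point L v + ?z = 0" using v unfolding R by (simp add: add.commute)
      have "closest_point L (closest_point L v + ?z) = closest_point L v" "closest_point ?L' (closest_point L v + ?z) = ?z"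
        by (intro closest_point_sum L closest_point_subspace(1) L')+
      then have z: "closest_point L v = 0" "?z = 0"
        unfolding eq by (simp_all add: closest_point_self subspace_0 L L')
      then have vL': "closest_point ?L' v = v" by (simp add: closest_point_orthogonal_comp[OF L])
      have "v \<in> ?L'" using closest_point_subspace(1)[OF L', of v] vL' by simp
      let ?n = "closest_point ?N v"
      have "?n - closest_point ?L' ?n \<in> orthogonal_comp ?L'" by (rule closest_point_subspace(2)[OF L'])
      then have "v \<bullet> ?n = 0" using z(2) vL' \<open>v \<in> ?L'\<close> by (auto simp: orthogonal_comp_def orthogonal_def)
      moreover have "?n \<bullet> (v - ?n) = 0"
        using closest_point_subspace[OF N, of v] by (auto simp: orthogonal_comp_def orthogonal_def)
      ultimately have "?n = 0" by (simp add: inner_diff_right inner_commute)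
      then have "v \<in> orthogonal_comp ?N" using closest_point_subspace(2)[OF N, of v] by simp
      with \<open>v \<in> ?L'\<close> t show ?thesis by (auto simp: transversal_def)
    qed
    then show ?thesis
      using det_nz_iff_inj[of "(*v) (oblique_matrix L M Q)"]
      by (simp add: linear_injective_0)
  qed
  ultimately have "a = (\<chi> k. det (\<chi> i j. if j = k then oblique_rhs L M Q g $ i else oblique_matrix L M Q $ i $ j)
     / det (oblique_matrix L M Q))"
    using cramer[of "oblique_matrix L M Q" a "oblique_rhs L M Q g"] by simp
  then show ?thesis unfolding oblique_def by simp
qed

text \<open>
  The part \<open>x + a\<close> of \<open>g = x + a + b\<close>, obtained by removing \<open>b\<close>. After pulling everything back by
  \<open>Q\<close>, the roles of \<open>L\<close> and \<open>M\<close> are exchanged and \<open>b\<close> takes the place of \<open>a\<close>.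
\<close>

definition side :: "(real^'d) set \<Rightarrow> (real^'d) set \<Rightarrow> real^'d^'d \<Rightarrow> real^'d \<Rightarrow> real^'d" where
  "side L M Q g = g - Q *v oblique M L (transpose Q) (transpose Q *v g)"

lemma measurable_side:
  fixes Q :: "'w \<Rightarrow> real^'d^'d"
  assumes [measurable]: "Q \<in> borel_measurable N" "g \<in> borel_measurable N"
  shows "(\<lambda>w. side L M (Q w) (g w)) \<in> borel_measurable N"
proof -
  have [measurable]: "(\<lambda>w. oblique M L (transpose (Q w)) (transpose (Q w) *v g w)) \<in> borel_measurable N"
    by (intro measurable_oblique) measurable
  show ?thesis unfolding side_def by measurable
qed

lemma transpose_image_cancel:
  assumes "orthogonal_matrix (Q :: real^'d^'d)"
  shows "(*v) (transpose Q) ` (*v) Q ` M = M" "(*v) Q ` (*v) (transpose Q) ` M = M"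
  by (simp_all add: image_image orthogonal_matrix_transpose_mult[OF assms] del: transpose_matrix_vector)

lemma side_eq:
  fixes L M :: "(real^'d) set"
  assumes L: "subspace L" and M: "subspace M" and Q: "orthogonal_matrix Q"
    and t: "transversal L ((*v) Q ` M)" and s: "splits L ((*v) Q ` M) g x a b"
  shows "side L M Q g = x + a" "side M L (transpose Q) (transpose Q *v g) = transpose Q *v (x + b)"
proof -
  have Q': "orthogonal_matrix (transpose Q)" using Q by simp
  have o': "orthogonal_transformation ((*v) (transpose Q))"
    using Q' by (simp only: orthogonal_matrix_transformation)
  have N: "subspace ((*v) Q ` M)" by (rule subspace_rotated[OF M])
  have t': "transversal M ((*v) (transpose Q) ` L)"
    using transversal_image[OF o' L N t] unfolding transpose_image_cancel[OF Q] by (rule transversal_sym[THEN iffD1])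
  have s': "splits M ((*v) (transpose Q) ` L) (transpose Q *v g) (transpose Q *v x) (transpose Q *v b) (transpose Q *v a)"
    using splits_image[OF o' L N s] unfolding transpose_image_cancel[OF Q] by (rule splits_sym[THEN iffD1])
  have g: "g = x + a + b" using s by (simp add: splits_def)
  have "oblique M L (transpose Q) (transpose Q *v g) = transpose Q *v b"
    by (rule oblique_eq[OF M L Q' t' s'])
  then show "side L M Q g = x + a"
    unfolding side_def by (simp add: orthogonal_matrix_transpose_mult[OF Q] g del: transpose_matrix_vector)
  have "oblique L M Q g = a" by (rule oblique_eq[OF L M Q t s])
  then show "side M L (transpose Q) (transpose Q *v g) = transpose Q *v (x + b)"
    unfolding side_def
    by (simp add: orthogonal_matrix_transpose_mult[OF Q] g matrix_vector_right_distrib del: transpose_matrix_vector)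
qed

lemma side_parts:
  fixes L M :: "(real^'d) set"
  assumes L: "subspace L" and M: "subspace M" and Q: "orthogonal_matrix Q"
    and t: "transversal L ((*v) Q ` M)" and s: "splits L ((*v) Q ` M) g x a b"
  shows "closest_point L (side L M Q g) = x" "closest_point (orthogonal_comp L) (side L M Q g) = a"
    "closest_point M (side M L (transpose Q) (transpose Q *v g)) = transpose Q *v x"
    "closest_point (orthogonal_comp M) (side M L (transpose Q) (transpose Q *v g)) = transpose Q *v b"
proof -
  have sx: "x \<in> L" "x \<in> (*v) Q ` M" "a \<in> orthogonal_comp L" "b \<in> orthogonal_comp ((*v) Q ` M)"
    using s by (auto simp: splits_def)
  show "closest_point L (side L M Q g) = x" "closest_point (orthogonal_comp L) (side L M Q g) = a"
    unfolding side_eq[OF assms] using closest_point_sum[OF L sx(1,3)] by auto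
  have "transpose Q *v x \<in> M"
    using sx(2) by (auto simp: orthogonal_matrix_transpose_mult[OF Q] simp del: transpose_matrix_vector)
  moreover have "transpose Q *v b \<in> orthogonal_comp M"
  proof -
    have "orthogonal_transformation ((*v) Q)" using Q by (simp only: orthogonal_matrix_transformation)
    then have "b \<in> (*v) Q ` orthogonal_comp M"
      using sx(4) orthogonal_comp_orthogonal_image M by metis
    then show ?thesis
      by (auto simp: orthogonal_matrix_transpose_mult[OF Q] simp del: transpose_matrix_vector)
  qed
  ultimately show "closest_point M (side M L (transpose Q) (transpose Q *v g)) = transpose Q *v x"
    "closest_point (orthogonal_comp M) (side M L (transpose Q) (transpose Q *v g)) = transpose Q *v b"
    unfolding side_eq[OF assms] matrix_vector_right_distrib using closest_point_sum[OF M] by auto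
qed

section \<open>A pair of faces under a random rotation\<close>

locale haar =
  fixes H :: "(real^'d^'d) measure"
  assumes H: "normalized_haar H"
begin

sublocale prob_space H by (rule normalized_haarD[OF H])

sublocale G: prob_space "std_gauss :: (real^'d) measure" by (rule prob_space_gaussian_on)

sublocale HG: pair_prob_space H "std_gauss :: (real^'d) measure" ..

abbreviation P :: "((real^'d^'d) \<times> (real^'d)) measure" where "P \<equiv> H \<Otimes>\<^sub>M std_gauss"

lemma space_H: "Q \<in> space H \<longleftrightarrow> orthogonal_matrix Q"
  using normalized_haarD(3)[OF H] by simp

lemma orth_fst: "p \<in> space P \<Longrightarrow> orthogonal_matrix (fst p)"
  by (auto simp: space_pair_measure space_H)

lemma measurable_P [measurable]: "fst \<in> borel_measurable P" "snd \<in> borel_measurable P"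
  using measurable_compose[OF measurable_fst measurable_haar_borel[OF H]] by simp_all

lemma measurable_pair_P:
  assumes "Q \<in> borel_measurable N" "g \<in> borel_measurable N" "\<And>w. w \<in> space N \<Longrightarrow> orthogonal_matrix (Q w)"
  shows "(\<lambda>w. (Q w, g w)) \<in> measurable N P"
  using assms by (intro measurable_Pair measurable_into_haar[OF H]) (auto cong: measurable_cong_sets)

lemma P_integral: "f \<in> borel_measurable P \<Longrightarrow> (\<integral>\<^sup>+p. f p \<partial>P) = (\<integral>\<^sup>+Q. \<integral>\<^sup>+g. f (Q, g) \<partial>std_gauss \<partial>H)"
  by (rule G.nn_integral_fst[symmetric])

lemma gauss_rotate:
  assumes U: "orthogonal_matrix U" and f: "f \<in> borel_measurable borel"
  shows "(\<integral>\<^sup>+g. f (U *v g) \<partial>std_gauss) = (\<integral>\<^sup>+g. f g \<partial>(std_gauss :: (real^'d) measure))"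
proof -
  have o: "orthogonal_transformation ((*v) U)" using U by (simp only: orthogonal_matrix_transformation)
  have [measurable]: "(*v) U \<in> borel_measurable borel" by (rule orthogonal_borel_measurable[OF o])
  have "(\<integral>\<^sup>+g. f (U *v g) \<partial>std_gauss) = (\<integral>\<^sup>+g. f g \<partial>distr std_gauss borel ((*v) U))"
    using f by (subst nn_integral_distr) auto
  then show ?thesis by (simp add: std_gauss_orthogonal[OF o])
qed

lemma measurable_section:
  "f \<in> borel_measurable P \<Longrightarrow> Q \<in> space H \<Longrightarrow> (\<lambda>g. f (Q, g)) \<in> borel_measurable borel"
  using measurable_compose[OF measurable_Pair1', of Q H f std_gauss borel]
  by (simp cong: measurable_cong_sets)

lemma P_rotate:
  assumes U: "orthogonal_matrix U" and f[measurable]: "f \<in> borel_measurable P"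
  shows "(\<integral>\<^sup>+p. f (U ** fst p, U *v snd p) \<partial>P) = (\<integral>\<^sup>+p. f p \<partial>P)"
proof -
  have "(\<lambda>p. (U ** fst p, U *v snd p)) \<in> measurable P P"
    using U by (intro measurable_pair_P) (auto intro: orthogonal_matrix_mul dest: orth_fst)
  from measurable_compose[OF this f] have "(\<integral>\<^sup>+p. f (U ** fst p, U *v snd p) \<partial>P)
    = (\<integral>\<^sup>+Q. \<integral>\<^sup>+g. f (U ** Q, U *v g) \<partial>std_gauss \<partial>H)"
    by (subst P_integral) auto
  also have "\<dots> = (\<integral>\<^sup>+Q. \<integral>\<^sup>+g. f (U ** Q, g) \<partial>std_gauss \<partial>H)"
    using U by (intro nn_integral_cong gauss_rotate measurable_section f) (auto simp: space_H orthogonal_matrix_mul)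
  also have "\<dots> = (\<integral>\<^sup>+Q. \<integral>\<^sup>+g. f (Q, g) \<partial>std_gauss \<partial>H)"
    by (rule haar_left_integral[OF H U]) measurable
  also have "\<dots> = (\<integral>\<^sup>+p. f p \<partial>P)" by (rule P_integral[symmetric]) measurable
  finally show ?thesis .
qed

text \<open>
  This symmetry exchanges the two subspaces of a pair: \<open>(L, Q M, g)\<close> is carried to \<open>(Q\<^sup>T L, M, Q\<^sup>T g)\<close>.
  It transfers statements about \<open>L\<close> to statements about \<open>M\<close>.
\<close>

lemma P_flip:
  assumes f[measurable]: "f \<in> borel_measurable P"
  shows "(\<integral>\<^sup>+p. f (transpose (fst p), transpose (fst p) *v snd p) \<partial>P) = (\<integral>\<^sup>+p. f p \<partial>P)"
proof -
  have "(\<lambda>p. (transpose (fst p), transpose (fst p) *v snd p)) \<in> measurable P P"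
    by (intro measurable_pair_P) (auto dest: orth_fst simp del: transpose_matrix_vector)
  from measurable_compose[OF this f] have "(\<integral>\<^sup>+p. f (transpose (fst p), transpose (fst p) *v snd p) \<partial>P)
    = (\<integral>\<^sup>+Q. \<integral>\<^sup>+g. f (transpose Q, transpose Q *v g) \<partial>std_gauss \<partial>H)"
    by (subst P_integral) auto
  also have "\<dots> = (\<integral>\<^sup>+Q. \<integral>\<^sup>+g. f (transpose Q, g) \<partial>std_gauss \<partial>H)"
    by (intro nn_integral_cong gauss_rotate measurable_section f) (auto simp: space_H)
  also have "\<dots> = (\<integral>\<^sup>+Q. \<integral>\<^sup>+g. f (Q, g) \<partial>std_gauss \<partial>H)"
    by (rule haar_transpose_integral[OF H]) measurable
  also have "\<dots> = (\<integral>\<^sup>+p. f p \<partial>P)" by (rule P_integral[symmetric]) measurable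
  finally show ?thesis .
qed

lemma AE_fst: "AE Q in H. R Q \<Longrightarrow> AE p in P. R (fst p)"
proof -
  assume "AE Q in H. R Q"
  then obtain N where N: "{Q \<in> space H. \<not> R Q} \<subseteq> N" "emeasure H N = 0" "N \<in> sets H" by (rule AE_E)
  show ?thesis
  proof (rule AE_I)
    show "{p \<in> space P. \<not> R (fst p)} \<subseteq> N \<times> UNIV" using N(1) by (auto simp: space_pair_measure)
    show "N \<times> UNIV \<in> sets P" using N(3) by (intro pair_measureI) auto
    show "emeasure P (N \<times> UNIV) = 0"
      using N(2,3) by (subst G.emeasure_pair_measure_Times) auto
  qed
qed

lemma AE_jointI:
  assumes "{p \<in> space P. R p} \<in> sets P" "AE Q in H. AE g in std_gauss. R (Q, g)"
  shows "AE p in P. R p"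
  using assms by (rule HG.AE_pair_measure)

end

locale haar_pair = haar H for H :: "(real^'d^'d) measure" +
  fixes L M :: "(real^'d) set"
  assumes L: "subspace L" and M: "subspace M" and dims: "CARD('d) < dim L + dim M"
begin

text \<open>
  With \<open>g = x + a + b\<close> as above, these are \<open>x + a\<close> and the pullback of \<open>x + b\<close>. Their projections to \<open>L\<close>
  and \<open>M\<close> and to the complements recover \<open>x\<close>, \<open>a\<close> and the pullbacks of \<open>x\<close>, \<open>b\<close>.
\<close>

definition "part_L p = side L M (fst p) (snd p)"
definition "part_M p = side M L (transpose (fst p)) (transpose (fst p) *v snd p)"

lemma measurable_parts [measurable]: "part_L \<in> borel_measurable P" "part_M \<in> borel_measurable P"
  unfolding part_L_def part_M_def by (intro measurable_side; measurable)+

lemma AE_transversal_H: "AE Q in H. transversal L ((*v) Q ` M)"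
proof -
  have "dim (orthogonal_comp L) + dim (orthogonal_comp M) \<le> CARD('d)"
    using dims dim_orthogonal_comp[OF L] dim_orthogonal_comp[OF M] by simp
  then have "AE Q in H. orthogonal_comp L \<inter> (*v) Q ` orthogonal_comp M = {0}"
    by (intro haar_general_position H subspace_orthogonal_comp)
  then show ?thesis
    using AE_space
  proof eventually_elim
    case (elim Q)
    have "orthogonal_transformation ((*v) Q)"
      using elim(2) by (simp only: space_H orthogonal_matrix_transformation)
    then show ?case
      using elim(1) by (simp add: transversal_def orthogonal_comp_orthogonal_image M)
  qed
qed

lemma AE_transversal: "AE p in P. transversal L ((*v) (fst p) ` M)"
  by (rule AE_fst) (rule AE_transversal_H)

lemma L_nonzero: "L \<noteq> {0}"
proof
  assume "L = {0}"
  then have "dim L = 0" by simp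
  then show False using dims dim_orthogonal_comp(2)[OF M] by linarith
qed

text \<open>
  For fixed \<open>Q\<close>, each of \<open>x = 0\<close> and \<open>a = 0\<close> confines \<open>g\<close> to a proper subspace. For \<open>x = 0\<close> this is
  where \<open>dim L + dim M\<close> has to exceed the dimension of the space.
\<close>

lemma AE_nondegenerate_part_L: "AE p in P. nondegenerate L (part_L p)"
proof -
  let ?L' = "orthogonal_comp L"
  note [measurable] = measurable_closest_point_subspace[OF L] measurable_closest_point_subspace[OF subspace_orthogonal_comp[of L]]
  have 1: "AE p in P. closest_point L (part_L p) \<noteq> 0"
  proof (rule AE_jointI)
    show "{p \<in> space P. closest_point L (part_L p) \<noteq> 0} \<in> sets P" by measurable
    show "AE Q in H. AE g in std_gauss. closest_point L (part_L (Q, g)) \<noteq> 0"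
      using AE_transversal_H AE_space
    proof eventually_elim
      case (elim Q)
      let ?N = "(*v) Q ` M"
      have Q: "orthogonal_matrix Q" using elim(2) by (simp add: space_H)
      have N: "subspace ?N" by (rule subspace_rotated[OF M])
      have "dim ?N \<ge> dim M"
      proof -
        have "(*v) (transpose Q) ` ?N = M" by (rule transpose_image_cancel[OF Q])
        then show ?thesis using dim_image_le[of "(*v) (transpose Q)" ?N] by (metis matrix_vector_mul_linear)
      qed
      then have "dim (?L' + orthogonal_comp ?N) < CARD('d)"
        using dim_plus_le[of ?L' "orthogonal_comp ?N"] dims dim_orthogonal_comp[OF L] dim_orthogonal_comp[OF N]
        by (simp add: subspace_orthogonal_comp)
      then have "?L' + orthogonal_comp ?N \<noteq> UNIV"
        by (metis dim_UNIV less_irrefl DIM_cart DIM_real mult.right_neutral)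
      then have "AE g in std_gauss. g \<notin> ?L' + orthogonal_comp ?N"
        by (intro null_proper_subspace subspace_plus subspace_orthogonal_comp)
      then show ?case
      proof eventually_elim
        case (elim g)
        obtain x a b where s: "splits L ?N g x a b" using splits_exists[OF L N] by blast
        have "x \<noteq> 0"
        proof
          assume "x = 0"
          then have "g \<in> ?L' + orthogonal_comp ?N" using s by (auto simp: splits_def intro!: set_plus_intro)
          with elim show False by simp
        qed
        then show ?case
          using side_parts(1)[OF L M Q \<open>transversal L ?N\<close> s] by (simp add: part_L_def)
      qed
    qed
  qed
  have 2: "AE p in P. closest_point ?L' (part_L p) \<noteq> 0" if ne: "?L' \<noteq> {0}"
  proof (rule AE_jointI)
    obtain c where c: "c \<in> ?L'" "c \<noteq> 0" using ne subspace_0[OF subspace_orthogonal_comp[of L]] by auto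
    show "{p \<in> space P. closest_point ?L' (part_L p) \<noteq> 0} \<in> sets P" by measurable
    show "AE Q in H. AE g in std_gauss. closest_point ?L' (part_L (Q, g)) \<noteq> 0"
      using AE_transversal_H AE_space
    proof eventually_elim
      case (elim Q)
      let ?N = "(*v) Q ` M"
      have Q: "orthogonal_matrix Q" using elim(2) by (simp add: space_H)
      have N: "subspace ?N" by (rule subspace_rotated[OF M])
      let ?V = "(L \<inter> ?N) + orthogonal_comp ?N"
      note parts = side_parts(2)[OF L M Q elim(1)]
      have "c \<notin> ?V"
      proof
        assume "c \<in> ?V"
        then obtain x b where "x \<in> L" "x \<in> ?N" "b \<in> orthogonal_comp ?N" "c = x + b"
          by (auto elim!: set_plus_elim)
        then have s: "splits L ?N c x 0 b" by (simp add: splits_def subspace_0 subspace_orthogonal_comp)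
        have s': "splits L ?N c 0 c 0"
          using c(1) by (simp add: splits_def subspace_0 subspace_orthogonal_comp L N)
        show False using parts[OF s] parts[OF s'] c(2) by simp
      qed
      then have "AE g in std_gauss. g \<notin> ?V"
        by (intro null_proper_subspace subspace_plus subspace_orthogonal_comp subspace_inter L N) auto
      then show ?case
      proof eventually_elim
        case (elim g)
        obtain x a b where s: "splits L ?N g x a b" using splits_exists[OF L N] by blast
        have "a \<noteq> 0"
        proof
          assume "a = 0"
          then have "g \<in> ?V" using s by (auto simp: splits_def intro!: set_plus_intro)
          with elim show False by simp
        qed
        then show ?case using parts[OF s] by (simp add: part_L_def)
      qed
    qed
  qed
  show ?thesis
  proof (cases "?L' = {0}")
    case True
    then show ?thesis using 1 by (auto simp: nondegenerate_def elim: eventually_mono)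
  next
    case False
    from 1 2[OF False] show ?thesis by eventually_elim (auto simp: nondegenerate_def)
  qed
qed

lemma stabilizer_matrix:
  assumes "f \<in> stabilizer L"
  shows "matrix f *v x = f x" "orthogonal_matrix (matrix f)"
proof -
  have f: "orthogonal_transformation f" using assms by (simp add: stabilizer_def)
  show "matrix f *v x = f x"
    by (rule matrix_works) (use orthogonal_transformation_linear[OF f] in \<open>simp add: linear_def scalar_mult_eq_scaleR\<close>)
  show "orthogonal_matrix (matrix f)" using f orthogonal_transformation_matrix by blast
qed

text \<open>
  An orthogonal map that preserves \<open>L\<close>, applied to \<open>Q\<close> and to \<open>g\<close>, maps the decomposition of \<open>g\<close> to
  the decomposition of its image, and it cancels in the pullback.
\<close>

lemma parts_stabilizer:
  assumes f: "f \<in> stabilizer L" and Q: "orthogonal_matrix Q" and t: "transversal L ((*v) Q ` M)"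
  shows "part_L (matrix f ** Q, f g) = f (part_L (Q, g))" "part_M (matrix f ** Q, f g) = part_M (Q, g)"
proof -
  let ?N = "(*v) Q ` M" and ?F = "matrix f"
  note F = stabilizer_matrix[OF f]
  have o: "orthogonal_transformation f" and fL: "f ` L = L" using f by (auto simp: stabilizer_def)
  have N: "subspace ?N" by (rule subspace_rotated[OF M])
  have FQ: "orthogonal_matrix (?F ** Q)" using F(2) Q by (rule orthogonal_matrix_mul)
  have im: "f ` ?N = (*v) (?F ** Q) ` M" by (simp add: image_image matrix_vector_mul_assoc[symmetric] F(1))
  obtain x a b where s: "splits L ?N g x a b" using splits_exists[OF L N] by blast
  have s': "splits L ((*v) (?F ** Q) ` M) (f g) (f x) (f a) (f b)"
    using splits_image[OF o L N s] unfolding fL im .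
  have t': "transversal L ((*v) (?F ** Q) ` M)"
    using transversal_image[OF o L N t] unfolding fL im .
  note lin = orthogonal_transformation_linear[OF o]
  show "part_L (?F ** Q, f g) = f (part_L (Q, g))"
    unfolding part_L_def using side_eq(1)[OF L M FQ t' s'] side_eq(1)[OF L M Q t s] by (simp add: linear_add[OF lin])
  have "transpose (?F ** Q) *v (f x + f b) = transpose Q *v (transpose ?F *v (?F *v (x + b)))"
    by (simp add: F(1) linear_add[OF lin] matrix_transpose_mul matrix_vector_mul_assoc[symmetric] del: transpose_matrix_vector)
  also have "\<dots> = transpose Q *v (x + b)" by (simp only: orthogonal_matrix_transpose_mult[OF F(2)])
  finally show "part_M (?F ** Q, f g) = part_M (Q, g)"
    unfolding part_M_def fst_conv snd_conv side_eq(2)[OF L M FQ t' s'] side_eq(2)[OF L M Q t s] .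
qed

text \<open>
  Conditionally on any quantity that is invariant under the stabilizer of \<open>L\<close>, the directions of \<open>x\<close>
  and \<open>a\<close> are those of the two parts of a Gaussian vector.
\<close>

lemma part_L_uniform:
  fixes \<phi> :: "(real^'d^'d) \<times> (real^'d) \<Rightarrow> ennreal"
  assumes \<phi>[measurable]: "\<phi> \<in> borel_measurable P" and fin: "(\<integral>\<^sup>+p. \<phi> p \<partial>P) < top"
    and inv: "\<And>f. f \<in> stabilizer L \<Longrightarrow> AE p in P. \<phi> (matrix f ** fst p, f (snd p)) = \<phi> p"
    and A: "closed A" "\<And>w. nondegenerate L w \<Longrightarrow> unit_parts L w \<in> A \<longleftrightarrow> w \<in> A"
  shows "(\<integral>\<^sup>+p. \<phi> p * indicator A (part_L p) \<partial>P) = (\<integral>\<^sup>+p. \<phi> p \<partial>P) * emeasure std_gauss A"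
proof -
  let ?N = "density P \<phi>"
  note [measurable] = measurable_unit_parts[OF L]
  have [measurable]: "A \<in> sets borel" using A(1) by simp
  have part_LN: "part_L \<in> borel_measurable ?N" by simp
  have tot: "emeasure ?N (space ?N) = (\<integral>\<^sup>+p. \<phi> p \<partial>P)"
    using emeasure_density[OF \<phi> sets.top] by (auto intro!: nn_integral_cong)
  have "emeasure ?N {p \<in> space ?N. part_L p \<in> A} = emeasure ?N (space ?N) * emeasure std_gauss A"
  proof (rule uniform_directions[OF _ L part_LN])
    show "finite_measure ?N" using tot fin by (intro finite_measureI) simp
    show "AE w in ?N. nondegenerate L (part_L w)"
      using AE_nondegenerate_part_L by (subst AE_density) auto
    fix f assume f: "f \<in> stabilizer L"
    have [measurable]: "f \<in> borel_measurable borel"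
      using f by (intro orthogonal_borel_measurable) (auto simp: stabilizer_def)
    show "distr ?N borel (\<lambda>w. f (unit_parts L (part_L w))) = distr ?N borel (\<lambda>w. unit_parts L (part_L w))"
    proof (rule measure_eqI)
      fix B assume "B \<in> sets (distr ?N borel (\<lambda>w. f (unit_parts L (part_L w))))"
      then have [measurable]: "B \<in> sets borel" by simp
      have em: "emeasure (distr ?N borel h) B = (\<integral>\<^sup>+p. \<phi> p * indicator B (h p) \<partial>P)"
        if [measurable]: "h \<in> borel_measurable P" for h :: "(real^'d^'d) \<times> (real^'d) \<Rightarrow> real^'d"
      proof -
        have hB: "h -` B \<inter> space P \<in> sets P" by (rule measurable_sets[OF that]) measurable
        have "h \<in> borel_measurable ?N" using that by simp
        then have "emeasure (distr ?N borel h) B = emeasure ?N (h -` B \<inter> space ?N)"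
          by (rule emeasure_distr) measurable
        also have "\<dots> = (\<integral>\<^sup>+p. \<phi> p * indicator (h -` B \<inter> space P) p \<partial>P)"
          unfolding space_density by (rule emeasure_density[OF \<phi> hB])
        also have "\<dots> = (\<integral>\<^sup>+p. \<phi> p * indicator B (h p) \<partial>P)"
          by (intro nn_integral_cong) (auto simp: indicator_def)
        finally show ?thesis .
      qed
      have "(\<integral>\<^sup>+p. \<phi> p * indicator B (unit_parts L (part_L p)) \<partial>P)
        = (\<integral>\<^sup>+p. \<phi> (matrix f ** fst p, matrix f *v snd p) * indicator B (unit_parts L (part_L (matrix f ** fst p, matrix f *v snd p))) \<partial>P)"
        by (rule P_rotate[OF stabilizer_matrix(2)[OF f], symmetric]) measurable
      also have "\<dots> = (\<integral>\<^sup>+p. \<phi> p * indicator B (f (unit_parts L (part_L p))) \<partial>P)"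
      proof (rule nn_integral_cong_AE)
        show "AE p in P. \<phi> (matrix f ** fst p, matrix f *v snd p) * indicator B (unit_parts L (part_L (matrix f ** fst p, matrix f *v snd p)))
          = \<phi> p * indicator B (f (unit_parts L (part_L p)))"
          using inv[OF f] AE_transversal AE_space
        proof eventually_elim
          case (elim p)
          then show ?case
            using parts_stabilizer(1)[OF f orth_fst[OF elim(3)] elim(2), of "snd p"]
            by (simp add: stabilizer_matrix(1)[OF f] unit_parts_stabilizer[OF L f])
        qed
      qed
      finally show "emeasure (distr ?N borel (\<lambda>w. f (unit_parts L (part_L w)))) B = emeasure (distr ?N borel (\<lambda>w. unit_parts L (part_L w))) B"
        by (subst (1 2) em) auto
    qed simp
  qed (use A in auto)
  moreover have "emeasure ?N {p \<in> space ?N. part_L p \<in> A} = (\<integral>\<^sup>+p. \<phi> p * indicator A (part_L p) \<partial>P)"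
  proof -
    have "{p \<in> space P. part_L p \<in> A} \<in> sets P" by measurable
    then have "emeasure ?N {p \<in> space P. part_L p \<in> A} = (\<integral>\<^sup>+p. \<phi> p * indicator {p \<in> space P. part_L p \<in> A} p \<partial>P)"
      by (rule emeasure_density[OF \<phi>])
    also have "\<dots> = (\<integral>\<^sup>+p. \<phi> p * indicator A (part_L p) \<partial>P)"
      by (intro nn_integral_cong) (auto simp: indicator_def)
    finally show ?thesis by simp
  qed
  ultimately show ?thesis by (simp only: tot)
qed

lemma AE_part_L_not_in:
  assumes L': "subspace L'" and n: "\<not> L \<subseteq> L'"
  shows "AE p in P. closest_point L (part_L p) \<notin> L'"
proof -
  let ?A = "closest_point L -` L'"
  have cA: "closed ?A"
    by (intro closed_vimage closed_subspace L' continuous_closest_point_cone closed_cone_subspace L)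
  have [measurable]: "?A \<in> sets borel" using cA by simp
  have "(\<integral>\<^sup>+p. 1 * indicator ?A (part_L p) \<partial>P) = (\<integral>\<^sup>+p. 1 \<partial>P) * emeasure std_gauss ?A"
  proof (rule part_L_uniform)
    show "(\<integral>\<^sup>+p. 1 \<partial>P) < top" using HG.emeasure_space_1 by simp
    show "unit_parts L w \<in> ?A \<longleftrightarrow> w \<in> ?A" for w
    proof -
      have "sgn v \<in> L' \<longleftrightarrow> v \<in> L'" for v :: "real^'d"
        using subspace_scale[OF L', of "sgn v" "norm v"] sgn_in_subspace[OF L', of v]
        by (cases "v = 0") (auto simp: sgn_div_norm)
      then show ?thesis by (simp add: closest_point_unit_parts[OF L])
    qed
  qed (use cA in auto)
  also have "emeasure std_gauss ?A = 0"
  proof -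
    have "AE g in std_gauss. g \<notin> ?A" using AE_closest_point_not_in[OF L L' n] by simp
    then show ?thesis by (subst (asm) AE_iff_measurable[of ?A]) auto
  qed
  finally have "(\<integral>\<^sup>+p. indicator ?A (part_L p) \<partial>P) = 0" by simp
  then have "AE p in P. indicator ?A (part_L p) = (0 :: ennreal)" by (subst (asm) nn_integral_0_iff_AE) auto
  then show ?thesis by eventually_elim (auto simp: indicator_def split: if_splits)
qed

text \<open>
  Here \<open>x\<close> is the projection of \<open>g\<close> to \<open>L \<inter> Q M\<close>, whose dimension is \<open>dim L + dim M - d\<close> in general
  position.
\<close>

lemma integral_weight_part_L:
  assumes u: "0 < u"
  shows "(\<integral>\<^sup>+p. ennreal (gauss_weight u (closest_point L (part_L p))) \<partial>P) = ennreal u ^ (dim L + dim M - CARD('d))"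
proof -
  note [measurable] = measurable_closest_point_subspace[OF L]
  have "(\<integral>\<^sup>+p. ennreal (gauss_weight u (closest_point L (part_L p))) \<partial>P)
    = (\<integral>\<^sup>+Q. \<integral>\<^sup>+g. ennreal (gauss_weight u (closest_point L (part_L (Q, g)))) \<partial>std_gauss \<partial>H)"
    by (rule P_integral) measurable
  also have "\<dots> = (\<integral>\<^sup>+Q. ennreal u ^ (dim L + dim M - CARD('d)) \<partial>H)"
  proof (rule nn_integral_cong_AE)
    show "AE Q in H. (\<integral>\<^sup>+g. ennreal (gauss_weight u (closest_point L (part_L (Q, g)))) \<partial>std_gauss) = ennreal u ^ (dim L + dim M - CARD('d))"
      using AE_transversal_H AE_space
    proof eventually_elim
      case (elim Q)
      let ?N = "(*v) Q ` M"
      have Q: "orthogonal_matrix Q" using elim(2) by (simp add: space_H)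
      have N: "subspace ?N" by (rule subspace_rotated[OF M])
      have "closest_point L (part_L (Q, g)) = closest_point (L \<inter> ?N) g" for g
      proof -
        obtain x a b where s: "splits L ?N g x a b" using splits_exists[OF L N] by blast
        show ?thesis
          using side_parts(1)[OF L M Q elim(1) s] splits_closest_point[OF L N s] by (simp add: part_L_def)
      qed
      moreover have "dim (L \<inter> ?N) = dim L + dim M - CARD('d)"
      proof -
        have "orthogonal_comp (L + ?N) = {0}"
          using elim(1) polar_sum[OF subspace_0[OF L] subspace_0[OF N]]
          by (simp add: polar_subspace L N subspace_plus transversal_def)
        then have "L + ?N = UNIV"
          using orthogonal_comp_self[OF subspace_plus[OF L N]] by simp
        moreover have "L + ?N = {x + y |x y. x \<in> L \<and> y \<in> ?N}" by (auto simp: set_plus_def)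
        ultimately have "CARD('d) + dim (L \<inter> ?N) = dim L + dim ?N"
          using dim_sums_Int[OF L N] by (simp add: dim_UNIV)
        moreover have "dim ?N = dim M"
        proof (rule dim_image_eq)
          show "linear ((*v) Q)" by simp
          have "inj ((*v) Q)" using Q orthogonal_transformation_inj orthogonal_matrix_transformation by blast
          then show "inj_on ((*v) Q) (span M)" by (rule inj_on_subset) simp
        qed
        ultimately show ?thesis by simp
      qed
      ultimately show ?case
        using gauss_weight_subspace[OF subspace_inter[OF L N] u] by simp
    qed
  qed
  also have "\<dots> = ennreal u ^ (dim L + dim M - CARD('d))" by (simp add: emeasure_space_1)
  finally show ?thesis .
qed

end

lemma unit_parts_tile:
  fixes L :: "(real^'d) set"
  assumes C: "closed_cone C" and L: "subspace L"
  shows "unit_parts L w \<in> tile C L \<longleftrightarrow> w \<in> tile C L"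
proof -
  have "sgn v \<in> K \<longleftrightarrow> v \<in> K" if "closed_cone K" for v :: "real^'d" and K
    using cone_iff_scale[OF that, of "inverse (norm v)" v] by (cases "v = 0") (auto simp: sgn_div_norm)
  then show ?thesis
    by (simp add: tile_def closest_point_unit_parts[OF L] C closed_cone_polar)
qed

context haar_pair
begin

lemma exchange: "haar_pair H M L"
  using L M dims by unfold_locales auto

text \<open>
  The length of \<open>x\<close> and the second part are invariant under the stabilizer of \<open>L\<close>, so the first tile splits
  off as a factor. After the exchange of the two subspaces the second tile splits off in the same way,
  and the mean of the weight remains.
\<close>

lemma tile_pair_weight:
  assumes C: "closed_cone C" and D: "closed_cone D" and u: "0 < u" "u \<le> 1"
  shows "(\<integral>\<^sup>+p. ennreal (gauss_weight u (closest_point L (part_L p))) * indicator (tile D M) (part_M p) * indicator (tile C L) (part_L p) \<partial>P)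
    = ennreal u ^ (dim L + dim M - CARD('d)) * emeasure std_gauss (tile C L) * emeasure std_gauss (tile D M)"
proof -
  interpret R: haar_pair H M L by (rule exchange)
  note [measurable] = measurable_closest_point_subspace[OF L] measurable_closest_point_subspace[OF M]
  have cl: "closed (tile C L)" "closed (tile D M)" using closed_tile C D L M by auto
  then have [measurable]: "tile C L \<in> sets borel" "tile D M \<in> sets borel" by auto
  let ?w = "\<lambda>x :: real^'d. ennreal (gauss_weight u x)"
  have fin: "(\<integral>\<^sup>+p. f p \<partial>P) < top" if "\<And>p. f p \<le> (1 :: ennreal)" for f
  proof -
    have "(\<integral>\<^sup>+p. f p \<partial>P) \<le> (\<integral>\<^sup>+p. 1 \<partial>P)" by (intro nn_integral_mono that)
    also have "\<dots> = 1" using HG.emeasure_space_1 by simp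
    finally show ?thesis using ennreal_one_less_top le_less_trans by blast
  qed
  have w1: "?w x \<le> 1" for x using gauss_weight_le_1[OF u, of x] by simp
  have normf: "?w (f x) = ?w x" if "f \<in> stabilizer K" for f x K
    using that gauss_weight_norm[of "f x" x] by (auto simp: stabilizer_def orthogonal_transformation_norm)
  have PLf: "closest_point K (f y) = f (closest_point K y)" if "subspace K" "f \<in> stabilizer K" for f y and K :: "(real^'d) set"
    using closest_point_orthogonal_image[OF _ closed_cone_subspace[OF that(1)], of f y] that(2)
    by (auto simp: stabilizer_def)
  have "(\<integral>\<^sup>+p. ?w (closest_point L (part_L p)) * indicator (tile D M) (part_M p) * indicator (tile C L) (part_L p) \<partial>P)
    = (\<integral>\<^sup>+p. ?w (closest_point L (part_L p)) * indicator (tile D M) (part_M p) \<partial>P) * emeasure std_gauss (tile C L)"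
  proof (rule part_L_uniform)
    show "(\<integral>\<^sup>+p. ?w (closest_point L (part_L p)) * indicator (tile D M) (part_M p) \<partial>P) < top"
      by (rule fin) (auto simp: indicator_def gauss_weight_le_1[OF u])
    fix f assume f: "f \<in> stabilizer L"
    show "AE p in P. ?w (closest_point L (part_L (matrix f ** fst p, f (snd p)))) * indicator (tile D M) (part_M (matrix f ** fst p, f (snd p)))
      = ?w (closest_point L (part_L p)) * indicator (tile D M) (part_M p)"
      using AE_transversal AE_space
    proof eventually_elim
      case (elim p)
      show ?case
        using parts_stabilizer[OF f orth_fst[OF elim(2)] elim(1), of "snd p"] by (simp add: PLf[OF L f] normf[OF f])
    qed
  qed (use cl unit_parts_tile[OF C L] in auto)
  also have "(\<integral>\<^sup>+p. ?w (closest_point L (part_L p)) * indicator (tile D M) (part_M p) \<partial>P)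
    = (\<integral>\<^sup>+p. ?w (closest_point L (part_L (transpose (fst p), transpose (fst p) *v snd p))) *
         indicator (tile D M) (part_M (transpose (fst p), transpose (fst p) *v snd p)) \<partial>P)"
    by (rule P_flip[symmetric]) measurable
  also have "\<dots> = (\<integral>\<^sup>+p. ?w (closest_point M (R.part_L p)) * indicator (tile D M) (R.part_L p) \<partial>P)"
  proof (rule nn_integral_cong_AE)
    show "AE p in P. ?w (closest_point L (part_L (transpose (fst p), transpose (fst p) *v snd p))) *
         indicator (tile D M) (part_M (transpose (fst p), transpose (fst p) *v snd p))
       = ?w (closest_point M (R.part_L p)) * indicator (tile D M) (R.part_L p)"
      using R.AE_transversal AE_space
    proof eventually_elim
      case (elim p)
      have Q: "orthogonal_matrix (fst p)" by (rule orth_fst[OF elim(2)])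
      have "part_M (transpose (fst p), transpose (fst p) *v snd p) = R.part_L p"
        by (simp add: part_M_def R.part_L_def orthogonal_matrix_transpose_mult[OF Q] del: transpose_matrix_vector)
      moreover obtain x a b where s: "splits M ((*v) (fst p) ` L) (snd p) x a b"
        using splits_exists[OF M subspace_rotated[OF L]] by blast
      have "closest_point M (R.part_L p) = x"
        "closest_point L (part_L (transpose (fst p), transpose (fst p) *v snd p)) = transpose (fst p) *v x"
        using side_parts(1,3)[OF M L Q elim(1) s] by (simp_all add: part_L_def R.part_L_def del: transpose_matrix_vector)
      moreover have "norm (transpose (fst p) *v x) = norm x"
        using Q orthogonal_transformation_norm[of "(*v) (transpose (fst p))"]
        by (simp add: orthogonal_matrix_transformation[symmetric] del: transpose_matrix_vector)
      ultimately show ?case using gauss_weight_norm by (metis (no_types))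
    qed
  qed
  also have "\<dots> = (\<integral>\<^sup>+p. ?w (closest_point M (R.part_L p)) \<partial>P) * emeasure std_gauss (tile D M)"
  proof (rule R.part_L_uniform)
    show "(\<integral>\<^sup>+p. ?w (closest_point M (R.part_L p)) \<partial>P) < top" by (rule fin) (rule w1)
    fix f assume f: "f \<in> stabilizer M"
    show "AE p in P. ?w (closest_point M (R.part_L (matrix f ** fst p, f (snd p)))) = ?w (closest_point M (R.part_L p))"
      using R.AE_transversal AE_space
    proof eventually_elim
      case (elim p)
      show ?case
        using R.parts_stabilizer[OF f orth_fst[OF elim(2)] elim(1), of "snd p"] by (simp add: PLf[OF M f] normf[OF f])
    qed
  qed (use cl unit_parts_tile[OF D M] in auto)
  also have "(\<integral>\<^sup>+p. ?w (closest_point M (R.part_L p)) \<partial>P) = ennreal u ^ (dim L + dim M - CARD('d))"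
    using R.integral_weight_part_L[OF u(1)] by (simp add: add.commute)
  finally show ?thesis by (simp add: mult_ac)
qed

lemma tile_pair_weight_real:
  assumes C: "closed_cone C" and D: "closed_cone D" and u: "0 < u" "u \<le> 1"
  shows "has_bochner_integral P (\<lambda>p. gauss_weight u (closest_point L (part_L p)) * indicator (tile D M) (part_M p) * indicator (tile C L) (part_L p))
    (u ^ (dim L + dim M - CARD('d)) * measure std_gauss (tile C L) * measure std_gauss (tile D M))"
proof (rule has_bochner_integral_nn_integral)
  note [measurable] = measurable_closest_point_subspace[OF L]
  have [measurable]: "tile C L \<in> sets borel" "tile D M \<in> sets borel"
    by (auto intro!: borel_closed closed_tile C D L M)
  show "(\<lambda>p. gauss_weight u (closest_point L (part_L p)) * indicator (tile D M) (part_M p) * indicator (tile C L) (part_L p)) \<in> borel_measurable P"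
    by measurable
  have "(\<integral>\<^sup>+p. ennreal (gauss_weight u (closest_point L (part_L p)) * indicator (tile D M) (part_M p) * indicator (tile C L) (part_L p)) \<partial>P)
    = (\<integral>\<^sup>+p. ennreal (gauss_weight u (closest_point L (part_L p))) * indicator (tile D M) (part_M p) * indicator (tile C L) (part_L p) \<partial>P)"
    by (intro nn_integral_cong) (auto simp: indicator_def)
  also have "\<dots> = ennreal (u ^ (dim L + dim M - CARD('d)) * measure std_gauss (tile C L) * measure std_gauss (tile D M))"
    unfolding tile_pair_weight[OF assms] using u
    by (simp add: G.emeasure_eq_measure ennreal_mult' ennreal_power)
  finally show "(\<integral>\<^sup>+p. ennreal (gauss_weight u (closest_point L (part_L p)) * indicator (tile D M) (part_M p) * indicator (tile C L) (part_L p)) \<partial>P)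
    = ennreal (u ^ (dim L + dim M - CARD('d)) * measure std_gauss (tile C L) * measure std_gauss (tile D M))" .
qed (use u in \<open>auto simp: gauss_weight_nonneg\<close>)

lemma AE_part_M_not_in:
  assumes M': "subspace M'" and n: "\<not> M \<subseteq> M'"
  shows "AE p in P. closest_point M (part_M p) \<notin> M'"
proof -
  interpret R: haar_pair H M L by (rule exchange)
  note [measurable] = measurable_closest_point_subspace[OF M] borel_subspace[OF M']
  have "(\<integral>\<^sup>+p. indicator M' (closest_point M (part_M p)) \<partial>P)
    = (\<integral>\<^sup>+p. indicator M' (closest_point M (part_M (transpose (fst p), transpose (fst p) *v snd p))) \<partial>P)"
    by (rule P_flip[symmetric]) measurable
  also have "\<dots> = (\<integral>\<^sup>+p. indicator M' (closest_point M (R.part_L p)) \<partial>P)"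
    by (intro nn_integral_cong)
      (simp add: part_M_def R.part_L_def orthogonal_matrix_transpose_mult[OF orth_fst] del: transpose_matrix_vector)
  also have "\<dots> = (\<integral>\<^sup>+p. 0 \<partial>P)"
    using R.AE_part_L_not_in[OF M' n] by (intro nn_integral_cong_AE) (auto elim: eventually_mono)
  finally have "(\<integral>\<^sup>+p. indicator M' (closest_point M (part_M p)) \<partial>P) = 0" by simp
  then have "AE p in P. indicator M' (closest_point M (part_M p)) = (0 :: ennreal)" by (subst (asm) nn_integral_0_iff_AE) auto
  then show ?thesis by eventually_elim (auto simp: indicator_def split: if_splits)
qed

end

section \<open>The kinematic formula\<close>

lemma random_cone_Int:
  fixes C D :: "'w \<Rightarrow> (real^'d) set"
  assumes C: "random_cone N C" "\<And>w. w \<in> space N \<Longrightarrow> polyhedral_cone (C w)"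
    and D: "random_cone N D" "\<And>w. w \<in> space N \<Longrightarrow> polyhedral_cone (D w)"
  shows "random_cone N (\<lambda>w. C w \<inter> D w)"
proof (rule random_cone_cong)
  show "random_cone N (\<lambda>w. polar_cone (polar_cone (C w) + polar_cone (D w)))"
    by (intro random_cone_polar random_cone_sum C D polyhedral_cone_closed polyhedral_cone_sum polyhedral_cone_polar)
  fix w assume "w \<in> space N"
  then show "polar_cone (polar_cone (C w) + polar_cone (D w)) = C w \<inter> D w"
    using C(2) D(2) by (simp add: polar_Int[symmetric] polar_polar polyhedral_cone_closed polyhedral_cone_Int)
qed

lemma intrinsic_volume_integrable:
  fixes C :: "'w \<Rightarrow> (real^'d) set"
  assumes "prob_space N" "random_cone N C" "\<And>w. w \<in> space N \<Longrightarrow> polyhedral_cone (C w)"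
  shows "integrable N (\<lambda>w. intrinsic_volume k (C w))"
proof -
  interpret prob_space N by fact
  show ?thesis
    using assms
    by (intro integrable_const_bound[where B=1] measurable_intrinsic_volume AE_I2)
      (auto simp: abs_of_nonneg intrinsic_volume_nonneg intrinsic_volume_le_1)
qed

context haar
begin

lemma polyhedral_rotate: "orthogonal_matrix Q \<Longrightarrow> polyhedral_cone D \<Longrightarrow> polyhedral_cone ((*v) Q ` D)" for Q :: "real^'d^'d"
  by (intro polyhedral_cone_orthogonal_image) (simp_all only: orthogonal_matrix_transformation)

context
  fixes C D :: "(real^'d) set"
  assumes C: "polyhedral_cone C" and D: "polyhedral_cone D"
begin

abbreviation "proj p \<equiv> closest_point (C \<inter> (*v) (fst p) ` D) (snd p)"

definition "pairs = {(L, M). L \<in> all_face_spans C \<and> M \<in> all_face_spans D \<and> CARD('d) < dim L + dim M}"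

definition "active L M p \<longleftrightarrow> haar_pair.part_L L M p \<in> tile C L \<and> haar_pair.part_M L M p \<in> tile D M"

lemma pairs_haar_pair: "(L, M) \<in> pairs \<Longrightarrow> haar_pair H L M"
  using subspace_all_face_spans by unfold_locales (auto simp: pairs_def)

lemma finite_pairs: "finite pairs"
  using finite_all_face_spans[OF C] finite_all_face_spans[OF D]
  by (rule finite_subset[rotated, OF finite_cartesian_product]) (auto simp: pairs_def)

text \<open>
  If the pair is active, then \<open>x\<close> is in \<open>C \<inter> Q D\<close>, and \<open>a + b\<close> is in the polar of that intersection and
  orthogonal to \<open>x\<close>. This characterises the projection.
\<close>

lemma active_proj:
  assumes LM: "(L, M) \<in> pairs" and Q: "orthogonal_matrix (fst p)"
    and t: "transversal L ((*v) (fst p) ` M)" and a: "active L M p"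
  shows "closest_point L (haar_pair.part_L L M p) = proj p" "closest_point M (haar_pair.part_M L M p) = transpose (fst p) *v proj p"
proof -
  interpret haar_pair H L M by (rule pairs_haar_pair[OF LM])
  let ?N = "(*v) (fst p) ` M" and ?D = "(*v) (fst p) ` D"
  have o: "orthogonal_transformation ((*v) (fst p))" using Q by (simp only: orthogonal_matrix_transformation)
  have D': "polyhedral_cone ?D" by (rule polyhedral_rotate[OF Q D])
  obtain x a b where s: "splits L ?N (snd p) x a b" using splits_exists[OF L subspace_rotated[OF M]] by blast
  note parts = side_parts[OF L M Q t s, folded part_L_def part_M_def[of p]]
  have x: "x \<in> C" "a \<in> polar_cone C" "transpose (fst p) *v x \<in> D" "transpose (fst p) *v b \<in> polar_cone D"
    using assms(4) parts by (simp_all add: active_def tile_def part_L_def part_M_def del: transpose_matrix_vector)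
  have xD: "x \<in> ?D" using x(3) orthogonal_matrix_transpose_mult(2)[OF Q, of x] by (metis image_eqI)
  have bD: "b \<in> polar_cone ?D"
    unfolding polar_orthogonal_image[OF o]
    using x(4) orthogonal_matrix_transpose_mult(2)[OF Q, of b] by (metis image_eqI)
  have "proj p = x"
  proof (rule closest_point_cone_unique)
    show "closed_cone (C \<inter> ?D)" by (intro polyhedral_cone_closed polyhedral_cone_Int C D')
    show "x \<in> C \<inter> ?D" using x xD by simp
    have eq: "snd p - x = a + b" using s by (simp add: splits_def)
    show "snd p - x \<in> polar_cone (C \<inter> ?D)"
      unfolding eq polar_Int[OF C D'] using x(2) bD by (rule set_plus_intro)
    show "x \<bullet> (snd p - x) = 0"
      unfolding eq inner_add_right using s by (auto simp: splits_def orthogonal_comp_def orthogonal_def)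
  qed
  then show "closest_point L (part_L p) = proj p" "closest_point M (part_M p) = transpose (fst p) *v proj p"
    using parts by (simp_all add: part_L_def part_M_def del: transpose_matrix_vector)
qed

text \<open>
  Write \<open>x\<close> for the projection and split \<open>g - x = a + b\<close> along the polars of \<open>C\<close> and of \<open>Q D\<close>. Both
  \<open>\<langle>x, a\<rangle>\<close> and \<open>\<langle>x, b\<rangle>\<close> are nonpositive and their sum is \<open>0\<close>, so both vanish. The smallest faces at
  \<open>x\<close> and at its pullback provide \<open>L\<close> and \<open>M\<close>.
\<close>

lemma exists_active:
  assumes Q: "orthogonal_matrix (fst p)" and ne: "proj p \<noteq> 0"
    and small: "\<And>L M. L \<in> all_face_spans C \<Longrightarrow> M \<in> all_face_spans D \<Longrightarrow> dim L + dim M \<le> CARD('d) \<Longrightarrow> L \<inter> (*v) (fst p) ` M = {0}"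
    and trans: "\<And>L M. (L, M) \<in> pairs \<Longrightarrow> transversal L ((*v) (fst p) ` M)"
  obtains L M where "(L, M) \<in> pairs" "active L M p"
proof -
  let ?D = "(*v) (fst p) ` D" and ?T = "transpose (fst p)"
  have o: "orthogonal_transformation ((*v) (fst p))" using Q by (simp only: orthogonal_matrix_transformation)
  have D': "polyhedral_cone ?D" by (rule polyhedral_rotate[OF Q D])
  have cc: "closed_cone (C \<inter> ?D)" by (intro polyhedral_cone_closed polyhedral_cone_Int C D')
  define x where "x = proj p"
  note x = closest_point_cone[OF cc, of "snd p", folded x_def]
  have Tinj: "(?T *v v) \<bullet> (?T *v w) = v \<bullet> w" for v w
  proof -
    have "orthogonal_transformation ((*v) ?T)" using Q by (simp only: orthogonal_matrix_transformation[symmetric] orthogonal_matrix_transpose)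
    then show ?thesis by (simp only: orthogonal_transformation_def)
  qed
  have TD: "?T *v v \<in> K" if "v \<in> (*v) (fst p) ` K" for v K
    using that by (auto simp: orthogonal_matrix_transpose_mult[OF Q] simp del: transpose_matrix_vector)
  obtain a b where ab: "a \<in> polar_cone C" "b \<in> polar_cone ?D" "snd p - x = a + b"
    using x(2) unfolding polar_Int[OF C D'] by (auto elim: set_plus_elim)
  have "x \<bullet> a \<le> 0" "x \<bullet> b \<le> 0" "x \<bullet> a + x \<bullet> b = 0"
    using x ab by (auto simp: polar_cone_def inner_add_right[symmetric])
  then have xa: "x \<bullet> a = 0" and xb: "x \<bullet> b = 0" by auto
  have xC: "x \<in> C" and xD: "x \<in> ?D" using x(1) by auto
  obtain L where Lf: "L \<in> all_face_spans C" "x \<in> L" "\<And>y. y \<in> polar_cone C \<Longrightarrow> x \<bullet> y = 0 \<Longrightarrow> y \<in> orthogonal_comp L"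
    using minimal_face_span[OF C xC] by metis
  obtain M where Mf: "M \<in> all_face_spans D" "?T *v x \<in> M"
    "\<And>y. y \<in> polar_cone D \<Longrightarrow> (?T *v x) \<bullet> y = 0 \<Longrightarrow> y \<in> orthogonal_comp M"
    using minimal_face_span[OF D TD[OF xD]] by metis
  note sL = subspace_all_face_spans[OF Lf(1)] and sM = subspace_all_face_spans[OF Mf(1)]
  let ?N = "(*v) (fst p) ` M"
  have xN: "x \<in> ?N" using Mf(2) orthogonal_matrix_transpose_mult(2)[OF Q, of x] by (metis image_eqI)
  have "b \<in> (*v) (fst p) ` polar_cone D" using ab(2) unfolding polar_orthogonal_image[OF o] .
  then have Tb: "?T *v b \<in> polar_cone D" by (rule TD)
  then have TbM: "?T *v b \<in> orthogonal_comp M" by (rule Mf(3)) (simp only: Tinj xb)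
  then have bN: "b \<in> orthogonal_comp ?N"
    unfolding orthogonal_comp_orthogonal_image[OF o sM]
    using orthogonal_matrix_transpose_mult(2)[OF Q, of b] by (metis image_eqI)
  have "\<not> dim L + dim M \<le> CARD('d)"
  proof
    assume "dim L + dim M \<le> CARD('d)"
    from small[OF Lf(1) Mf(1) this] show False using Lf(2) xN ne by (auto simp: x_def)
  qed
  then have LM: "(L, M) \<in> pairs" using Lf(1) Mf(1) by (simp add: pairs_def)
  interpret haar_pair H L M by (rule pairs_haar_pair[OF LM])
  have s: "splits L ?N (snd p) x a b"
    unfolding splits_def using Lf(2) xN Lf(3)[OF ab(1) xa] bN ab(3) by (auto simp: algebra_simps)
  have "active L M p"
    using side_parts[OF sL sM Q trans[OF LM] s] xC ab(1) TD[OF xD] Tb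
    by (simp add: active_def tile_def part_L_def part_M_def del: transpose_matrix_vector)
  with LM that show ?thesis by blast
qed

text \<open>
  At most one pair is active: by \<open>active_proj\<close> any two active pairs share \<open>x\<close>, and almost surely \<open>x\<close> lies
  in no face span that does not contain \<open>L\<close>, nor its pullback in one that does not contain \<open>M\<close>. If \<open>x = 0\<close>, no
  pair is active and the weight is \<open>1\<close>. Writing the weight as \<open>1\<close> plus a sum of differences covers
  this case, so the probability of \<open>x = 0\<close> need not be found separately.
\<close>

lemma AE_weight:
  "AE p in P. gauss_weight u (proj p) = 1 + (\<Sum>(L, M)\<in>pairs.
     (gauss_weight u (closest_point L (haar_pair.part_L L M p)) - 1) * indicator (tile D M) (haar_pair.part_M L M p) * indicator (tile C L) (haar_pair.part_L L M p))"
proof -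
  note finC = finite_all_face_spans[OF C] and finD = finite_all_face_spans[OF D]
  have small: "AE p in P. \<forall>L\<in>all_face_spans C. \<forall>M\<in>all_face_spans D. dim L + dim M \<le> CARD('d) \<longrightarrow> L \<inter> (*v) (fst p) ` M = {0}"
  proof (intro AE_finite_allI finC finD)
    fix L M assume "L \<in> all_face_spans C" "M \<in> all_face_spans D"
    then show "AE p in P. dim L + dim M \<le> CARD('d) \<longrightarrow> L \<inter> (*v) (fst p) ` M = {0}"
      using AE_fst[OF haar_general_position[OF H, of L M]] subspace_all_face_spans
      by (cases "dim L + dim M \<le> CARD('d)") auto
  qed
  have big: "AE p in P. \<forall>(L, M)\<in>pairs. transversal L ((*v) (fst p) ` M) \<and> closest_point L (haar_pair.part_L L M p) \<noteq> 0
     \<and> (\<forall>L'\<in>all_face_spans C. \<not> L \<subseteq> L' \<longrightarrow> closest_point L (haar_pair.part_L L M p) \<notin> L')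
     \<and> (\<forall>M'\<in>all_face_spans D. \<not> M \<subseteq> M' \<longrightarrow> closest_point M (haar_pair.part_M L M p) \<notin> M')"
  proof (intro AE_finite_allI finite_pairs)
    fix LM assume LM: "LM \<in> pairs"
    obtain L M where eq: "LM = (L, M)" by force
    interpret haar_pair H L M using pairs_haar_pair LM eq by auto
    have "AE p in P. \<forall>L'\<in>all_face_spans C. \<not> L \<subseteq> L' \<longrightarrow> closest_point L (part_L p) \<notin> L'"
      using AE_part_L_not_in subspace_all_face_spans by (intro AE_finite_allI finC) auto
    moreover have "AE p in P. \<forall>M'\<in>all_face_spans D. \<not> M \<subseteq> M' \<longrightarrow> closest_point M (part_M p) \<notin> M'"
      using AE_part_M_not_in subspace_all_face_spans by (intro AE_finite_allI finD) auto
    ultimately show "AE p in P. case LM of (L, M) \<Rightarrow> transversal L ((*v) (fst p) ` M) \<and> closest_point L (haar_pair.part_L L M p) \<noteq> 0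
     \<and> (\<forall>L'\<in>all_face_spans C. \<not> L \<subseteq> L' \<longrightarrow> closest_point L (haar_pair.part_L L M p) \<notin> L')
     \<and> (\<forall>M'\<in>all_face_spans D. \<not> M \<subseteq> M' \<longrightarrow> closest_point M (haar_pair.part_M L M p) \<notin> M')"
      using AE_transversal AE_nondegenerate_part_L
      by eventually_elim (simp add: eq nondegenerate_def L_nonzero)
  qed
  from small big AE_space show ?thesis
  proof eventually_elim
    case (elim p)
    note Q = orth_fst[OF elim(3)]
    have big: "transversal L ((*v) (fst p) ` M)" "closest_point L (haar_pair.part_L L M p) \<noteq> 0"
      "\<And>L'. L' \<in> all_face_spans C \<Longrightarrow> closest_point L (haar_pair.part_L L M p) \<in> L' \<Longrightarrow> L \<subseteq> L'"
      "\<And>M'. M' \<in> all_face_spans D \<Longrightarrow> closest_point M (haar_pair.part_M L M p) \<in> M' \<Longrightarrow> M \<subseteq> M'"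
      if "(L, M) \<in> pairs" for L M
    proof -
      note b = bspec[OF elim(2) that, unfolded case_prod_conv]
      show "transversal L ((*v) (fst p) ` M)" using b by (rule conjunct1)
      note b = b[THEN conjunct2]
      show "closest_point L (haar_pair.part_L L M p) \<noteq> 0" using b by (rule conjunct1)
      note b = b[THEN conjunct2]
      show "L \<subseteq> L'" if "L' \<in> all_face_spans C" "closest_point L (haar_pair.part_L L M p) \<in> L'" for L'
        using b[THEN conjunct1, rule_format, OF that(1)] that(2) by (rule contrapos_pp[rotated]) 
      show "M \<subseteq> M'" if "M' \<in> all_face_spans D" "closest_point M (haar_pair.part_M L M p) \<in> M'" for M'
        using b[THEN conjunct2, rule_format, OF that(1)] that(2) by (rule contrapos_pp[rotated]) 
    qed
    have proj: "closest_point L (haar_pair.part_L L M p) = proj p" "closest_point M (haar_pair.part_M L M p) = transpose (fst p) *v proj p"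
      if "(L, M) \<in> pairs" "active L M p" for L M
      using active_proj[OF that(1) Q big(1)[OF that(1)] that(2)] by auto
    let ?t = "\<lambda>(L, M). (gauss_weight u (closest_point L (haar_pair.part_L L M p)) - 1) *
       indicator (tile D M) (haar_pair.part_M L M p) * indicator (tile C L) (haar_pair.part_L L M p)"
    have t: "?t (L, M) = (if active L M p then gauss_weight u (proj p) - 1 else 0)" if LM: "(L, M) \<in> pairs" for L M
    proof (cases "active L M p")
      case True
      show ?thesis unfolding case_prod_conv proj(1)[OF LM True] using True by (simp add: active_def)
    next
      case False
      then show ?thesis unfolding case_prod_conv by (auto simp: active_def)
    qed
    have "(\<Sum>LM\<in>pairs. ?t LM) = gauss_weight u (proj p) - 1"
    proof (cases "proj p = 0")
      case True
      have "\<not> active L M p" if "(L, M) \<in> pairs" for L M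
        using proj(1)[OF that] big(2)[OF that] True by metis
      then have "?t X = 0" if "X \<in> pairs" for X
        using t that by (cases X) (simp only: if_False simp_thms)
      then have "(\<Sum>LM\<in>pairs. ?t LM) = 0" by (intro sum.neutral ballI)
      moreover have "gauss_weight u (proj p) = 1" unfolding True by (simp add: gauss_weight_def)
      ultimately show ?thesis by (simp only: diff_self)
    next
      case False
      obtain L M where LM: "(L, M) \<in> pairs" "active L M p"
        by (rule exists_active[OF Q False elim(1)[rule_format] big(1)])
      interpret haar_pair H L M by (rule pairs_haar_pair[OF LM(1)])
      have LM': "L \<in> all_face_spans C" "M \<in> all_face_spans D" using LM(1) by (auto simp: pairs_def)
      have mem: "proj p \<in> L" "transpose (fst p) *v proj p \<in> M"
        using closest_point_subspace(1)[OF L, of "part_L p"] closest_point_subspace(1)[OF M, of "part_M p"]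
        unfolding proj[OF LM] by blast+
      have "(L', M') = (L, M)" if p': "(L', M') \<in> pairs" "active L' M' p" for L' M'
      proof -
        interpret R: haar_pair H L' M' by (rule pairs_haar_pair[OF p'(1)])
        have LM2: "L' \<in> all_face_spans C" "M' \<in> all_face_spans D" using p'(1) by (auto simp: pairs_def)
        have mem': "proj p \<in> L'" "transpose (fst p) *v proj p \<in> M'"
          using closest_point_subspace(1)[OF R.L, of "R.part_L p"] closest_point_subspace(1)[OF R.M, of "R.part_M p"]
          unfolding proj[OF p'] by auto
        have "L \<subseteq> L'" "M \<subseteq> M'"
          using big(3)[OF LM(1) LM2(1)] big(4)[OF LM(1) LM2(2)] mem' unfolding proj[OF LM] by auto
        moreover have "L' \<subseteq> L" "M' \<subseteq> M"
          using big(3)[OF p'(1) LM'(1)] big(4)[OF p'(1) LM'(2)] mem unfolding proj[OF p'] by auto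
        ultimately show ?thesis by auto
      qed
      note uniq = this
      have "?t X = (if X = (L, M) then gauss_weight u (proj p) - 1 else 0)" if X: "X \<in> pairs" for X
      proof (cases "X = (L, M)")
        case True
        then show ?thesis using t[OF LM(1)] LM(2) by (simp only: if_True simp_thms)
      next
        case False
        obtain L' M' where eq: "X = (L', M')" by force
        have "\<not> active L' M' p" using uniq[of L' M'] X False unfolding eq by blast
        then show ?thesis using t[of L' M'] X False unfolding eq by (simp only: if_False simp_thms)
      qed
      then have "(\<Sum>LM\<in>pairs. ?t LM) = (\<Sum>LM\<in>pairs. if LM = (L, M) then gauss_weight u (proj p) - 1 else 0)"
        by (intro sum.cong refl)
      also have "\<dots> = gauss_weight u (proj p) - 1" using LM(1) finite_pairs by simp
      finally show ?thesis .
    qed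
    then show ?case by (simp only: algebra_simps)
  qed
qed

lemma random_intersection: "random_cone H (\<lambda>Q. C \<inter> (*v) Q ` D)"
  using polyhedral_rotate[OF _ D] C D
  by (intro random_cone_Int random_cone_const random_cone_rotate measurable_haar_borel H polyhedral_cone_closed)
    (auto simp: space_H)

lemma polyhedral_intersection: "Q \<in> space H \<Longrightarrow> polyhedral_cone (C \<inter> (*v) Q ` D)"
  by (intro polyhedral_cone_Int C polyhedral_rotate D) (simp add: space_H)

lemma sum_intrinsic_volume_pairs:
  fixes f :: "nat \<Rightarrow> nat \<Rightarrow> real"
  shows "(\<Sum>i\<le>CARD('d). \<Sum>j\<le>CARD('d). intrinsic_volume i C * intrinsic_volume j D * f i j)
    = (\<Sum>L\<in>all_face_spans C. \<Sum>M\<in>all_face_spans D. measure std_gauss (tile C L) * measure std_gauss (tile D M) * f (dim L) (dim M))"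
proof -
  have "(\<Sum>i\<le>CARD('d). \<Sum>j\<le>CARD('d). intrinsic_volume i C * intrinsic_volume j D * f i j)
    = (\<Sum>i\<le>CARD('d). intrinsic_volume i C * (\<Sum>j\<le>CARD('d). intrinsic_volume j D * f i j))"
    by (simp add: sum_distrib_left mult.assoc)
  also have "\<dots> = (\<Sum>L\<in>all_face_spans C. measure std_gauss (tile C L) * (\<Sum>j\<le>CARD('d). intrinsic_volume j D * f (dim L) j))"
    by (rule sum_intrinsic_volume[OF C])
  also have "\<dots> = (\<Sum>L\<in>all_face_spans C. measure std_gauss (tile C L) * (\<Sum>M\<in>all_face_spans D. measure std_gauss (tile D M) * f (dim L) (dim M)))"
    by (simp only: sum_intrinsic_volume[OF D])
  finally show ?thesis by (simp add: sum_distrib_left mult.assoc)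
qed

text \<open>
  The pairs with \<open>dim L + dim M \<le> d\<close> appear in the result with the exponent \<open>0\<close>, since the total mass of all
  pairs of tiles is \<open>1\<close>.
\<close>

lemma kinematic_generating:
  assumes u: "0 < u" "u < 1"
  shows "(\<integral>p. gauss_weight u (proj p) \<partial>P)
    = (\<Sum>i\<le>CARD('d). \<Sum>j\<le>CARD('d). intrinsic_volume i C * intrinsic_volume j D * u ^ (i + j - CARD('d)))"
proof -
  let ?m = "\<lambda>L M. measure std_gauss (tile C L) * measure std_gauss (tile D M)"
  let ?t = "\<lambda>p (L, M). (gauss_weight u (closest_point L (haar_pair.part_L L M p)) - 1) *
       indicator (tile D M) (haar_pair.part_M L M p) * indicator (tile C L) (haar_pair.part_L L M p)"
  note cC = polyhedral_cone_closed[OF C] and cD = polyhedral_cone_closed[OF D]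
  have meas: "(\<lambda>p. gauss_weight u (proj p)) \<in> borel_measurable P"
  proof -
    have [measurable]: "(\<lambda>p. proj p) \<in> borel_measurable (H \<Otimes>\<^sub>M borel)"
      using random_cone_joint[OF random_intersection] by (simp add: case_prod_beta')
    have "(\<lambda>p. gauss_weight u (proj p)) \<in> borel_measurable (H \<Otimes>\<^sub>M borel)" by measurable
    then show ?thesis
      by (subst measurable_cong_sets[OF sets_pair_measure_cong[OF refl sets_gaussian_on] refl])
  qed
  have hb: "has_bochner_integral P (\<lambda>p. ?t p (L, M)) ((u ^ (dim L + dim M - CARD('d)) - 1) * ?m L M)" if "(L, M) \<in> pairs" for L M
  proof -
    interpret haar_pair H L M by (rule pairs_haar_pair[OF that])
    have "has_bochner_integral P (\<lambda>p. gauss_weight u (closest_point L (part_L p)) * indicator (tile D M) (part_M p) * indicator (tile C L) (part_L p)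
       - gauss_weight 1 (closest_point L (part_L p)) * indicator (tile D M) (part_M p) * indicator (tile C L) (part_L p))
      (u ^ (dim L + dim M - CARD('d)) * measure std_gauss (tile C L) * measure std_gauss (tile D M)
        - 1 ^ (dim L + dim M - CARD('d)) * measure std_gauss (tile C L) * measure std_gauss (tile D M))"
      using u by (intro has_bochner_integral_diff tile_pair_weight_real[OF cC cD]) auto
    then show ?thesis by (simp add: algebra_simps)
  qed
  have "has_bochner_integral P (\<lambda>p. 1 + (\<Sum>LM\<in>pairs. ?t p LM))
     (1 + (\<Sum>(L, M)\<in>pairs. (u ^ (dim L + dim M - CARD('d)) - 1) * ?m L M))"
  proof (intro has_bochner_integral_add has_bochner_integral_sum)
    show "has_bochner_integral P (\<lambda>p. 1 :: real) 1"
      using HG.prob_space by (simp add: has_bochner_integral_iff)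
    fix LM assume "LM \<in> pairs"
    then show "has_bochner_integral P (\<lambda>p. ?t p LM) (case LM of (L, M) \<Rightarrow> (u ^ (dim L + dim M - CARD('d)) - 1) * ?m L M)"
      using hb by (cases LM) auto
  qed
  then have "(\<integral>p. 1 + (\<Sum>LM\<in>pairs. ?t p LM) \<partial>P) = 1 + (\<Sum>(L, M)\<in>pairs. (u ^ (dim L + dim M - CARD('d)) - 1) * ?m L M)"
    by (rule has_bochner_integral_integral_eq)
  moreover have "(\<integral>p. gauss_weight u (proj p) \<partial>P) = (\<integral>p. 1 + (\<Sum>LM\<in>pairs. ?t p LM) \<partial>P)"
  proof (rule integral_cong_AE)
    show "AE p in P. gauss_weight u (proj p) = 1 + (\<Sum>LM\<in>pairs. ?t p LM)"
      using AE_weight[of u] .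
    show "(\<lambda>p. 1 + (\<Sum>LM\<in>pairs. ?t p LM)) \<in> borel_measurable P"
      using has_bochner_integral_implies_finite_norm hb
      by (intro borel_measurable_add borel_measurable_const borel_measurable_sum) (auto dest: borel_measurable_has_bochner_integral)
  qed (rule meas)
  moreover have "(\<Sum>(L, M)\<in>pairs. (u ^ (dim L + dim M - CARD('d)) - 1) * ?m L M)
    = (\<Sum>(L, M)\<in>all_face_spans C \<times> all_face_spans D. (u ^ (dim L + dim M - CARD('d)) - 1) * ?m L M)"
  proof (intro sum.mono_neutral_left ballI)
    show "finite (all_face_spans C \<times> all_face_spans D)"
      by (intro finite_cartesian_product finite_all_face_spans C D)
    fix X assume X: "X \<in> all_face_spans C \<times> all_face_spans D - pairs"
    obtain L M where eq: "X = (L, M)" by force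
    have "dim L + dim M - CARD('d) = 0" using X by (auto simp: pairs_def eq)
    then show "(case X of (L, M) \<Rightarrow> (u ^ (dim L + dim M - CARD('d)) - 1) * ?m L M) = 0"
      unfolding eq by simp
  qed (auto simp: pairs_def)
  moreover have "\<dots> = (\<Sum>L\<in>all_face_spans C. \<Sum>M\<in>all_face_spans D. ?m L M * u ^ (dim L + dim M - CARD('d)))
     - (\<Sum>L\<in>all_face_spans C. \<Sum>M\<in>all_face_spans D. ?m L M * 1)"
    by (simp add: sum.cartesian_product[symmetric] sum_subtractf algebra_simps)
  moreover have "(\<Sum>L\<in>all_face_spans C. \<Sum>M\<in>all_face_spans D. ?m L M * 1) = 1"
    using sum_intrinsic_volume_pairs[of "\<lambda>_ _. 1"] sum_intrinsic_volume_1[OF C] sum_intrinsic_volume_1[OF D]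
    by (simp add: sum_distrib_left[symmetric] sum_distrib_right[symmetric])
  ultimately show ?thesis
    unfolding sum_intrinsic_volume_pairs by simp
qed

text \<open>
  Subtraction of natural numbers is truncated, so \<open>i + j - d\<close> is the generic dimension \<open>max 0 (i + j - d)\<close>.
\<close>

proposition kinematic_formula:
  assumes k: "k \<le> CARD('d)"
  shows "(\<integral>Q. intrinsic_volume k (C \<inter> (*v) Q ` D) \<partial>H)
    = (\<Sum>(i, j) | i \<le> CARD('d) \<and> j \<le> CARD('d) \<and> i + j - CARD('d) = k. intrinsic_volume i C * intrinsic_volume j D)"
proof (rule polynomial_coeffs_eq[OF _ k])
  fix u :: real assume u: "0 < u" "u < 1"
  have int: "integrable H (\<lambda>Q. intrinsic_volume k (C \<inter> (*v) Q ` D))" for k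
    by (intro intrinsic_volume_integrable prob_space_axioms random_intersection polyhedral_intersection)
  have "(\<Sum>k\<le>CARD('d). (\<integral>Q. intrinsic_volume k (C \<inter> (*v) Q ` D) \<partial>H) * u ^ k)
    = (\<integral>Q. (\<Sum>k\<le>CARD('d). intrinsic_volume k (C \<inter> (*v) Q ` D) * u ^ k) \<partial>H)"
    using int by simp
  also have "\<dots> = (\<integral>Q. (\<integral>g. gauss_weight u (closest_point (C \<inter> (*v) Q ` D) g) \<partial>std_gauss) \<partial>H)"
    using u by (intro Bochner_Integration.integral_cong refl steiner[symmetric] polyhedral_intersection)
  also have "\<dots> = (\<integral>p. gauss_weight u (proj p) \<partial>P)"
  proof (subst HG.integral_fst'[symmetric])
    have [measurable]: "(\<lambda>p. proj p) \<in> borel_measurable (H \<Otimes>\<^sub>M borel)"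
      using random_cone_joint[OF random_intersection] by (simp add: case_prod_beta')
    have "(\<lambda>p. gauss_weight u (proj p)) \<in> borel_measurable (H \<Otimes>\<^sub>M borel)" by measurable
    then have "(\<lambda>p. gauss_weight u (proj p)) \<in> borel_measurable P"
      by (subst measurable_cong_sets[OF sets_pair_measure_cong[OF refl sets_gaussian_on] refl])
    then show "integrable P (\<lambda>p. gauss_weight u (proj p))"
      using u gauss_weight_le_1[of u] by (intro HG.integrable_const_bound[where B=1] AE_I2) (auto simp: gauss_weight_nonneg)
  qed simp
  also have "\<dots> = (\<Sum>i\<le>CARD('d). \<Sum>j\<le>CARD('d). intrinsic_volume i C * intrinsic_volume j D * u ^ (i + j - CARD('d)))"
    by (rule kinematic_generating[OF u])
  also have "\<dots> = (\<Sum>(i, j)\<in>{..CARD('d)} \<times> {..CARD('d)}. intrinsic_volume i C * intrinsic_volume j D * u ^ (i + j - CARD('d)))"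
    by (rule sum.cartesian_product)
  also have "\<dots> = (\<Sum>k\<le>CARD('d). \<Sum>ij\<in>{ij \<in> {..CARD('d)} \<times> {..CARD('d)}. fst ij + snd ij - CARD('d) = k}.
      case ij of (i, j) \<Rightarrow> intrinsic_volume i C * intrinsic_volume j D * u ^ (i + j - CARD('d)))"
    by (rule sum.group[symmetric]) auto
  also have "\<dots> = (\<Sum>k\<le>CARD('d). (\<Sum>(i, j) | i \<le> CARD('d) \<and> j \<le> CARD('d) \<and> i + j - CARD('d) = k. intrinsic_volume i C * intrinsic_volume j D) * u ^ k)"
    unfolding sum_distrib_right by (intro sum.cong refl sum.cong) auto
  finally show "(\<Sum>k\<le>CARD('d). (\<integral>Q. intrinsic_volume k (C \<inter> (*v) Q ` D) \<partial>H) * u ^ k)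
    = (\<Sum>k\<le>CARD('d). (\<Sum>(i, j) | i \<le> CARD('d) \<and> j \<le> CARD('d) \<and> i + j - CARD('d) = k. intrinsic_volume i C * intrinsic_volume j D) * u ^ k)" .
qed

end

end

section \<open>Formulas\<close>

fun formula_dim :: "nat \<Rightarrow> formula \<Rightarrow> (nat \<Rightarrow> nat) \<Rightarrow> nat" where
  "formula_dim d (Var i) \<kappa> = \<kappa> i"
| "formula_dim d (Neg F) \<kappa> = d - formula_dim d F \<kappa>"
| "formula_dim d (And F G) \<kappa> = formula_dim d F \<kappa> + formula_dim d G \<kappa> - d"
| "formula_dim d (Or F G) \<kappa> = min d (formula_dim d F \<kappa> + formula_dim d G \<kappa>)"

lemma formula_dim_le: "(\<And>i. i \<in> set (var_list F) \<Longrightarrow> \<kappa> i \<le> d) \<Longrightarrow> formula_dim d F \<kappa> \<le> d"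
proof (induction F)
  case (And F G)
  have "formula_dim d F \<kappa> \<le> d" "formula_dim d G \<kappa> \<le> d" by (rule And.IH, rule And.prems, simp)+
  then show ?case by simp
qed auto

lemma formula_dim_cong: "(\<And>i. i \<in> set (var_list F) \<Longrightarrow> \<kappa> i = \<kappa>' i) \<Longrightarrow> formula_dim d F \<kappa> = formula_dim d F \<kappa>'"
  by (induction F) auto

lemma eval_formula_cong:
  "(\<And>i. i \<in> set (var_list F) \<Longrightarrow> A i = B i) \<Longrightarrow> eval_formula F A = eval_formula F B"
  by (induction F) auto

lemma polyhedral_eval_formula:
  "(\<And>i. i \<in> set (var_list F) \<Longrightarrow> polyhedral_cone (A i)) \<Longrightarrow> polyhedral_cone (eval_formula F A)"
  by (induction F) (auto intro: polyhedral_cone_polar polyhedral_cone_Int polyhedral_cone_sum)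

lemma subspace_eval_formula:
  fixes A :: "nat \<Rightarrow> (real^'d) set"
  shows "(\<And>i. i \<in> set (var_list F) \<Longrightarrow> subspace (A i)) \<Longrightarrow> subspace (eval_formula F A)"
  by (induction F) (auto simp: polar_subspace subspace_orthogonal_comp intro: subspace_inter subspace_plus)

lemma eval_formula_orthogonal_image:
  fixes f :: "real^'d \<Rightarrow> real^'d"
  assumes f: "orthogonal_transformation f"
  shows "eval_formula F (\<lambda>i. f ` A i) = f ` eval_formula F A"
proof (induction F)
  case (Neg F)
  then show ?case by (simp add: polar_orthogonal_image[OF f])
next
  case (And F G)
  then show ?case by (simp add: image_Int[OF orthogonal_transformation_inj[OF f]])
next
  case (Or F G)
  have "f ` X + f ` Y = f ` (X + Y)" for X Y
    using linear_add[OF orthogonal_transformation_linear[OF f]] by (force simp: set_plus_def image_def)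
  then show ?case using Or by simp
qed simp

lemma random_eval_formula:
  fixes A :: "nat \<Rightarrow> 'w \<Rightarrow> (real^'d) set"
  assumes "\<And>i. i \<in> set (var_list F) \<Longrightarrow> random_cone N (A i)"
    and "\<And>i w. i \<in> set (var_list F) \<Longrightarrow> w \<in> space N \<Longrightarrow> polyhedral_cone (A i w)"
  shows "random_cone N (\<lambda>w. eval_formula F (\<lambda>i. A i w))"
  using assms
proof (induction F)
  case (Neg F)
  then show ?case by (simp add: random_cone_polar)
next
  case (And F G)
  then show ?case by (simp add: random_cone_Int polyhedral_eval_formula)
next
  case (Or F G)
  then show ?case
    by (simp add: random_cone_sum polyhedral_cone_closed polyhedral_cone_sum polyhedral_eval_formula)
qed simp

section \<open>Finite sums over dimension vectors\<close>

lemma sum_PiE_union: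
  fixes f :: "('i \<Rightarrow> 'a) \<Rightarrow> real"
  assumes "V \<inter> W = {}"
  shows "(\<Sum>\<kappa>\<in>V \<union> W \<rightarrow>\<^sub>E S. f \<kappa>) = (\<Sum>\<kappa>1\<in>V \<rightarrow>\<^sub>E S. \<Sum>\<kappa>2\<in>W \<rightarrow>\<^sub>E S. f (merge V W (\<kappa>1, \<kappa>2)))"
proof -
  have "(\<Sum>\<kappa>\<in>V \<union> W \<rightarrow>\<^sub>E S. f \<kappa>) = (\<Sum>p\<in>(V \<rightarrow>\<^sub>E S) \<times> (W \<rightarrow>\<^sub>E S). f (merge V W p))"
  proof (rule sum.reindex_bij_witness[of _ "merge V W" "\<lambda>\<kappa>. (restrict \<kappa> V, restrict \<kappa> W)"])
    fix \<kappa> assume "\<kappa> \<in> V \<union> W \<rightarrow>\<^sub>E S"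
    then show m: "merge V W (restrict \<kappa> V, restrict \<kappa> W) = \<kappa>" "(restrict \<kappa> V, restrict \<kappa> W) \<in> (V \<rightarrow>\<^sub>E S) \<times> (W \<rightarrow>\<^sub>E S)"
      by (auto simp: merge_def PiE_iff extensional_def fun_eq_iff)
    show "f (merge V W (restrict \<kappa> V, restrict \<kappa> W)) = f \<kappa>" by (simp only: m(1))
  next
    fix p assume p: "p \<in> (V \<rightarrow>\<^sub>E S) \<times> (W \<rightarrow>\<^sub>E S)"
    show "(restrict (merge V W p) V, restrict (merge V W p) W) = p"
    proof (rule prod_eqI)
      show "fst (restrict (merge V W p) V, restrict (merge V W p) W) = fst p"
        using p by (cases p) (auto simp: merge_def PiE_iff extensional_def fun_eq_iff)
      show "snd (restrict (merge V W p) V, restrict (merge V W p) W) = snd p"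
        using p assms by (cases p) (auto simp: merge_def PiE_iff extensional_def fun_eq_iff disjoint_iff)
    qed
    show "merge V W p \<in> V \<union> W \<rightarrow>\<^sub>E S"
      using p by (cases p) (auto simp: merge_def PiE_iff extensional_def)
  qed
  then show ?thesis by (simp add: sum.cartesian_product case_prod_beta')
qed

text \<open>
  The law of \<open>a x + b y - d\<close> for independent \<open>x\<close> and \<open>y\<close>, in terms of the laws of \<open>a x\<close> and \<open>b y\<close>.
\<close>

lemma convolve_dimensions:
  fixes \<alpha> \<beta> :: "nat \<Rightarrow> real"
  assumes fin: "finite S" "finite T"
    and \<alpha>: "\<And>i. i \<le> d \<Longrightarrow> \<alpha> i = (\<Sum>x\<in>S. if a x = i then v x else 0)"
    and \<beta>: "\<And>j. j \<le> d \<Longrightarrow> \<beta> j = (\<Sum>y\<in>T. if b y = j then w y else 0)"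
    and le: "\<And>x. x \<in> S \<Longrightarrow> a x \<le> d" "\<And>y. y \<in> T \<Longrightarrow> b y \<le> d"
  shows "(\<Sum>(i, j) | i \<le> d \<and> j \<le> d \<and> i + j - d = k. \<alpha> i * \<beta> j)
    = (\<Sum>x\<in>S. \<Sum>y\<in>T. if a x + b y - d = k then v x * w y else 0)"
proof -
  let ?X = "{(i, j). i \<le> d \<and> j \<le> d \<and> i + j - d = k}"
  have finX: "finite ?X" by (rule finite_subset[of _ "{..d} \<times> {..d}"]) auto
  have "(\<Sum>(i, j)\<in>?X. \<alpha> i * \<beta> j)
    = (\<Sum>p\<in>?X. \<Sum>x\<in>S. \<Sum>y\<in>T. if p = (a x, b y) then v x * w y else 0)"
  proof (intro sum.cong refl)
    fix p assume "p \<in> ?X"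
    then obtain i j where p: "p = (i, j)" "i \<le> d" "j \<le> d" by auto
    have "\<alpha> i * \<beta> j = (\<Sum>x\<in>S. \<Sum>y\<in>T. (if a x = i then v x else 0) * (if b y = j then w y else 0))"
      unfolding \<alpha>[OF p(2)] \<beta>[OF p(3)] by (rule sum_product)
    also have "\<dots> = (\<Sum>x\<in>S. \<Sum>y\<in>T. if p = (a x, b y) then v x * w y else 0)"
      by (intro sum.cong refl) (auto simp: p(1))
    finally show "(case p of (i, j) \<Rightarrow> \<alpha> i * \<beta> j) = (\<Sum>x\<in>S. \<Sum>y\<in>T. if p = (a x, b y) then v x * w y else 0)"
      by (simp add: p(1))
  qed
  also have "\<dots> = (\<Sum>x\<in>S. \<Sum>p\<in>?X. \<Sum>y\<in>T. if p = (a x, b y) then v x * w y else 0)"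
    by (rule sum.swap)
  also have "\<dots> = (\<Sum>x\<in>S. \<Sum>y\<in>T. \<Sum>p\<in>?X. if p = (a x, b y) then v x * w y else 0)"
    by (intro sum.cong refl sum.swap)
  also have "\<dots> = (\<Sum>x\<in>S. \<Sum>y\<in>T. if a x + b y - d = k then v x * w y else 0)"
    using le finX by (intro sum.cong refl) auto
  finally show ?thesis .
qed

section \<open>Independent rotations\<close>

locale haar_family =
  fixes H :: "nat \<Rightarrow> (real^'d^'d) measure"
  assumes haar_H: "\<And>i. normalized_haar (H i)"
begin

sublocale product_prob_space H I for I
  using normalized_haarD(1)[OF haar_H]
  by (simp add: product_prob_space_def product_prob_space_axioms_def product_sigma_finite_def prob_space_imp_sigma_finite)

lemma prob_space_family: "prob_space (PiM I H)"
  by (intro prob_space_PiM normalized_haarD(1)[OF haar_H])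

lemma orthogonal_family: "Q \<in> space (PiM I H) \<Longrightarrow> i \<in> I \<Longrightarrow> orthogonal_matrix (Q i)"
  using normalized_haarD(3)[OF haar_H] by (auto simp: space_PiM PiE_iff)

lemma measurable_family: "i \<in> I \<Longrightarrow> (\<lambda>Q. Q i) \<in> borel_measurable (PiM I H)"
  by (rule measurable_compose[OF measurable_component_singleton[where M=H] measurable_haar_borel[OF haar_H]])

lemma distr_family_rotate:
  assumes I: "finite I" and U: "orthogonal_matrix U"
  shows "distr (PiM I H) (PiM I H) (compose I ((**) U)) = PiM I H"
proof -
  have "distr (PiM I H) (PiM I H) (compose I ((**) U)) = PiM I (\<lambda>i. distr (H i) (H i) ((**) U))"
    by (rule distr_PiM_finite_prob_space'[OF I])
      (auto intro: normalized_haarD(1)[OF haar_H] measurable_haar_ops(1)[OF haar_H U])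
  then show ?thesis using normalized_haarD(4)[OF haar_H U] by simp
qed

abbreviation rotated :: "(nat \<Rightarrow> (real^'d) set) \<Rightarrow> (nat \<Rightarrow> real^'d^'d) \<Rightarrow> nat \<Rightarrow> (real^'d) set" where
  "rotated C Q \<equiv> \<lambda>i. (*v) (Q i) ` C i"

lemma polyhedral_rotated:
  assumes "\<And>i. i \<in> set (var_list F) \<Longrightarrow> polyhedral_cone (C i)" "set (var_list F) \<subseteq> I" "Q \<in> space (PiM I H)"
  shows "polyhedral_cone (eval_formula F (rotated C Q))"
  using assms orthogonal_family[OF assms(3)]
  by (intro polyhedral_eval_formula polyhedral_cone_orthogonal_image)
    (auto simp only: orthogonal_matrix_transformation[symmetric])

lemma random_rotated:
  assumes C: "\<And>i. i \<in> set (var_list F) \<Longrightarrow> polyhedral_cone (C i)" and I: "set (var_list F) \<subseteq> I"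
  shows "random_cone (PiM I H) (\<lambda>Q. eval_formula F (rotated C Q))"
proof (rule random_eval_formula)
  fix i assume i: "i \<in> set (var_list F)"
  then have iI: "i \<in> I" using I by auto
  show "random_cone (PiM I H) (\<lambda>Q. (*v) (Q i) ` C i)"
    using orthogonal_family[OF _ iI] C[OF i]
    by (intro random_cone_rotate random_cone_const polyhedral_cone_closed measurable_family iI) auto
  fix Q assume "Q \<in> space (PiM I H)"
  then show "polyhedral_cone ((*v) (Q i) ` C i)"
    using orthogonal_family[OF _ iI] C[OF i]
    by (intro polyhedral_cone_orthogonal_image) (auto simp only: orthogonal_matrix_transformation[symmetric])
qed

text \<open>
  A further uniform rotation \<open>U\<close> of all the coordinates in \<open>W\<close> leaves their joint law unchanged and
  replaces \<open>B\<close> by \<open>U B\<close>. For fixed coordinates the mean over \<open>U\<close> is given by the kinematic formula.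
\<close>

lemma kinematic_independent:
  fixes A B :: "(nat \<Rightarrow> real^'d^'d) \<Rightarrow> (real^'d) set"
  assumes V: "finite V" and W: "finite W" and disj: "V \<inter> W = {}" and k: "k \<le> CARD('d)"
    and A: "random_cone (PiM V H) A" "\<And>Q. Q \<in> space (PiM V H) \<Longrightarrow> polyhedral_cone (A Q)"
    and B: "random_cone (PiM W H) B" "\<And>Q. Q \<in> space (PiM W H) \<Longrightarrow> polyhedral_cone (B Q)"
    and AB: "\<And>Q Q'. (\<And>i. i \<in> V \<Longrightarrow> Q i = Q' i) \<Longrightarrow> A Q = A Q'" "\<And>Q Q'. (\<And>i. i \<in> W \<Longrightarrow> Q i = Q' i) \<Longrightarrow> B Q = B Q'"
    and rot: "\<And>U Q. orthogonal_matrix U \<Longrightarrow> B (\<lambda>i. U ** Q i) = (*v) U ` B Q"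
  shows "(\<integral>Q. intrinsic_volume k (A Q \<inter> B Q) \<partial>PiM (V \<union> W) H)
    = (\<Sum>(i, j) | i \<le> CARD('d) \<and> j \<le> CARD('d) \<and> i + j - CARD('d) = k.
        (\<integral>Q. intrinsic_volume i (A Q) \<partial>PiM V H) * (\<integral>Q. intrinsic_volume j (B Q) \<partial>PiM W H))"
proof -
  interpret U: haar "H 0" by unfold_locales (rule haar_H)
  interpret UW: pair_prob_space "H 0" "PiM W H"
    by (simp add: pair_prob_space_def pair_sigma_finite_def prob_space_imp_sigma_finite prob_space_family normalized_haarD(1)[OF haar_H])
  have mV: "(\<lambda>Q. restrict Q V) \<in> measurable (PiM (V \<union> W) H) (PiM V H)" by (rule measurable_restrict_subset) auto
  have mW: "(\<lambda>Q. restrict Q W) \<in> measurable (PiM (V \<union> W) H) (PiM W H)" by (rule measurable_restrict_subset) auto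
  have rA: "A (restrict Q V) = A Q" for Q by (rule AB) simp
  have rB: "B (restrict Q W) = B Q" for Q by (rule AB) simp
  have "random_cone (PiM (V \<union> W) H) (\<lambda>Q. A (restrict Q V) \<inter> B (restrict Q W))"
    using measurable_space[OF mV] measurable_space[OF mW]
    by (intro random_cone_Int random_cone_reparam[OF A(1) mV] random_cone_reparam[OF B(1) mW] A(2) B(2)) auto
  moreover have "polyhedral_cone (A (restrict Q V) \<inter> B (restrict Q W))" if "Q \<in> space (PiM (V \<union> W) H)" for Q
    using measurable_space[OF mV that] measurable_space[OF mW that] by (intro polyhedral_cone_Int A(2) B(2)) auto
  ultimately have int: "integrable (PiM (V \<union> W) H) (\<lambda>Q. intrinsic_volume k (A Q \<inter> B Q))"
    using intrinsic_volume_integrable[OF prob_space_family] unfolding rA rB by blast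
  have inner: "(\<integral>y. intrinsic_volume k (A x \<inter> B y) \<partial>PiM W H)
    = (\<Sum>(i, j) | i \<le> CARD('d) \<and> j \<le> CARD('d) \<and> i + j - CARD('d) = k.
        intrinsic_volume i (A x) * (\<integral>y. intrinsic_volume j (B y) \<partial>PiM W H))" (is "?L = ?R")
    if x: "x \<in> space (PiM V H)" for x
  proof -
    have rot1: "(\<integral>y. intrinsic_volume k (A x \<inter> (*v) U ` B y) \<partial>PiM W H) = ?L" if U: "orthogonal_matrix U" for U
    proof -
      have rI: "random_cone (PiM W H) (\<lambda>y. A x \<inter> B y)"
        by (intro random_cone_Int random_cone_const polyhedral_cone_closed A(2)[OF x] B)
      have m: "(\<lambda>y. intrinsic_volume k (A x \<inter> B y)) \<in> borel_measurable (PiM W H)"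
        by (intro measurable_intrinsic_volume rI polyhedral_cone_Int A(2)[OF x] B(2))
      have BU: "B (compose W ((**) U) y) = (*v) U ` B y" for y
      proof -
        have "B (compose W ((**) U) y) = B (\<lambda>i. U ** y i)" by (rule AB) (simp add: compose_def)
        then show ?thesis by (simp only: rot[OF U])
      qed
      have mc: "compose W ((**) U) \<in> measurable (PiM W H) (PiM W H)"
        unfolding compose_def
        by (intro measurable_restrict measurable_compose[OF measurable_component_singleton[where M=H] measurable_haar_ops(1)[OF haar_H U]])
      have "?L = (\<integral>y. intrinsic_volume k (A x \<inter> B y) \<partial>distr (PiM W H) (PiM W H) (compose W ((**) U)))"
        by (simp only: distr_family_rotate[OF W U])
      also have "\<dots> = (\<integral>y. intrinsic_volume k (A x \<inter> B (compose W ((**) U) y)) \<partial>PiM W H)"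
        by (rule integral_distr[OF mc m])
      also have "\<dots> = (\<integral>y. intrinsic_volume k (A x \<inter> (*v) U ` B y) \<partial>PiM W H)"
        by (simp only: BU)
      finally show ?thesis by (rule sym)
    qed
    have rUW: "random_cone (H 0 \<Otimes>\<^sub>M PiM W H) (\<lambda>p. A x \<inter> (*v) (fst p) ` B (snd p))"
      and pUW: "\<And>p. p \<in> space (H 0 \<Otimes>\<^sub>M PiM W H) \<Longrightarrow> polyhedral_cone (A x \<inter> (*v) (fst p) ` B (snd p))"
    proof -
      have o: "orthogonal_matrix (fst p)" "polyhedral_cone (B (snd p))" if "p \<in> space (H 0 \<Otimes>\<^sub>M PiM W H)" for p
        using that B(2) by (auto simp: space_pair_measure U.space_H)
      have p: "polyhedral_cone ((*v) (fst p) ` B (snd p))" if "p \<in> space (H 0 \<Otimes>\<^sub>M PiM W H)" for p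
        by (intro U.polyhedral_rotate o that)
      show "random_cone (H 0 \<Otimes>\<^sub>M PiM W H) (\<lambda>p. A x \<inter> (*v) (fst p) ` B (snd p))"
        by (intro random_cone_Int random_cone_const random_cone_rotate random_cone_reparam[OF B(1) measurable_snd]
          polyhedral_cone_closed A(2)[OF x] measurable_compose[OF measurable_fst measurable_haar_borel[OF haar_H]] o p)
      show "\<And>p. p \<in> space (H 0 \<Otimes>\<^sub>M PiM W H) \<Longrightarrow> polyhedral_cone (A x \<inter> (*v) (fst p) ` B (snd p))"
        by (intro polyhedral_cone_Int A(2)[OF x] p)
    qed
    have "integrable (H 0 \<Otimes>\<^sub>M PiM W H) (\<lambda>p. intrinsic_volume k (A x \<inter> (*v) (fst p) ` B (snd p)))"
      by (intro intrinsic_volume_integrable rUW pUW UW.prob_space_axioms)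
    then have iUW: "integrable (H 0 \<Otimes>\<^sub>M PiM W H) (\<lambda>(u, y). intrinsic_volume k (A x \<inter> (*v) u ` B y))"
      by (simp add: case_prod_beta')
    have "?L = (\<integral>u. ?L \<partial>H 0)" using prob_space.prob_space[OF normalized_haarD(1)[OF haar_H[of 0]]] by simp
    also have "\<dots> = (\<integral>u. (\<integral>y. intrinsic_volume k (A x \<inter> (*v) u ` B y) \<partial>PiM W H) \<partial>H 0)"
      by (intro Bochner_Integration.integral_cong refl rot1[symmetric]) (simp add: U.space_H)
    also have "\<dots> = (\<integral>y. (\<integral>u. intrinsic_volume k (A x \<inter> (*v) u ` B y) \<partial>H 0) \<partial>PiM W H)"
      using UW.Fubini_integral[OF iUW] by simp
    also have "\<dots> = (\<integral>y. (\<Sum>(i, j) | i \<le> CARD('d) \<and> j \<le> CARD('d) \<and> i + j - CARD('d) = k.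
        intrinsic_volume i (A x) * intrinsic_volume j (B y)) \<partial>PiM W H)"
      by (intro Bochner_Integration.integral_cong refl U.kinematic_formula A(2)[OF x] B(2) k)
    also have "\<dots> = ?R"
      using intrinsic_volume_integrable[OF prob_space_family B]
      unfolding case_prod_beta' by (subst Bochner_Integration.integral_sum) auto
    finally show ?thesis .
  qed
  have "(\<integral>Q. intrinsic_volume k (A Q \<inter> B Q) \<partial>PiM (V \<union> W) H)
    = (\<integral>x. (\<integral>y. intrinsic_volume k (A (merge V W (x, y)) \<inter> B (merge V W (x, y))) \<partial>PiM W H) \<partial>PiM V H)"
    by (rule product_integral_fold[OF disj V W int])
  also have "\<dots> = (\<integral>x. (\<integral>y. intrinsic_volume k (A x \<inter> B y) \<partial>PiM W H) \<partial>PiM V H)"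
  proof -
    have "A (merge V W (x, y)) = A x" "B (merge V W (x, y)) = B y" for x y
      using disj by (auto intro!: AB simp: merge_def)
    then show ?thesis by simp
  qed
  also have "\<dots> = (\<integral>x. (\<Sum>(i, j) | i \<le> CARD('d) \<and> j \<le> CARD('d) \<and> i + j - CARD('d) = k.
        intrinsic_volume i (A x) * (\<integral>y. intrinsic_volume j (B y) \<partial>PiM W H)) \<partial>PiM V H)"
    by (intro Bochner_Integration.integral_cong refl inner)
  also have "\<dots> = (\<Sum>(i, j) | i \<le> CARD('d) \<and> j \<le> CARD('d) \<and> i + j - CARD('d) = k.
        (\<integral>x. intrinsic_volume i (A x) \<partial>PiM V H) * (\<integral>y. intrinsic_volume j (B y) \<partial>PiM W H))"
    using intrinsic_volume_integrable[OF prob_space_family A]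
    unfolding case_prod_beta' by (subst Bochner_Integration.integral_sum) auto
  finally show ?thesis .
qed

abbreviation mean_volume :: "(nat \<Rightarrow> (real^'d) set) \<Rightarrow> formula \<Rightarrow> nat set \<Rightarrow> nat \<Rightarrow> real" where
  "mean_volume C F I k \<equiv> \<integral>Q. intrinsic_volume k (eval_formula F (rotated C Q)) \<partial>PiM I H"

abbreviation dim_sum :: "(nat \<Rightarrow> (real^'d) set) \<Rightarrow> formula \<Rightarrow> nat set \<Rightarrow> nat \<Rightarrow> real" where
  "dim_sum C F I k \<equiv> \<Sum>\<kappa>\<in>I \<rightarrow>\<^sub>E {..CARD('d)}.
     if formula_dim (CARD('d)) F \<kappa> = k then \<Prod>i\<in>I. intrinsic_volume (\<kappa> i) (C i) else 0"

text \<open>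
  The index set \<open>I\<close> is left free, so that the induction can split it between the two parts of a conjunction.
  Indices outside the formula contribute the factor \<open>1\<close>, the total intrinsic volume of a cone.
\<close>

definition expected_in :: "(nat \<Rightarrow> (real^'d) set) \<Rightarrow> formula \<Rightarrow> bool" where
  "expected_in C F \<longleftrightarrow> (\<forall>I k. finite I \<longrightarrow> (\<forall>i\<in>I. polyhedral_cone (C i)) \<longrightarrow> set (var_list F) \<subseteq> I \<longrightarrow> k \<le> CARD('d) \<longrightarrow>
    mean_volume C F I k = dim_sum C F I k)"

lemma expected_inI:
  assumes "\<And>I k. finite I \<Longrightarrow> (\<And>i. i \<in> I \<Longrightarrow> polyhedral_cone (C i)) \<Longrightarrow> set (var_list F) \<subseteq> I \<Longrightarrow> k \<le> CARD('d) \<Longrightarrow>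
    mean_volume C F I k = dim_sum C F I k"
  shows "expected_in C F"
  unfolding expected_in_def using assms by blast

lemma expected_in_Var: "expected_in C (Var l)"
proof (rule expected_inI)
  fix I k assume prems: "finite I" "\<And>i. i \<in> I \<Longrightarrow> polyhedral_cone (C i)" "set (var_list (Var l)) \<subseteq> I" "k \<le> CARD('d)"
  have l: "l \<in> I" using prems(3) by auto
  have "mean_volume C (Var l) I k = (\<integral>Q. intrinsic_volume k (C l) \<partial>PiM I H)"
    using orthogonal_family[OF _ l] prems(2)[OF l]
    by (intro Bochner_Integration.integral_cong refl) (simp add: intrinsic_volume_orthogonal_image orthogonal_matrix_transformation[symmetric])
  also have "\<dots> = intrinsic_volume k (C l)" using prob_space.prob_space[OF prob_space_family] by simp
  also have "\<dots> = (\<Prod>i\<in>I. \<Sum>m\<le>CARD('d). if i = l \<and> m \<noteq> k then 0 else intrinsic_volume m (C i))"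
  proof -
    have "(\<Prod>i\<in>I. \<Sum>m\<le>CARD('d). if i = l \<and> m \<noteq> k then 0 else intrinsic_volume m (C i))
      = (\<Prod>i\<in>I. if i = l then intrinsic_volume k (C l) else 1)"
    proof (intro prod.cong refl)
      fix i assume i: "i \<in> I"
      show "(\<Sum>m\<le>CARD('d). if i = l \<and> m \<noteq> k then 0 else intrinsic_volume m (C i)) = (if i = l then intrinsic_volume k (C l) else 1)"
      proof (cases "i = l")
        case True
        have "(\<Sum>m\<le>CARD('d). if i = l \<and> m \<noteq> k then 0 else intrinsic_volume m (C i))
          = (\<Sum>m\<le>CARD('d). if m = k then intrinsic_volume k (C l) else 0)"
          by (intro sum.cong refl) (simp add: True)
        then show ?thesis using prems(4) by (simp add: True)
      qed (use sum_intrinsic_volume_1[OF prems(2)[OF i]] in simp)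
    qed
    then show ?thesis using l prems(1) by simp
  qed
  also have "\<dots> = (\<Sum>\<kappa>\<in>I \<rightarrow>\<^sub>E {..CARD('d)}. \<Prod>i\<in>I. if i = l \<and> \<kappa> i \<noteq> k then 0 else intrinsic_volume (\<kappa> i) (C i))"
    by (rule prod_sum_PiE) (use prems(1) in auto)
  also have "\<dots> = dim_sum C (Var l) I k"
  proof (intro sum.cong refl)
    fix \<kappa> :: "nat \<Rightarrow> nat"
    show "(\<Prod>i\<in>I. if i = l \<and> \<kappa> i \<noteq> k then 0 else intrinsic_volume (\<kappa> i) (C i))
       = (if formula_dim (CARD('d)) (Var l) \<kappa> = k then \<Prod>i\<in>I. intrinsic_volume (\<kappa> i) (C i) else 0)"
    proof (cases "\<kappa> l = k")
      case False
      then show ?thesis using l prems(1) by (auto intro!: prod_zero bexI[of _ l])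
    qed (auto intro!: prod.cong)
  qed
  finally show "mean_volume C (Var l) I k = dim_sum C (Var l) I k" .
qed

lemma expected_in_Neg:
  assumes F: "expected_in C F"
  shows "expected_in C (Neg F)"
proof (rule expected_inI)
  fix I k assume prems: "finite I" "\<And>i. i \<in> I \<Longrightarrow> polyhedral_cone (C i)" "set (var_list (Neg F)) \<subseteq> I" "k \<le> CARD('d)"
  have "mean_volume C (Neg F) I k
    = (\<integral>Q. intrinsic_volume (CARD('d) - k) (eval_formula F (rotated C Q)) \<partial>PiM I H)"
    using polyhedral_rotated[of F C I] prems
    by (intro Bochner_Integration.integral_cong refl) (auto intro!: intrinsic_volume_polar)
  also have "\<dots> = (\<Sum>\<kappa>\<in>I \<rightarrow>\<^sub>E {..CARD('d)}. if formula_dim (CARD('d)) F \<kappa> = CARD('d) - k then \<Prod>i\<in>I. intrinsic_volume (\<kappa> i) (C i) else 0)"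
    using prems F unfolding expected_in_def by auto
  also have "\<dots> = dim_sum C (Neg F) I k"
  proof (intro sum.cong refl if_cong)
    fix \<kappa> :: "nat \<Rightarrow> nat" assume "\<kappa> \<in> I \<rightarrow>\<^sub>E {..CARD('d)}"
    then have "formula_dim (CARD('d)) F \<kappa> \<le> CARD('d)" using prems(3) by (intro formula_dim_le) (auto simp: PiE_iff)
    then show "formula_dim (CARD('d)) F \<kappa> = CARD('d) - k \<longleftrightarrow> formula_dim (CARD('d)) (Neg F) \<kappa> = k"
      using prems(4) by auto
  qed
  finally show "mean_volume C (Neg F) I k = dim_sum C (Neg F) I k" .
qed

text \<open>
  The parts depend on disjoint sets of independent rotations, and \<open>formula_dim\<close> of the conjunction is the
  dimension that the kinematic formula assigns to a pair of dimensions.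
\<close>

lemma expected_in_And:
  assumes F: "expected_in C F" and G: "expected_in C G" and disj0: "set (var_list F) \<inter> set (var_list G) = {}"
  shows "expected_in C (And F G)"
proof (rule expected_inI)
  fix I k assume prems: "finite I" "\<And>i. i \<in> I \<Longrightarrow> polyhedral_cone (C i)" "set (var_list (And F G)) \<subseteq> I" "k \<le> CARD('d)"
  define V where "V = set (var_list F)"
  \<comment> \<open>The second part takes the indices outside the formula as well, so that the two sets cover \<open>I\<close>.\<close>
  define W where "W = I - V"
  have vars: "set (var_list F) \<subseteq> V" "set (var_list G) \<subseteq> W" and disj: "V \<inter> W = {}" and I: "I = V \<union> W"
    and fin: "finite V" "finite W"
    using prems disj0 by (auto simp: V_def W_def)
  have pF: "polyhedral_cone (C i)" if "i \<in> V" for i using that prems I by auto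
  have pG: "polyhedral_cone (C i)" if "i \<in> W" for i using that prems I by auto
  have "(\<integral>Q. intrinsic_volume k (eval_formula F (rotated C Q) \<inter> eval_formula G (rotated C Q)) \<partial>PiM (V \<union> W) H)
    = (\<Sum>(i, j) | i \<le> CARD('d) \<and> j \<le> CARD('d) \<and> i + j - CARD('d) = k.
        (\<integral>Q. intrinsic_volume i (eval_formula F (rotated C Q)) \<partial>PiM V H) * (\<integral>Q. intrinsic_volume j (eval_formula G (rotated C Q)) \<partial>PiM W H))"
  proof (rule kinematic_independent[OF fin disj prems(4)])
    show "random_cone (PiM V H) (\<lambda>Q. eval_formula F (rotated C Q))" "random_cone (PiM W H) (\<lambda>Q. eval_formula G (rotated C Q))"
      using vars pF pG by (auto intro!: random_rotated)
    show "polyhedral_cone (eval_formula F (rotated C Q))" if "Q \<in> space (PiM V H)" for Q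
      using polyhedral_rotated[OF _ vars(1) that] vars pF by auto
    show "polyhedral_cone (eval_formula G (rotated C Q))" if "Q \<in> space (PiM W H)" for Q
      using polyhedral_rotated[OF _ vars(2) that] vars pG by auto
    show "eval_formula F (rotated C Q) = eval_formula F (rotated C Q')" if "\<And>i. i \<in> V \<Longrightarrow> Q i = Q' i" for Q Q'
      using vars that by (intro eval_formula_cong) auto
    show "eval_formula G (rotated C Q) = eval_formula G (rotated C Q')" if "\<And>i. i \<in> W \<Longrightarrow> Q i = Q' i" for Q Q'
      using vars that by (intro eval_formula_cong) (metis subsetD)
    show "eval_formula G (rotated C (\<lambda>i. U ** Q i)) = (*v) U ` eval_formula G (rotated C Q)" if "orthogonal_matrix U" for U Q
    proof -
      have "orthogonal_transformation ((*v) U)" using that by (simp only: orthogonal_matrix_transformation)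
      from eval_formula_orthogonal_image[OF this, of G "rotated C Q"]
      show ?thesis by (simp add: image_image matrix_vector_mul_assoc)
    qed
  qed
  also have "\<dots> = (\<Sum>\<kappa>1\<in>V \<rightarrow>\<^sub>E {..CARD('d)}. \<Sum>\<kappa>2\<in>W \<rightarrow>\<^sub>E {..CARD('d)}.
     if formula_dim (CARD('d)) F \<kappa>1 + formula_dim (CARD('d)) G \<kappa>2 - CARD('d) = k
     then (\<Prod>i\<in>V. intrinsic_volume (\<kappa>1 i) (C i)) * (\<Prod>i\<in>W. intrinsic_volume (\<kappa>2 i) (C i)) else 0)"
  proof (rule convolve_dimensions)
    show "finite (V \<rightarrow>\<^sub>E {..CARD('d)})" "finite (W \<rightarrow>\<^sub>E {..CARD('d)})" using fin by (auto intro!: finite_PiE)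
    show "formula_dim (CARD('d)) F \<kappa> \<le> CARD('d)" if "\<kappa> \<in> V \<rightarrow>\<^sub>E {..CARD('d)}" for \<kappa>
      using that vars by (intro formula_dim_le) (auto simp: PiE_iff)
    show "formula_dim (CARD('d)) G \<kappa> \<le> CARD('d)" if "\<kappa> \<in> W \<rightarrow>\<^sub>E {..CARD('d)}" for \<kappa>
      using that vars by (intro formula_dim_le) (auto simp: PiE_iff)
  qed (use F[unfolded expected_in_def, rule_format, OF fin(1) pF vars(1)] G[unfolded expected_in_def, rule_format, OF fin(2) pG vars(2)] in auto)
  also have "\<dots> = (\<Sum>\<kappa>1\<in>V \<rightarrow>\<^sub>E {..CARD('d)}. \<Sum>\<kappa>2\<in>W \<rightarrow>\<^sub>E {..CARD('d)}.
     if formula_dim (CARD('d)) (And F G) (merge V W (\<kappa>1, \<kappa>2)) = k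
     then \<Prod>i\<in>I. intrinsic_volume (merge V W (\<kappa>1, \<kappa>2) i) (C i) else 0)"
  proof (intro sum.cong refl if_cong)
    fix \<kappa>1 \<kappa>2 :: "nat \<Rightarrow> nat"
    have m: "merge V W (\<kappa>1, \<kappa>2) i = \<kappa>1 i" if "i \<in> V" for i using that by (simp add: merge_def)
    have m': "merge V W (\<kappa>1, \<kappa>2) i = \<kappa>2 i" if "i \<in> W" for i using that disj by (auto simp: merge_def)
    have "formula_dim (CARD('d)) F (merge V W (\<kappa>1, \<kappa>2)) = formula_dim (CARD('d)) F \<kappa>1"
      "formula_dim (CARD('d)) G (merge V W (\<kappa>1, \<kappa>2)) = formula_dim (CARD('d)) G \<kappa>2"
      using vars m m' by (auto intro!: formula_dim_cong)
    then show "formula_dim (CARD('d)) F \<kappa>1 + formula_dim (CARD('d)) G \<kappa>2 - CARD('d) = k \<longleftrightarrow>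
       formula_dim (CARD('d)) (And F G) (merge V W (\<kappa>1, \<kappa>2)) = k" by simp
    show "(\<Prod>i\<in>V. intrinsic_volume (\<kappa>1 i) (C i)) * (\<Prod>i\<in>W. intrinsic_volume (\<kappa>2 i) (C i))
      = (\<Prod>i\<in>I. intrinsic_volume (merge V W (\<kappa>1, \<kappa>2) i) (C i))"
      unfolding I using fin disj m m' by (simp add: prod.union_disjoint)
  qed
  also have "\<dots> = (\<Sum>\<kappa>\<in>V \<union> W \<rightarrow>\<^sub>E {..CARD('d)}. if formula_dim (CARD('d)) (And F G) \<kappa> = k then \<Prod>i\<in>I. intrinsic_volume (\<kappa> i) (C i) else 0)"
    by (rule sum_PiE_union[OF disj, symmetric])
  finally show "mean_volume C (And F G) I k = dim_sum C (And F G) I k" by (simp add: I)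
qed

text \<open>
  De Morgan's law for polyhedral cones, \<open>C + D\<close> being the polar of the intersection of the polars. The
  recursion for the generic dimension obeys the same law.
\<close>

lemma expected_in_Or:
  assumes F: "expected_in C F" and G: "expected_in C G" and disj0: "set (var_list F) \<inter> set (var_list G) = {}"
  shows "expected_in C (Or F G)"
proof (rule expected_inI)
  fix I k assume prems: "finite I" "\<And>i. i \<in> I \<Longrightarrow> polyhedral_cone (C i)" "set (var_list (Or F G)) \<subseteq> I" "k \<le> CARD('d)"
  let ?F = "Neg (And (Neg F) (Neg G))"
  have "expected_in C ?F"
    using disj0 by (intro expected_in_Neg expected_in_And F G) simp
  then have "mean_volume C ?F I k = dim_sum C ?F I k"
    unfolding expected_in_def using prems by auto
  also have "mean_volume C ?F I k
    = mean_volume C (Or F G) I k"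
  proof (intro Bochner_Integration.integral_cong refl)
    fix Q assume Q: "Q \<in> space (PiM I H)"
    have P: "polyhedral_cone (eval_formula F (rotated C Q))" "polyhedral_cone (eval_formula G (rotated C Q))"
      using prems by (auto intro!: polyhedral_rotated[OF _ _ Q])
    have "eval_formula ?F (rotated C Q) = eval_formula (Or F G) (rotated C Q)"
      using P by (simp add: polar_Int polyhedral_cone_polar polar_polar polyhedral_cone_closed)
    then show "intrinsic_volume k (eval_formula ?F (rotated C Q)) = intrinsic_volume k (eval_formula (Or F G) (rotated C Q))"
      by (simp only:)
  qed
  also have "dim_sum C ?F I k
    = dim_sum C (Or F G) I k"
  proof (intro sum.cong refl if_cong)
    fix \<kappa> :: "nat \<Rightarrow> nat" assume \<kappa>: "\<kappa> \<in> I \<rightarrow>\<^sub>E {..CARD('d)}"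
    have "formula_dim (CARD('d)) F \<kappa> \<le> CARD('d)" "formula_dim (CARD('d)) G \<kappa> \<le> CARD('d)"
      using \<kappa> prems(3) by (auto intro!: formula_dim_le simp: PiE_iff)
    then show "formula_dim (CARD('d)) ?F \<kappa> = k \<longleftrightarrow> formula_dim (CARD('d)) (Or F G) \<kappa> = k"
      by auto
  qed
  finally show "mean_volume C (Or F G) I k = dim_sum C (Or F G) I k" .
qed

lemma expected_in_read_once:
  assumes "read_once F"
  shows "expected_in C F"
  using assms unfolding read_once_def
  by (induction F) (simp_all add: expected_in_Var expected_in_Neg expected_in_And expected_in_Or)

end

section \<open>The generic dimension\<close>

text \<open>
  For a subspace, \<open>v\<^sub>k\<close> is the indicator of dimension \<open>k\<close>. If each variable has the fixed dimension
  \<open>\<kappa> i\<close>, the expectation formula has a single term, and it says that the value of the formula has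
  dimension \<open>formula_dim\<close> with probability \<open>1\<close>. Given one Haar measure, no other number can have
  this property, since there are subspaces of all the dimensions \<open>\<kappa> i\<close>.
\<close>

lemma generic_dim_eq:
  fixes H0 :: "(real^'d^'d) measure"
  assumes H0: "normalized_haar H0" and F: "set (var_list F) \<subseteq> {..n}" "read_once F"
    and \<kappa>: "\<And>i. i \<le> n \<Longrightarrow> \<kappa> i \<le> CARD('d)"
  shows "generic_dim TYPE('d) F n \<kappa> = formula_dim (CARD('d)) F \<kappa>"
proof -
  let ?m = "formula_dim (CARD('d)) F \<kappa>"
  have AE: "AE Q in PiM {..n} (\<lambda>_. H). dim (eval_formula F (\<lambda>i. (*v) (Q i) ` L i)) = ?m"
    if H: "normalized_haar H" and L: "\<And>i. i \<le> n \<Longrightarrow> subspace (L i) \<and> dim (L i) = \<kappa> i"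
    for H :: "(real^'d^'d) measure" and L :: "nat \<Rightarrow> (real^'d) set"
  proof -
    interpret haar_family "\<lambda>_. H" by unfold_locales (rule H)
    let ?N = "PiM {..n} (\<lambda>_ :: nat. H)"
    let ?E = "\<lambda>Q. eval_formula F (rotated L Q)"
    have sub: "subspace (L i)" if "i \<in> {..n}" for i using L that by auto
    have pol: "polyhedral_cone (L i)" if "i \<in> {..n}" for i by (rule polyhedral_cone_subspace) (rule sub[OF that])
    have m: "?m \<le> CARD('d)" using F \<kappa> by (intro formula_dim_le) auto
    have ve: "intrinsic_volume k (?E Q) = (if k = dim (?E Q) then 1 else 0)" for Q k
      using F sub by (intro intrinsic_volume_subspace subspace_eval_formula subspace_rotated) auto
    have "(\<integral>Q. intrinsic_volume ?m (?E Q) \<partial>?N)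
      = (\<Sum>\<kappa>'\<in>{..n} \<rightarrow>\<^sub>E {..CARD('d)}. if formula_dim (CARD('d)) F \<kappa>' = ?m then \<Prod>i\<in>{..n}. intrinsic_volume (\<kappa>' i) (L i) else 0)"
      using expected_in_read_once[OF F(2), of L] m F(1) pol unfolding expected_in_def by simp
    also have "\<dots> = (\<Sum>\<kappa>'\<in>{..n} \<rightarrow>\<^sub>E {..CARD('d)}. if \<kappa>' = restrict \<kappa> {..n} then 1 else 0)"
    proof (intro sum.cong refl)
      fix \<kappa>' assume \<kappa>': "\<kappa>' \<in> {..n} \<rightarrow>\<^sub>E {..CARD('d)}"
      have v: "intrinsic_volume (\<kappa>' i) (L i) = (if \<kappa>' i = \<kappa> i then 1 else 0)" if "i \<le> n" for i
        using L[OF that] by (simp add: intrinsic_volume_subspace)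
      show "(if formula_dim (CARD('d)) F \<kappa>' = ?m then \<Prod>i\<in>{..n}. intrinsic_volume (\<kappa>' i) (L i) else 0)
        = (if \<kappa>' = restrict \<kappa> {..n} then 1 else 0)"
      proof (cases "\<kappa>' = restrict \<kappa> {..n}")
        case True
        then have "\<kappa>' i = \<kappa> i" if "i \<le> n" for i using that by simp
        moreover from this have "formula_dim (CARD('d)) F \<kappa>' = ?m" using F(1) by (intro formula_dim_cong) auto
        ultimately show ?thesis using True v by simp
      next
        case False
        have "\<exists>i\<le>n. \<kappa>' i \<noteq> \<kappa> i"
        proof (rule ccontr)
          assume "\<not> ?thesis"
          then have "\<kappa>' = restrict \<kappa> {..n}" using \<kappa>' by (intro ext) (auto simp: PiE_iff extensional_def)
          with False show False by simp
        qed
        then obtain i where "i \<le> n" "\<kappa>' i \<noteq> \<kappa> i" by blast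
        then have "(\<Prod>i\<in>{..n}. intrinsic_volume (\<kappa>' i) (L i)) = 0"
          by (intro prod_zero bexI[of _ i]) (auto simp: v)
        then show ?thesis using False by simp
      qed
    qed
    also have "\<dots> = 1"
    proof -
      have "restrict \<kappa> {..n} \<in> {..n} \<rightarrow>\<^sub>E {..CARD('d)}" using \<kappa> by auto
      then show ?thesis by (simp add: finite_PiE)
    qed
    finally have one: "(\<integral>Q. intrinsic_volume ?m (?E Q) \<partial>?N) = 1" .
    have int: "integrable ?N (\<lambda>Q. intrinsic_volume ?m (?E Q))"
      using F pol by (intro intrinsic_volume_integrable prob_space_family random_rotated polyhedral_rotated) auto
    have "(\<integral>Q. 1 - intrinsic_volume ?m (?E Q) \<partial>?N) = 0"
      using one int prob_space.prob_space[OF prob_space_family[of "{..n}"]]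
        prob_space.finite_measure[OF prob_space_family[of "{..n}"]]
      by (subst Bochner_Integration.integral_diff) (auto simp: finite_measure.integrable_const)
    then have "AE Q in ?N. 1 - intrinsic_volume ?m (?E Q) = 0"
      using int prob_space.finite_measure[OF prob_space_family[of "{..n}"]]
      by (subst (asm) integral_nonneg_eq_0_iff_AE) (auto simp: ve finite_measure.integrable_const)
    then show ?thesis
      by eventually_elim (auto simp: ve split: if_splits)
  qed
  show ?thesis
    unfolding generic_dim_def
  proof (rule the_equality)
    show "\<forall>(H :: (real^'d^'d) measure) (L :: nat \<Rightarrow> (real^'d) set).
       normalized_haar H \<longrightarrow> (\<forall>i\<le>n. subspace (L i) \<and> dim (L i) = \<kappa> i) \<longrightarrow>
       (AE Q in PiM {..n} (\<lambda>_. H). dim (eval_formula F (\<lambda>i. (*v) (Q i) ` L i)) = ?m)"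
      using AE by blast
  next
    fix m
    assume m: "\<forall>(H :: (real^'d^'d) measure) (L :: nat \<Rightarrow> (real^'d) set).
       normalized_haar H \<longrightarrow> (\<forall>i\<le>n. subspace (L i) \<and> dim (L i) = \<kappa> i) \<longrightarrow>
       (AE Q in PiM {..n} (\<lambda>_. H). dim (eval_formula F (\<lambda>i. (*v) (Q i) ` L i)) = m)"
    have "\<exists>S :: (real^'d) set. subspace S \<and> dim S = \<kappa> i" if "i \<le> n" for i
    proof -
      have "\<kappa> i \<le> dim (UNIV :: (real^'d) set)" using \<kappa>[OF that] by (simp add: dim_UNIV)
      then show ?thesis using choose_subspace_of_subspace[of "\<kappa> i" "UNIV :: (real^'d) set"] by metis
    qed
    then obtain L :: "nat \<Rightarrow> (real^'d) set" where L: "\<And>i. i \<le> n \<Longrightarrow> subspace (L i) \<and> dim (L i) = \<kappa> i"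
      by metis
    interpret haar_family "\<lambda>_. H0" by unfold_locales (rule H0)
    have "AE Q in PiM {..n} (\<lambda>_. H0). dim (eval_formula F (\<lambda>i. (*v) (Q i) ` L i)) = m"
      using m H0 L by blast
    moreover have "AE Q in PiM {..n} (\<lambda>_. H0). dim (eval_formula F (\<lambda>i. (*v) (Q i) ` L i)) = ?m"
      by (rule AE[OF H0 L])
    ultimately have "AE Q in PiM {..n} (\<lambda>_ :: nat. H0). m = ?m" by eventually_elim simp
    then show "m = ?m" using prob_space.AE_const[OF prob_space_family[of "{..n}"]] by simp
  qed
qed

section \<open>Read-once formulas of randomly rotated cones\<close>

lemma haar_translate:
  fixes Q :: "'w \<Rightarrow> real^'d^'d"
  assumes M: "prob_space M" and Q: "Q \<in> measurable M orthogonal_group"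
    and H: "normalized_haar (distr M orthogonal_group Q)" and T: "orthogonal_matrix T"
  shows "distr M orthogonal_group (\<lambda>\<omega>. T ** Q \<omega>) = distr M orthogonal_group Q"
proof -
  let ?H = "distr M orthogonal_group Q"
  have m: "(\<lambda>Q. T ** Q) \<in> measurable orthogonal_group orthogonal_group"
    using measurable_haar_ops(1)[OF H T] by (simp cong: measurable_cong_sets)
  have "distr ?H ?H (\<lambda>Q. T ** Q) = ?H" by (rule normalized_haarD(4)[OF H T])
  moreover have "distr ?H ?H (\<lambda>Q. T ** Q) = distr ?H orthogonal_group (\<lambda>Q. T ** Q)"
    by (rule distr_cong) auto
  ultimately show ?thesis
    using distr_distr[OF m Q] by (simp add: comp_def)
qed

theorem theorem1p6:
  fixes C :: "nat \<Rightarrow> (real^'d) set"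
    and T :: "nat \<Rightarrow> real^'d^'d"
    and M :: "'w measure"
    and Q :: "nat \<Rightarrow> 'w \<Rightarrow> real^'d^'d"
    and F :: formula
    and n k :: nat
  assumes "\<And>i. i \<le> n \<Longrightarrow> polyhedral_cone (C i)"
    and "\<And>i. i \<le> n \<Longrightarrow> orthogonal_matrix (T i)"
    and "k \<le> CARD('d)"
    and "set (var_list F) \<subseteq> {..n}"
    and "read_once F"
    and "prob_space M"
    and "prob_space.indep_vars M (\<lambda>_. orthogonal_group) Q {..n}"
    and "\<And>i. i \<le> n \<Longrightarrow> normalized_haar (distr M orthogonal_group (Q i))"
  shows "has_bochner_integral M
     (\<lambda>\<omega>. intrinsic_volume k (eval_formula F (\<lambda>i. (*v) (T i ** Q i \<omega>) ` C i)))
     (\<Sum>\<kappa> | \<kappa> \<in> {..n} \<rightarrow>\<^sub>E {..CARD('d)} \<and> generic_dim TYPE('d) F n \<kappa> = k.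
        \<Prod>i\<le>n. intrinsic_volume (\<kappa> i) (C i))"
proof -
  interpret \<Omega>: prob_space M by fact
  let ?G = "orthogonal_group :: (real^'d^'d) measure"
  \<comment> \<open>The indices beyond \<open>n\<close> only have to carry some Haar measure.\<close>
  define H where "H i = distr M ?G (Q (min i n))" for i
  interpret haar_family H
    by unfold_locales (auto simp: H_def intro: assms(8))
  let ?N = "PiM {..n} H"
  define q where "q \<omega> = (\<lambda>i\<in>{..n}. T i ** Q i \<omega>)" for \<omega>
  have mQ: "Q i \<in> measurable M ?G" if "i \<le> n" for i
    using assms(7) that unfolding \<Omega>.indep_vars_def by auto
  have mT: "(\<lambda>X. T i ** X) \<in> measurable ?G ?G" if "i \<le> n" for i
    using measurable_haar_ops(1)[OF assms(8) assms(2)] that by (simp cong: measurable_cong_sets)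
  have indep: "\<Omega>.indep_vars (\<lambda>_. ?G) (\<lambda>i \<omega>. T i ** Q i \<omega>) {..n}"
    by (rule \<Omega>.indep_vars_compose2[OF assms(7)]) (use mT in auto)
  have TQ: "(\<lambda>\<omega>. T i ** Q i \<omega>) \<in> measurable M ?G" if "i \<in> {..n}" for i
    using measurable_compose[OF mQ mT] that by auto
  have law: "distr M ?N q = ?N"
  proof -
    have "distr M (PiM {..n} (\<lambda>_. ?G)) q = PiM {..n} (\<lambda>i. distr M ?G (\<lambda>\<omega>. T i ** Q i \<omega>))"
      using \<Omega>.indep_vars_iff_distr_eq_PiM'[where I="{..n}" and M'="\<lambda>_. ?G", OF _ TQ] indep
      unfolding q_def by auto
    also have "\<dots> = ?N"
      by (rule PiM_cong) (auto simp: H_def intro!: haar_translate assms mQ)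
    also have "distr M (PiM {..n} (\<lambda>_. ?G)) q = distr M ?N q"
      by (rule distr_cong) (auto simp: H_def intro!: sets_PiM_cong)
    finally show ?thesis .
  qed
  have mq: "q \<in> measurable M ?N"
  proof -
    have "q \<in> measurable M (PiM {..n} (\<lambda>_. ?G))"
      unfolding q_def by (rule measurable_restrict[OF TQ])
    also have "measurable M (PiM {..n} (\<lambda>_. ?G)) = measurable M ?N"
      by (rule measurable_cong_sets) (auto simp: H_def intro!: sets_PiM_cong)
    finally show ?thesis .
  qed
  let ?v = "\<lambda>X. intrinsic_volume k (eval_formula F (rotated C X))"
  have eval: "eval_formula F (\<lambda>i. (*v) (T i ** Q i \<omega>) ` C i) = eval_formula F (rotated C (q \<omega>))" for \<omega>
    using assms(4) by (intro eval_formula_cong) (auto simp: q_def)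
  have int: "integrable ?N ?v"
    using assms(1,4) by (intro intrinsic_volume_integrable prob_space_family random_rotated polyhedral_rotated) auto
  have "integrable M (\<lambda>\<omega>. ?v (q \<omega>))"
    by (rule integrable_distr[OF mq]) (simp only: law int)
  moreover have "(\<integral>\<omega>. ?v (q \<omega>) \<partial>M) = (\<integral>X. ?v X \<partial>?N)"
    using integral_distr[OF mq borel_measurable_integrable[OF int]] by (simp only: law)
  moreover have "(\<integral>X. ?v X \<partial>?N)
    = (\<Sum>\<kappa>\<in>{..n} \<rightarrow>\<^sub>E {..CARD('d)}. if formula_dim (CARD('d)) F \<kappa> = k then \<Prod>i\<in>{..n}. intrinsic_volume (\<kappa> i) (C i) else 0)"
    using expected_in_read_once[OF assms(5), of C] assms(1,3,4) unfolding expected_in_def by simp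
  moreover have "\<dots> = (\<Sum>\<kappa> | \<kappa> \<in> {..n} \<rightarrow>\<^sub>E {..CARD('d)} \<and> generic_dim TYPE('d) F n \<kappa> = k.
        \<Prod>i\<le>n. intrinsic_volume (\<kappa> i) (C i))"
  proof -
    have "(\<Sum>\<kappa>\<in>{..n} \<rightarrow>\<^sub>E {..CARD('d)}. if formula_dim (CARD('d)) F \<kappa> = k then \<Prod>i\<in>{..n}. intrinsic_volume (\<kappa> i) (C i) else 0)
      = (\<Sum>\<kappa>\<in>{..n} \<rightarrow>\<^sub>E {..CARD('d)}. if generic_dim TYPE('d) F n \<kappa> = k then \<Prod>i\<in>{..n}. intrinsic_volume (\<kappa> i) (C i) else 0)"
      using generic_dim_eq[OF assms(8)[of 0] assms(4,5)] by (intro sum.cong refl) (auto simp: PiE_iff)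
    also have "\<dots> = (\<Sum>\<kappa>\<in>{\<kappa> \<in> {..n} \<rightarrow>\<^sub>E {..CARD('d)}. generic_dim TYPE('d) F n \<kappa> = k}. \<Prod>i\<in>{..n}. intrinsic_volume (\<kappa> i) (C i))"
      by (rule sum.inter_filter[symmetric]) (auto intro!: finite_PiE)
    finally show ?thesis by simp
  qed
  ultimately show ?thesis
    unfolding eval by (simp only: has_bochner_integral_iff)
qed

end
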